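(* Assume $\mathbb{E}[\log\xi]<\infty$. Suppose further that there exists a finite set $\mathcal{P}_0\subseteq\mathcal{P}$, $d:=|\mathcal{P}_0|$, such that the distributional tail of $(\lambda_p(\eta))_{p\in\mathcal{P}_0}$ is regularly varying at infinity in the following sense: for some positive function $(a(t))_{t>0}$ and a measure $\nu$ satisfying $\nu(\{x\in\mathbb{R}^d:\|x\|\ge r\})=c\cdot r^{-\alpha}$ for all $r>0$, with $c>0$ and $\alpha\in(0,1)$, it holds $$t\,\mathbb{P}\{(a(t))^{-1}(\lambda_p(\eta))_{p\in\mathcal{P}_0}\in\cdot\}\longrightarrow\nu(\cdot),\quad t\to\infty,$$ vaguely, on the space of locally finite measures on $(0,\infty]^d$ endowed with the vague topology. Suppose that $\mathbb{E}[\lambda_p(\eta)]<\infty$ for $p\in\mathcal{P}\setminus\mathcal{P}_0$, and assume additionally that $$\sum_{p\in\mathcal{P}\setminus\mathcal{P}_0}\mathbb{E}[\lambda_p(\eta)]\log p<\infty.$$ For $n\in\mathbb{N}$ let $L_n:=\mathrm{LCM}(\{\Theta_1,\Theta_2,\ldots,\Theta_n\})$. Then, in the sense of weak convergence of finite-dimensional distributions, $$\left(\frac{\log L_{\lfloor tu\rfloor}}{a(t)}\right)_{u\ge0}\longrightarrow\left(\sum_{p\in\mathcal{P}_0}M_p(u)\log p\right)_{u\ge0},\quad t\to\infty,$$ where $((M_p(u))_{u\ge0})_{p\in\mathcal{P}_0}$ is the multivariate extreme process defined by $$(M_p(u))_{p\in\mathcal{P}_0}=\sup_{k:\,t_k\le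 u}y_k,\quad u\ge0.$$ Here the pairs $(t_k,y_k)$ are the atoms of a Poisson point process on $[0,\infty)\times(0,\infty]^d$ with intensity measure $\mathrm{Leb}\otimes\nu$ ($\mathrm{Leb}$ is Lebesgue measure), and the supremum is taken coordinatewise.
   Context: $\mathbb{N}=\{1,2,\ldots\}$. $(\xi_1,\eta_1),(\xi_2,\eta_2),\ldots$ are independent copies of an $\mathbb{N}^2$-valued random vector $(\xi,\eta)$ with arbitrarily dependent components. $\mathcal{P}$ is the set of prime numbers, and for $n\in\mathbb{N}$, $p\in\mathcal{P}$, $\lambda_p(n)$ is the multiplicity of $p$ in the prime decomposition of $n$, so $n=\prod_{p\in\mathcal{P}}p^{\lambda_p(n)}$. Put $\Pi_0=1$, $\Pi_k=\xi_1\cdots\xi_k$, and $\Theta_k=\Pi_{k-1}\cdot\eta_k$ for $k\in\mathbb{N}$. $\mathrm{LCM}(A)$ is the least common multiple of a finite set $A\subset\mathbb{N}$, with $\mathrm{LCM}(\varnothing)=1$ (so $L_0=1$). $\|\cdot\|$ is a norm on $\mathbb{R}^d$, whose coordinates are indexed by $\mathcal{P}_0$. Locally finite means finite on compact sets, and vague convergence means convergence of integrals of all continuous compactly supported functions. A supremum over the empty set is the zero vector.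
   Formalization: The space (0,∞]^d is replaced by [0,∞]^d∖{0} in the vague convergence, for ν and for the Poisson process; read literally the claim fails for d≥2 (η=6^X or 2^Y with probability 1/2 each, Y of heavier tail than X), since mass on the axes is not seen. *)

theory Defs
  imports "HOL-Probability.Probability" "HOL-Computational_Algebra.Primes"
begin

definition walk_prod :: "(nat \<Rightarrow> 'w \<Rightarrow> nat) \<Rightarrow> nat \<Rightarrow> 'w \<Rightarrow> nat" where
  "walk_prod \<xi> k \<omega> = (\<Prod>i=1..k. \<xi> i \<omega>)"

definition perturbed_walk ::
    "(nat \<Rightarrow> 'w \<Rightarrow> nat) \<Rightarrow> (nat \<Rightarrow> 'w \<Rightarrow> nat) \<Rightarrow> nat \<Rightarrow> 'w \<Rightarrow> nat" where
  "perturbed_walk \<xi> \<eta> k \<omega> = walk_prod \<xi> (k - 1) \<omega> * \<eta> k \<omega>"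

definition walk_lcm ::
    "(nat \<Rightarrow> 'w \<Rightarrow> nat) \<Rightarrow> (nat \<Rightarrow> 'w \<Rightarrow> nat) \<Rightarrow> nat \<Rightarrow> 'w \<Rightarrow> nat" where
  "walk_lcm \<xi> \<eta> n \<omega> = Lcm ((\<lambda>k. perturbed_walk \<xi> \<eta> k \<omega>) ` {1..n})"

definition is_norm :: "('a::real_vector \<Rightarrow> real) \<Rightarrow> bool" where
  "is_norm N \<longleftrightarrow>
     (\<forall>x. N x = 0 \<longleftrightarrow> x = 0) \<and>
     (\<forall>r x. N (r *\<^sub>R x) = \<bar>r\<bar> * N x) \<and>
     (\<forall>x y. N (x + y) \<le> N x + N y)"

text \<open>The compactified orthant without the origin, i.e. the cube \<open>[0,\<infinity>]\<^sup>d\<close> minus \<open>0\<close>. Its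
  relatively compact subsets are those bounded away from the origin. This is the usual state
  space for multivariate regular variation: points with some but not all coordinates equal
  to zero belong to it. Functions carry the product topology.\<close>

definition punctured_orthant :: "('d::finite \<Rightarrow> ennreal) set" where
  "punctured_orthant = - {\<lambda>_. 0}"

definition locally_finite_on :: "'a::topological_space set \<Rightarrow> 'a measure \<Rightarrow> bool" where
  "locally_finite_on E \<nu> \<longleftrightarrow> (\<forall>K. compact K \<and> K \<subseteq> E \<longrightarrow> emeasure \<nu> K < \<infinity>)"

definition vaguely_converges_on ::
    "'a::topological_space set \<Rightarrow> ('t \<Rightarrow> 'a measure) \<Rightarrow> 'a measure \<Rightarrow> 't filter \<Rightarrow> bool" where
  "vaguely_converges_on E \<mu> \<nu> F \<longleftrightarrow>
     (\<forall>f :: 'a \<Rightarrow> real.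
        continuous_on E f \<and> (\<exists>K. compact K \<and> K \<subseteq> E \<and> (\<forall>x\<in>E - K. f x = 0)) \<longrightarrow>
        ((\<lambda>t. \<integral>x. f x \<partial>\<mu> t) \<longlongrightarrow> (\<integral>x. f x \<partial>\<nu>)) F)"

definition num_points :: "'a set \<Rightarrow> 'a set \<Rightarrow> ennreal" where
  "num_points S B = emeasure (count_space UNIV) (S \<inter> B)"

text \<open>A Poisson point process as a random countable set of points (atoms). For intensities
  without atoms, such as products with Lebesgue measure, the process is almost surely simple,
  so that no multiplicities have to be recorded.\<close>

definition poisson_point_process ::
    "'w measure \<Rightarrow> 'a measure \<Rightarrow> ('w \<Rightarrow> 'a set) \<Rightarrow> bool" where
  "poisson_point_process M \<mu> \<Phi> \<longleftrightarrow>
     prob_space M \<and>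
     (\<forall>\<omega>\<in>space M. countable (\<Phi> \<omega>) \<and> \<Phi> \<omega> \<subseteq> space \<mu>) \<and>
     (\<forall>B\<in>sets \<mu>. (\<lambda>\<omega>. num_points (\<Phi> \<omega>) B) \<in> borel_measurable M) \<and>
     (\<forall>B\<in>sets \<mu>. emeasure \<mu> B < \<infinity> \<longrightarrow>
        (\<forall>k::nat. measure M {\<omega>\<in>space M. num_points (\<Phi> \<omega>) B = of_nat k} =
                  exp (- measure \<mu> B) * measure \<mu> B ^ k / fact k)) \<and>
     (\<forall>(I::nat set) A. finite I \<and> A ` I \<subseteq> sets \<mu> \<and> disjoint_family_on A I \<longrightarrow>
        prob_space.indep_vars M (\<lambda>_. borel) (\<lambda>i \<omega>. num_points (\<Phi> \<omega>) (A i)) I)"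

text \<open>The supremum is the pointwise one on functions, so it is taken coordinatewise, and the
  supremum of the empty set is the zero vector.\<close>

definition extreme_process ::
    "('w \<Rightarrow> (real \<times> ('d \<Rightarrow> ennreal)) set) \<Rightarrow> real \<Rightarrow> 'w \<Rightarrow> 'd \<Rightarrow> ennreal" where
  "extreme_process \<Phi> u \<omega> = Sup {y. \<exists>s. (s, y) \<in> \<Phi> \<omega> \<and> s \<le> u}"

text \<open>Weak convergence of the finite-dimensional distributions of processes indexed by \<open>T\<close>.
  For finite \<open>I\<close> the product topology is that of the Euclidean space with coordinates in \<open>I\<close>.\<close>

definition fdd_converges ::
    "'i set \<Rightarrow> 'v measure \<Rightarrow> ('t \<Rightarrow> 'i \<Rightarrow> 'v \<Rightarrow> real) \<Rightarrow> 'w measure \<Rightarrow> ('i \<Rightarrow> 'w \<Rightarrow> real)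
      \<Rightarrow> 't filter \<Rightarrow> bool" where
  "fdd_converges T M X M' Z F \<longleftrightarrow>
     (\<forall>t. \<forall>u\<in>T. X t u \<in> borel_measurable M) \<and>
     (\<forall>u\<in>T. Z u \<in> borel_measurable M') \<and>
     (\<forall>I f. finite I \<and> I \<subseteq> T \<and>
        continuous_map (product_topology (\<lambda>_. euclideanreal) I) euclideanreal f \<and>
        bounded (f ` (I \<rightarrow>\<^sub>E UNIV)) \<longrightarrow>
        ((\<lambda>t. \<integral>\<omega>. f (\<lambda>u\<in>I. X t u \<omega>) \<partial>M) \<longlongrightarrow> (\<integral>\<omega>. f (\<lambda>u\<in>I. Z u \<omega>) \<partial>M')) F)"

end

theory Submission
  imports Defs
begin

text \<open>
  Two separate reasons make the theorem true. The first is that only the maxima of the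
  multiplicities \<open>\<lambda>\<^sub>p(\<eta>\<^sub>k)\<close> with \<open>p\<close> in \<open>P0\<close> matter. Each \<open>\<Theta>\<^sub>k\<close> with \<open>k \<le> n\<close> divides
  the product of \<open>\<xi>\<^sub>1 \<dots> \<xi>\<^sub>n\<close>, of the largest powers of the primes in \<open>P0\<close> that occur
  in \<open>\<eta>\<^sub>1, \<dots>, \<eta>\<^sub>n\<close>, and of the parts of \<open>\<eta>\<^sub>1, \<dots>, \<eta>\<^sub>n\<close> coprime to \<open>P0\<close>; the second factor
  divides the least common multiple. Hence \<open>ln L\<^sub>n\<close> exceeds
  \<open>\<Sum>\<^sub>p ln p \<cdot> max\<^sub>k \<lambda>\<^sub>p(\<eta>\<^sub>k)\<close> by a nonnegative amount whose mean is at most linear in \<open>n\<close>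
  (\<open>ln_lcm_of_perturbed_products\<close>, \<open>integrable_ln_coprime_part\<close>). Because \<open>\<alpha> < 1\<close>, the
  normalization satisfies \<open>a(t)/t \<longlonglongrightarrow> \<infinity>\<close> (\<open>normalization_superlinear\<close>), so that this excess
  disappears in the limit.

  The second is the classical limit theorem for maxima of independent heavy-tailed vectors.
  The joint distribution function of the maxima at finitely many times is a product of powers
  of probabilities \<open>1 - q\<close>, where \<open>q\<close> is the probability that one normalized vector exceeds
  a level; vague convergence says that \<open>t q\<close> tends to the \<open>\<nu>\<close>-mass of the exceedance set. The
  product therefore tends to \<open>exp\<close> of minus the intensity of a region of space-time
  (\<open>block_maxima_distribution\<close>), which is the probability that the Poisson process has no point
  in it, that is, the joint distribution function of the extreme process
  (\<open>real_extreme_distribution\<close>).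

  Laplace transforms connect the two. With \<open>V = exp (- X)\<close>, a nonnegative random vector becomes
  a vector in a unit cube, its Laplace transform becomes a mixed moment, and a mixed moment is an
  average of distribution functions, up to a uniformly small error
  (\<open>moment_convergence_from_distribution_functions\<close>). By the Stone-Weierstrass theorem the moments
  control all continuous functions on the cube, and as the limit is finite nothing escapes
  through the face where a coordinate of \<open>V\<close> vanishes (\<open>fdd_convergence_from_laplace\<close>).
  Moreover, Laplace transforms hardly change under perturbations that are small in mean
  (\<open>laplace_perturbation\<close>), which is how the excess above is removed.

  Finiteness of the limit needs that \<open>\<nu>\<close> puts no mass on points with an infinite coordinate
  (\<open>inf_mass_zero\<close>). The norm condition describes \<open>\<nu>\<close> only at finite points, but mass at infinity would
  contradict the convergence of the tails along both scales \<open>a(t)\<close> and \<open>a(2t)\<close>. The growth of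
  \<open>a\<close> comes from a comparison of the same kind.
\<close>

section \<open>Limits of approximations and step functions\<close>

lemma tendsto_by_approximation:
  fixes x :: "'t \<Rightarrow> real"
  assumes "\<And>e. e > 0 \<Longrightarrow> \<exists>A l. (A \<longlongrightarrow> l) F \<and> (\<forall>\<^sub>F t in F. \<bar>x t - A t\<bar> \<le> e) \<and> \<bar>y - l\<bar> \<le> e"
  shows "(x \<longlongrightarrow> y) F"
proof (rule tendstoI)
  fix e :: real assume "e > 0"
  then have "e / 4 > 0" by simp
  from assms[OF this] obtain A l where A: "(A \<longlongrightarrow> l) F" "\<forall>\<^sub>F t in F. \<bar>x t - A t\<bar> \<le> e / 4" "\<bar>y - l\<bar> \<le> e / 4"
    by blast
  from tendstoD[OF A(1) \<open>e / 4 > 0\<close>] A(2) show "\<forall>\<^sub>F t in F. dist (x t) y < e"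
  proof eventually_elim
    case (elim t)
    with A(3) \<open>e > 0\<close> show ?case unfolding dist_real_def by linarith
  qed
qed

lemma tendsto_between_sequences:
  fixes x :: "'t \<Rightarrow> real" and l u :: "nat \<Rightarrow> real"
  assumes "\<And>n. (L n \<longlongrightarrow> l n) F" "\<And>n. (U n \<longlongrightarrow> u n) F"
    and "\<And>n. \<forall>\<^sub>F t in F. L n t \<le> x t" "\<And>n. \<forall>\<^sub>F t in F. x t \<le> U n t"
    and "l \<longlonglongrightarrow> y" "u \<longlonglongrightarrow> y"
  shows "(x \<longlongrightarrow> y) F"
proof (rule order_tendstoI)
  fix z assume "z < y"
  then have "\<forall>\<^sub>F n in sequentially. z < l n"
    using assms(5) order_tendstoD(1) by blast
  then obtain n where "z < l n" by (meson eventually_happens sequentially_bot)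
  then have "\<forall>\<^sub>F t in F. z < L n t" using assms(1) order_tendstoD(1) by blast
  with assms(3)[of n] show "\<forall>\<^sub>F t in F. z < x t" by eventually_elim simp
next
  fix z assume "y < z"
  then have "\<forall>\<^sub>F n in sequentially. u n < z"
    using assms(6) order_tendstoD(2) by blast
  then obtain n where "u n < z" by (meson eventually_happens sequentially_bot)
  then have "\<forall>\<^sub>F t in F. U n t < z" using assms(2) order_tendstoD(2) by blast
  with assms(4)[of n] show "\<forall>\<^sub>F t in F. x t < z" by eventually_elim simp
qed

lemma countable_avoid:
  fixes D :: "real set"
  assumes "countable D" "a < b"
  obtains r where "a < r" "r < b" "r \<notin> D"
  by (meson assms real_interval_avoid_countable_set greaterThanLessThan_iff)

text \<open>
  A number \<open>v\<close> in the unit interval is the integral of \<open>x \<mapsto> [x \<le> v]\<close>; the sum below is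
  a Riemann sum of this integral. The node in each cell is free, so that it can later be chosen
  outside a countable set of discontinuities.
\<close>

lemma counting_fraction_error:
  fixes v :: real
  assumes "m > 0" "0 \<le> v" "v \<le> 1"
    and b: "\<And>l. l < m \<Longrightarrow> real l / m < b l \<and> b l < (real l + 1) / m"
  shows "\<bar>(\<Sum>l<m. if b l \<le> v then 1 / real m else 0) - v\<bar> \<le> 1 / real m"
proof -
  define A where "A = {l. l < m \<and> b l \<le> v}"
  have [simp]: "finite A" by (simp add: A_def)
  have s: "(\<Sum>l<m. if b l \<le> v then 1 / real m else 0) = real (card A) / m"
    by (simp add: sum.If_cases A_def lessThan_def Collect_conj_eq[symmetric])
  have mv: "0 \<le> real m * v" "real m * v \<le> m" using assms by (auto simp: mult_left_le)
  have "A \<subseteq> {..<nat \<lceil>real m * v\<rceil>}"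
  proof
    fix l assume "l \<in> A"
    then have "real l / m < v" using b[of l] by (auto simp: A_def)
    then have "real l < real m * v" using assms(1) by (simp add: field_simps)
    then show "l \<in> {..<nat \<lceil>real m * v\<rceil>}" by (simp, linarith)
  qed
  then have "card A \<le> nat \<lceil>real m * v\<rceil>" by (metis card_lessThan card_mono finite_lessThan)
  then have 1: "real (card A) \<le> real m * v + 1" using mv by linarith
  have "{..<nat \<lfloor>real m * v\<rfloor>} \<subseteq> A"
  proof
    fix l assume "l \<in> {..<nat \<lfloor>real m * v\<rfloor>}"
    then have l: "real l + 1 \<le> real m * v" by (simp, linarith)
    then have "l < m" using mv by linarith
    moreover have "(real l + 1) / m \<le> v" using l assms(1) by (simp add: field_simps)
    ultimately show "l \<in> A" using b[of l] by (auto simp: A_def)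
  qed
  then have "nat \<lfloor>real m * v\<rfloor> \<le> card A"
    by (metis \<open>finite A\<close> card_lessThan card_mono)
  then have 2: "real m * v - 1 \<le> real (card A)" using mv by linarith
  have "\<bar>real (card A) - real m * v\<bar> \<le> 1" using 1 2 by linarith
  then have "\<bar>real (card A) - real m * v\<bar> / m \<le> 1 / m"
    using assms(1) by (intro divide_right_mono) auto
  also have "\<bar>real (card A) - real m * v\<bar> / m = \<bar>real (card A) / m - v\<bar>"
  proof -
    have "real (card A) / m - v = (real (card A) - real m * v) / m"
      using assms(1) by (simp add: field_simps)
    then show ?thesis using assms(1) by simp
  qed
  finally show ?thesis using s by simp
qed

text \<open>
  Replacing every factor by its Riemann sum and expanding the product turns a mixed moment into an
  average of values of the joint distribution function of the \<open>v k\<close>.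
\<close>

lemma expectation_prod_step:
  fixes v :: "'k \<Rightarrow> 'w \<Rightarrow> real"
  assumes "prob_space M" "finite K" "m > 0"
    and meas: "\<And>k. k \<in> K \<Longrightarrow> v k \<in> borel_measurable M"
    and rng: "\<And>k \<omega>. k \<in> K \<Longrightarrow> \<omega> \<in> space M \<Longrightarrow> 0 \<le> v k \<omega> \<and> v k \<omega> \<le> 1"
    and b: "\<And>k l. k \<in> K \<Longrightarrow> l < m \<Longrightarrow> real l / m < b k l \<and> b k l < (real l + 1) / m"
  shows "\<bar>(\<integral>\<omega>. (\<Prod>k\<in>K. v k \<omega>) \<partial>M) -
     (\<Sum>g\<in>Pi\<^sub>E K (\<lambda>_. {..<m}). (1 / real m) ^ card K * measure M {\<omega>\<in>space M. \<forall>k\<in>K. b k (g k) \<le> v k \<omega>})\<bar>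
     \<le> card K / m"
proof -
  let ?A = "\<lambda>g. {\<omega>\<in>space M. \<forall>k\<in>K. b k (g k) \<le> v k \<omega>}"
  let ?I = "Pi\<^sub>E K (\<lambda>_. {..<m})"
  let ?c = "(1 / real m) ^ card K"
  interpret prob_space M by fact
  define q where "q k \<omega> = (\<Sum>l<m. if b k l \<le> v k \<omega> then 1 / real m else 0)" for k \<omega>
  have q01: "0 \<le> q k \<omega> \<and> q k \<omega> \<le> 1" for k \<omega>
  proof
    show "0 \<le> q k \<omega>" unfolding q_def by (intro sum_nonneg) auto
    have "q k \<omega> \<le> (\<Sum>l<m. 1 / real m)" unfolding q_def by (intro sum_mono) auto
    then show "q k \<omega> \<le> 1" using assms(3) by simp
  qed
  have qm: "q k \<in> borel_measurable M" if "k \<in> K" for k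
    unfolding q_def using meas[OF that] by measurable
  have S: "?A g \<in> sets M" for g
    using assms(2) meas by measurable
  have eq: "(\<Prod>k\<in>K. q k \<omega>) = (\<Sum>g\<in>?I. ?c * indicator (?A g) \<omega>)"
    if "\<omega> \<in> space M" for \<omega>
  proof -
    have "(\<Prod>k\<in>K. q k \<omega>) = (\<Sum>g\<in>?I. \<Prod>k\<in>K. if b k (g k) \<le> v k \<omega> then 1 / real m else 0)"
      unfolding q_def by (rule prod_sum_PiE) (use assms in auto)
    also have "\<dots> = (\<Sum>g\<in>?I. ?c * indicator (?A g) \<omega>)"
    proof (rule sum.cong[OF refl])
      fix g
      show "(\<Prod>k\<in>K. if b k (g k) \<le> v k \<omega> then 1 / real m else 0) =
        ?c * indicator (?A g) \<omega>"
      proof (cases "\<forall>k\<in>K. b k (g k) \<le> v k \<omega>")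
        case True
        then have "(\<Prod>k\<in>K. if b k (g k) \<le> v k \<omega> then 1 / real m else 0) = (\<Prod>k\<in>K. 1 / real m)"
          by (intro prod.cong) auto
        then show ?thesis using True that by simp
      next
        case False
        then have "(\<Prod>k\<in>K. if b k (g k) \<le> v k \<omega> then 1 / real m else 0) = 0"
          using assms(2) by (intro prod_zero) auto
        then show ?thesis using False by (simp add: indicator_def)
      qed
    qed
    finally show ?thesis .
  qed
  have Eq: "(\<integral>\<omega>. (\<Prod>k\<in>K. q k \<omega>) \<partial>M) = (\<Sum>g\<in>?I. ?c * measure M (?A g))"
  proof -
    have "(\<integral>\<omega>. (\<Prod>k\<in>K. q k \<omega>) \<partial>M) = (\<integral>\<omega>. (\<Sum>g\<in>?I. ?c * indicator (?A g) \<omega>) \<partial>M)"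
      by (intro Bochner_Integration.integral_cong refl eq)
    also have "\<dots> = (\<Sum>g\<in>?I. ?c * measure M (?A g))"
      using S by (subst Bochner_Integration.integral_sum) (auto simp: emeasure_eq_measure)
    finally show ?thesis .
  qed
  have bound: "\<bar>\<Prod>k\<in>K. h k\<bar> \<le> 1" if "\<And>k. k \<in> K \<Longrightarrow> 0 \<le> h k \<and> h k \<le> 1" for h :: "'k \<Rightarrow> real"
    using that by (simp add: abs_prod prod_le_1)
  have iv: "integrable M (\<lambda>\<omega>. \<Prod>k\<in>K. v k \<omega>)"
    by (rule integrable_const_bound[where B=1]) (use meas rng bound in \<open>auto intro!: AE_I2\<close>)
  have iq: "integrable M (\<lambda>\<omega>. \<Prod>k\<in>K. q k \<omega>)"
    by (rule integrable_const_bound[where B=1]) (use qm q01 bound in \<open>auto intro!: AE_I2\<close>)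
  have "\<bar>(\<Prod>k\<in>K. v k \<omega>) - (\<Prod>k\<in>K. q k \<omega>)\<bar> \<le> card K / m" if "\<omega> \<in> space M" for \<omega>
  proof -
    have "norm ((\<Prod>k\<in>K. v k \<omega>) - (\<Prod>k\<in>K. q k \<omega>)) \<le> (\<Sum>k\<in>K. norm (v k \<omega> - q k \<omega>))"
      by (rule norm_prod_diff) (use rng that q01 in auto)
    also have "\<dots> \<le> (\<Sum>k\<in>K. 1 / real m)"
    proof (rule sum_mono)
      fix k assume "k \<in> K"
      then show "norm (v k \<omega> - q k \<omega>) \<le> 1 / real m"
        using counting_fraction_error[of m "v k \<omega>" "b k"] b[of k] rng[of k \<omega>] that assms(3)
        by (auto simp: q_def abs_minus_commute)
    qed
    finally show ?thesis by simp
  qed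
  then have "(\<integral>\<omega>. \<bar>(\<Prod>k\<in>K. v k \<omega>) - (\<Prod>k\<in>K. q k \<omega>)\<bar> \<partial>M) \<le> (\<integral>\<omega>. card K / m \<partial>M)"
    using iv iq by (intro integral_mono) auto
  moreover have "\<bar>(\<integral>\<omega>. (\<Prod>k\<in>K. v k \<omega>) \<partial>M) - (\<integral>\<omega>. (\<Prod>k\<in>K. q k \<omega>) \<partial>M)\<bar> \<le> (\<integral>\<omega>. \<bar>(\<Prod>k\<in>K. v k \<omega>) - (\<Prod>k\<in>K. q k \<omega>)\<bar> \<partial>M)"
    unfolding Bochner_Integration.integral_diff[OF iv iq, symmetric] by (rule integral_abs_bound)
  ultimately show ?thesis using Eq by (simp add: prob_space)
qed

lemma moment_convergence_from_distribution_functions: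
  fixes v :: "'t \<Rightarrow> 'k \<Rightarrow> 'w \<Rightarrow> real" and w :: "'k \<Rightarrow> 'v \<Rightarrow> real"
  assumes "prob_space M" "prob_space M'" "finite K"
    and "\<And>t k. k \<in> K \<Longrightarrow> v t k \<in> borel_measurable M"
    and "\<And>k. k \<in> K \<Longrightarrow> w k \<in> borel_measurable M'"
    and ev: "\<forall>\<^sub>F t in F. \<forall>k\<in>K. \<forall>\<omega>\<in>space M. 0 \<le> v t k \<omega> \<and> v t k \<omega> \<le> 1"
    and "\<And>k \<omega>. k \<in> K \<Longrightarrow> \<omega> \<in> space M' \<Longrightarrow> 0 \<le> w k \<omega> \<and> w k \<omega> \<le> 1"
    and D: "\<And>k. k \<in> K \<Longrightarrow> countable (D k)"
    and conv: "\<And>b. (\<And>k. k \<in> K \<Longrightarrow> 0 < b k \<and> b k < 1 \<and> b k \<notin> D k) \<Longrightarrow>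
       ((\<lambda>t. measure M {\<omega>\<in>space M. \<forall>k\<in>K. b k \<le> v t k \<omega>}) \<longlongrightarrow>
        measure M' {\<omega>\<in>space M'. \<forall>k\<in>K. b k \<le> w k \<omega>}) F"
  shows "((\<lambda>t. \<integral>\<omega>. (\<Prod>k\<in>K. v t k \<omega>) \<partial>M) \<longlongrightarrow> (\<integral>\<omega>. (\<Prod>k\<in>K. w k \<omega>) \<partial>M')) F"
proof (rule tendsto_by_approximation)
  fix e :: real assume "e > 0"
  obtain m0 :: nat where m0: "real (card K) / e < m0" using reals_Archimedean2 by blast
  define m where "m = Suc m0"
  have m: "m > 0" "card K / m \<le> e"
    using m0 \<open>e > 0\<close> by (auto simp: m_def field_simps intro: less_imp_le less_trans)
  have "\<exists>r. real l / m < r \<and> r < (real l + 1) / m \<and> r \<notin> D k" if "k \<in> K" for k l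
    using countable_avoid[OF D[OF that], of "real l / m" "(real l + 1) / m"] m
    by (metis divide_strict_right_mono less_add_one of_nat_0_less_iff)
  then obtain b where b: "\<And>k l. k \<in> K \<Longrightarrow> real l / m < b k l \<and> b k l < (real l + 1) / m \<and> b k l \<notin> D k"
    by metis
  let ?A = "\<lambda>N x. \<Sum>g\<in>Pi\<^sub>E K (\<lambda>_. {..<m}). (1 / real m) ^ card K * measure N {\<omega>\<in>space N. \<forall>k\<in>K. b k (g k) \<le> x k \<omega>}"
  have c: "((\<lambda>t. ?A M (v t)) \<longlongrightarrow> ?A M' w) F"
  proof (intro tendsto_intros conv)
    fix g k assume g: "g \<in> Pi\<^sub>E K (\<lambda>_. {..<m})" "k \<in> K"
    then have "g k < m" by (auto simp: PiE_iff)
    then have "(real (g k) + 1) / m \<le> 1" "0 \<le> real (g k) / m" using m(1) by (auto simp: field_simps)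
    then show "0 < b k (g k) \<and> b k (g k) < 1 \<and> b k (g k) \<notin> D k"
      using b[OF g(2), of "g k"] by linarith
  qed
  have 1: "\<forall>\<^sub>F t in F. \<bar>(\<integral>\<omega>. (\<Prod>k\<in>K. v t k \<omega>) \<partial>M) - ?A M (v t)\<bar> \<le> e"
    using ev
  proof eventually_elim
    case (elim t)
    show ?case
      by (rule order_trans[OF expectation_prod_step m(2)]) (use assms elim b m in auto)
  qed
  have 2: "\<bar>(\<integral>\<omega>. (\<Prod>k\<in>K. w k \<omega>) \<partial>M') - ?A M' w\<bar> \<le> e"
    by (rule order_trans[OF expectation_prod_step m(2)]) (use assms b m in auto)
  show "\<exists>A l. (A \<longlongrightarrow> l) F \<and> (\<forall>\<^sub>F t in F. \<bar>(\<integral>\<omega>. (\<Prod>k\<in>K. v t k \<omega>) \<partial>M) - A t\<bar> \<le> e) \<and> \<bar>(\<integral>\<omega>. (\<Prod>k\<in>K. w k \<omega>) \<partial>M') - l\<bar> \<le> e"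
    using c 1 2 by blast
qed

section \<open>Weak convergence from Laplace transforms\<close>

text \<open>
  The linear span of the monomials, on which convergence of expectations can be checked by
  induction. That it is closed under products is what makes it an algebra.
\<close>

inductive_set monomial_span :: "nat \<Rightarrow> ((nat \<Rightarrow> real) \<Rightarrow> real) set" for n where
  monomial: "(\<lambda>v. c * (\<Prod>k<n. v k ^ e k)) \<in> monomial_span n"
| add: "f \<in> monomial_span n \<Longrightarrow> g \<in> monomial_span n \<Longrightarrow> (\<lambda>v. f v + g v) \<in> monomial_span n"

text \<open>
  The coordinates beyond \<open>n\<close> are fixed at 0, so that the first \<open>n\<close> coordinate functions separate
  points. As the index type is countable, the function space is
  Hausdorff, which the Stone-Weierstrass theorem requires.
\<close>

definition unit_cube :: "nat \<Rightarrow> (nat \<Rightarrow> real) set" where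
  "unit_cube n = Pi\<^sub>E UNIV (\<lambda>k. if k < n then {0..1} else {0})"

lemma compact_unit_cube: "compact (unit_cube n)"
proof -
  have "compactin (product_topology (\<lambda>_. euclidean) UNIV) (unit_cube n)"
    unfolding unit_cube_def compactin_PiE by (auto simp: compactin_euclidean_iff)
  then show ?thesis by (simp add: euclidean_product_topology compactin_euclidean_iff)
qed

lemma unit_cube_iff: "v \<in> unit_cube n \<longleftrightarrow> (\<forall>k. (k < n \<longrightarrow> 0 \<le> v k \<and> v k \<le> 1) \<and> (\<not> k < n \<longrightarrow> v k = 0))"
  unfolding unit_cube_def PiE_iff by simp

lemma unit_cube_coord: "v \<in> unit_cube n \<Longrightarrow> 0 \<le> v k \<and> v k \<le> 1"
  unfolding unit_cube_iff by (metis order_refl zero_le_one)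

lemma monomial_span_mult:
  assumes "f \<in> monomial_span n" "g \<in> monomial_span n"
  shows "(\<lambda>v. f v * g v) \<in> monomial_span n"
  using assms
proof (induction f)
  case (monomial c e)
  show ?case using monomial.prems
  proof (induction g)
    case (monomial c' e')
    have "(\<lambda>v. (c * (\<Prod>k<n. v k ^ e k)) * (c' * (\<Prod>k<n. v k ^ e' k))) =
      (\<lambda>v. (c * c') * (\<Prod>k<n. v k ^ (e k + e' k)))"
      by (simp add: power_add prod.distrib fun_eq_iff)
    then show ?case by (metis monomial_span.monomial)
  next
    case (add f g)
    then show ?case by (simp add: distrib_left monomial_span.add)
  qed
next
  case (add f g)
  then show ?case by (simp add: distrib_right monomial_span.add)
qed

lemma function_ring_monomial_span: "function_ring_on (monomial_span n) (unit_cube n)"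
proof
  show "compact (unit_cube n)" by (rule compact_unit_cube)
next
  fix f assume "f \<in> monomial_span n"
  then show "continuous_on (unit_cube n) f"
  proof induction
    case (monomial c e)
    show ?case
      by (intro continuous_intros continuous_on_subset[OF continuous_on_product_coordinates]) auto
  qed (auto intro: continuous_intros)
next
  fix c :: real
  have "(\<lambda>v. c * (\<Prod>k<n. v k ^ (\<lambda>_. 0) k)) \<in> monomial_span n"
    by (rule monomial_span.monomial)
  then show "(\<lambda>_. c) \<in> monomial_span n" by simp
next
  fix x y :: "nat \<Rightarrow> real" assume xy: "x \<in> unit_cube n" "y \<in> unit_cube n" "x \<noteq> y"
  then obtain j where j: "x j \<noteq> y j" by auto
  then have "j < n" using xy unfolding unit_cube_iff by metis
  have eq: "(\<Prod>k<n. v k ^ (if k = j then 1 else 0)) = v j" for v :: "nat \<Rightarrow> real"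
  proof -
    have "(\<Prod>k<n. v k ^ (if k = j then 1 else 0)) = (\<Prod>k<n. if k = j then v k else 1)"
      by (intro prod.cong) auto
    then show ?thesis using \<open>j < n\<close> by simp
  qed
  have "(\<lambda>v. 1 * (\<Prod>k<n. v k ^ (if k = j then 1 else 0))) \<in> monomial_span n"
    by (rule monomial_span.monomial)
  then have "(\<lambda>v. v j) \<in> monomial_span n" unfolding eq by simp
  then show "\<exists>f\<in>monomial_span n. f x \<noteq> f y" by (rule rev_bexI) (rule j)
qed (fact monomial_span.add monomial_span_mult)+

lemma integrable_monomial_span:
  assumes "prob_space M" "\<And>k. (\<lambda>\<omega>. V \<omega> k) \<in> borel_measurable M"
    and V: "\<And>\<omega>. \<omega> \<in> space M \<Longrightarrow> V \<omega> \<in> unit_cube n" and "f \<in> monomial_span n"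
  shows "integrable M (\<lambda>\<omega>. f (V \<omega>))"
  using assms(4)
proof induction
  case (monomial c e)
  interpret prob_space M by fact
  show ?case
  proof (intro integrable_mult_right integrable_const_bound[where B=1] AE_I2)
    fix \<omega> assume "\<omega> \<in> space M"
    show "norm (\<Prod>k<n. V \<omega> k ^ e k) \<le> 1"
      using unit_cube_coord[OF V[OF \<open>\<omega> \<in> space M\<close>]]
      by (auto simp: abs_prod intro!: prod_le_1 power_le_one)
  qed (use assms in measurable)
qed auto

lemma integrable_continuous_on_unit_cube:
  assumes "prob_space M" "\<And>k. (\<lambda>\<omega>. V \<omega> k) \<in> borel_measurable M"
    and V: "\<And>\<omega>. \<omega> \<in> space M \<Longrightarrow> V \<omega> \<in> unit_cube n" and G: "continuous_on (unit_cube n) G"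
  shows "integrable M (\<lambda>\<omega>. G (V \<omega>) :: real)"
proof -
  interpret prob_space M by fact
  interpret function_ring_on "monomial_span n" "unit_cube n"
    by (rule function_ring_monomial_span)
  have "\<exists>g \<in> monomial_span n. \<forall>x\<in>unit_cube n. \<bar>G x - g x\<bar> < 1 / Suc m" for m
    by (rule Stone_Weierstrass_basic[OF G]) simp
  then obtain g where g: "\<And>m. g m \<in> monomial_span n"
    "\<And>m x. x \<in> unit_cube n \<Longrightarrow> \<bar>G x - g m x\<bar> < 1 / Suc m" by metis
  have "(\<lambda>\<omega>. G (V \<omega>)) \<in> borel_measurable M"
  proof (rule borel_measurable_LIMSEQ_real)
    fix \<omega> assume "\<omega> \<in> space M"
    have "(\<lambda>m. G (V \<omega>) - g m (V \<omega>)) \<longlonglongrightarrow> 0"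
      by (rule Lim_null_comparison[OF _ LIMSEQ_inverse_real_of_nat])
         (use g(2)[OF V[OF \<open>\<omega> \<in> space M\<close>]] in \<open>auto intro!: always_eventually less_imp_le simp: inverse_eq_divide\<close>)
    from tendsto_diff[OF tendsto_const[of "G (V \<omega>)"] this]
    show "(\<lambda>m. g m (V \<omega>)) \<longlonglongrightarrow> G (V \<omega>)" by simp
  next
    fix m show "(\<lambda>\<omega>. g m (V \<omega>)) \<in> borel_measurable M"
      using integrable_monomial_span[OF assms(1-3) g(1)] by auto
  qed
  moreover have "bounded (G ` unit_cube n)"
    using compact_continuous_image[OF G compact_unit_cube] compact_imp_bounded by blast
  then obtain B where "\<forall>x\<in>unit_cube n. \<bar>G x\<bar> \<le> B" by (auto simp: bounded_real)
  ultimately show ?thesis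
    using V by (intro integrable_const_bound[where B=B]) auto
qed

lemma uniform_approximation_expectation:
  fixes G :: "(nat \<Rightarrow> real) \<Rightarrow> real"
  assumes "prob_space N" "\<And>k. (\<lambda>\<omega>. U \<omega> k) \<in> borel_measurable N" "\<And>\<omega>. \<omega> \<in> space N \<Longrightarrow> U \<omega> \<in> unit_cube n"
    and "continuous_on (unit_cube n) G" "g \<in> monomial_span n"
    and g: "\<And>x. x \<in> unit_cube n \<Longrightarrow> \<bar>G x - g x\<bar> < e"
  shows "\<bar>(\<integral>\<omega>. G (U \<omega>) \<partial>N) - (\<integral>\<omega>. g (U \<omega>) \<partial>N)\<bar> \<le> e"
proof -
  interpret N: prob_space N by fact
  have i: "integrable N (\<lambda>\<omega>. G (U \<omega>))" "integrable N (\<lambda>\<omega>. g (U \<omega>))"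
    using integrable_continuous_on_unit_cube[OF assms(1-4)] integrable_monomial_span[OF assms(1-3) assms(5)] by auto
  have "\<bar>(\<integral>\<omega>. G (U \<omega>) \<partial>N) - (\<integral>\<omega>. g (U \<omega>) \<partial>N)\<bar> \<le> (\<integral>\<omega>. \<bar>G (U \<omega>) - g (U \<omega>)\<bar> \<partial>N)"
    unfolding Bochner_Integration.integral_diff[OF i, symmetric] by (rule integral_abs_bound)
  also have "\<dots> \<le> (\<integral>\<omega>. e \<partial>N)"
    using i g assms(3) by (intro integral_mono) (auto intro: less_imp_le)
  finally show ?thesis by (simp add: N.prob_space)
qed

lemma expectation_convergence_from_moments:
  fixes V :: "'t \<Rightarrow> 'w \<Rightarrow> nat \<Rightarrow> real" and V' :: "'v \<Rightarrow> nat \<Rightarrow> real"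
    and G :: "(nat \<Rightarrow> real) \<Rightarrow> real"
  assumes "prob_space M" "prob_space M'"
    and meas: "\<And>t k. (\<lambda>\<omega>. V t \<omega> k) \<in> borel_measurable M" "\<And>k. (\<lambda>\<omega>. V' \<omega> k) \<in> borel_measurable M'"
    and V: "\<forall>\<^sub>F t in F. \<forall>\<omega>\<in>space M. V t \<omega> \<in> unit_cube n" and V': "\<And>\<omega>. \<omega> \<in> space M' \<Longrightarrow> V' \<omega> \<in> unit_cube n"
    and mom: "\<And>e. ((\<lambda>t. \<integral>\<omega>. (\<Prod>k<n. V t \<omega> k ^ e k) \<partial>M) \<longlongrightarrow> (\<integral>\<omega>. (\<Prod>k<n. V' \<omega> k ^ e k) \<partial>M')) F"
    and G: "continuous_on (unit_cube n) G"
  shows "((\<lambda>t. \<integral>\<omega>. G (V t \<omega>) \<partial>M) \<longlongrightarrow> (\<integral>\<omega>. G (V' \<omega>) \<partial>M')) F"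
proof (rule tendsto_by_approximation)
  fix e :: real assume "e > 0"
  interpret M: prob_space M by fact
  interpret M': prob_space M' by fact
  interpret function_ring_on "monomial_span n" "unit_cube n"
    by (rule function_ring_monomial_span)
  obtain g where g: "g \<in> monomial_span n" "\<And>x. x \<in> unit_cube n \<Longrightarrow> \<bar>G x - g x\<bar> < e"
    using Stone_Weierstrass_basic[OF G \<open>e > 0\<close>] by blast
  have c: "((\<lambda>t. \<integral>\<omega>. g (V t \<omega>) \<partial>M) \<longlongrightarrow> (\<integral>\<omega>. g (V' \<omega>) \<partial>M')) F"
    using g(1)
  proof induction
    case (monomial c e)
    then show ?case using tendsto_mult_left[OF mom[of e], of c] by simp
  next
    case (add f g)
    have 1: "\<forall>\<^sub>F t in F. (\<integral>\<omega>. f (V t \<omega>) + g (V t \<omega>) \<partial>M) = (\<integral>\<omega>. f (V t \<omega>) \<partial>M) + (\<integral>\<omega>. g (V t \<omega>) \<partial>M)"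
      using V
    proof eventually_elim
      case (elim t)
      then show ?case
        using integrable_monomial_span[OF assms(1) meas(1) _ add.hyps(1)]
          integrable_monomial_span[OF assms(1) meas(1) _ add.hyps(2)]
        by (intro Bochner_Integration.integral_add) auto
    qed
    have 2: "(\<integral>\<omega>. f (V' \<omega>) + g (V' \<omega>) \<partial>M') = (\<integral>\<omega>. f (V' \<omega>) \<partial>M') + (\<integral>\<omega>. g (V' \<omega>) \<partial>M')"
      using integrable_monomial_span[OF assms(2) meas(2) V' add.hyps(1)]
          integrable_monomial_span[OF assms(2) meas(2) V' add.hyps(2)]
      by (intro Bochner_Integration.integral_add) auto
    show ?case unfolding tendsto_cong[OF 1] 2 by (rule tendsto_add[OF add.IH])
  qed
  have "\<forall>\<^sub>F t in F. \<bar>(\<integral>\<omega>. G (V t \<omega>) \<partial>M) - (\<integral>\<omega>. g (V t \<omega>) \<partial>M)\<bar> \<le> e"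
    using V by eventually_elim (rule uniform_approximation_expectation[OF assms(1) meas(1) _ G g], auto)
  with c uniform_approximation_expectation[OF assms(2) meas(2) V' G g] show "\<exists>A l. (A \<longlongrightarrow> l) F \<and> (\<forall>\<^sub>F t in F. \<bar>(\<integral>\<omega>. G (V t \<omega>) \<partial>M) - A t\<bar> \<le> e) \<and> \<bar>(\<integral>\<omega>. G (V' \<omega>) \<partial>M') - l\<bar> \<le> e"
    by blast
qed

text \<open>
  An enumeration \<open>h\<close> of the finite index set transports vectors indexed by \<open>I\<close> to the cube by
  \<open>x \<mapsto> exp (- x)\<close>. In these coordinates a bounded continuous \<open>f\<close> lives where all coordinates
  are positive. Cutting the coordinates off from below at \<open>1 / Suc m\<close> makes it continuous on the
  whole cube; \<open>overflow\<close> is a continuous function that dominates the indicator of the event on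
  which the cut-off has an effect.
\<close>

locale exponential_encoding =
  fixes f :: "('i \<Rightarrow> real) \<Rightarrow> real" and h :: "nat \<Rightarrow> 'i" and n :: nat and I :: "'i set" and B :: real
  assumes h: "bij_betw h {..<n} I"
    and f: "continuous_map (product_topology (\<lambda>_. euclideanreal) I) euclideanreal f"
    and B: "\<And>w. w \<in> I \<rightarrow>\<^sub>E UNIV \<Longrightarrow> \<bar>f w\<bar> \<le> B"
begin

definition position :: "'i \<Rightarrow> nat" where "position = inv_into {..<n} h"

definition encode :: "('i \<Rightarrow> real) \<Rightarrow> nat \<Rightarrow> real" where
  "encode x k = (if k < n then exp (- x (h k)) else 0)"

definition truncated :: "nat \<Rightarrow> (nat \<Rightarrow> real) \<Rightarrow> real" where
  "truncated m v = f (\<lambda>u\<in>I. - ln (max (v (position u)) (1 / real (Suc m))))"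

definition overflow :: "nat \<Rightarrow> (nat \<Rightarrow> real) \<Rightarrow> real" where
  "overflow m v = (\<Sum>k<n. min 1 (max 0 (2 - real (Suc m) * v k)))"

lemma position: "position u < n" "h (position u) = u" if "u \<in> I" for u
  using that h unfolding position_def
  by (metis bij_betw_imp_surj_on inv_into_into lessThan_iff,
      metis bij_betw_imp_surj_on f_inv_into_f)

lemma truncation_error_encode: "\<bar>f (restrict x I) - truncated m (encode x)\<bar> \<le> 2 * B * overflow m (encode x)"
proof -
  let ?R = "real (Suc m)"
  have B0: "0 \<le> B" using B[of "restrict x I"] by auto
  have v: "encode x (position u) = exp (- x u)" if "u \<in> I" for u
    using position[OF that] by (simp add: encode_def)
  show ?thesis
  proof (cases "\<forall>u\<in>I. 1 / ?R \<le> exp (- x u)")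
    case True
    then have "(\<lambda>u\<in>I. - ln (max (encode x (position u)) (1 / ?R))) = restrict x I"
      using v by (auto simp: restrict_def fun_eq_iff max_absorb1)
    then show ?thesis using B0 by (auto simp: truncated_def overflow_def intro!: mult_nonneg_nonneg sum_nonneg)
  next
    case False
    then obtain u where u: "u \<in> I" "exp (- x u) < 1 / ?R" by (auto simp: not_le)
    have "?R * encode x (position u) \<le> 1" using u(2) v[OF u(1)] by (simp add: field_simps less_imp_le)
    then have "1 = min 1 (max 0 (2 - ?R * encode x (position u)))" by simp
    also have "\<dots> \<le> overflow m (encode x)"
      unfolding overflow_def by (rule member_le_sum) (use position[OF u(1)] in auto)
    finally have "2 * B * 1 \<le> 2 * B * overflow m (encode x)" using B0 by (intro mult_left_mono) auto
    moreover have "\<bar>f (restrict x I) - truncated m (encode x)\<bar> \<le> B + B"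
      unfolding truncated_def
      by (rule order_trans[OF abs_triangle_ineq4 add_mono[OF B B]]) auto
    ultimately show ?thesis by simp
  qed
qed

lemma encode_in_unit_cube: "encode x \<in> unit_cube n" if "\<And>u. u \<in> I \<Longrightarrow> 0 \<le> x u" for x
  using that h by (auto simp: unit_cube_iff encode_def bij_betw_apply)

lemma continuous_truncated: "continuous_on (unit_cube n) (truncated m)" for m
proof -
  have "continuous_map euclidean (product_topology (\<lambda>_. euclideanreal) I)
    (\<lambda>v. \<lambda>u\<in>I. - ln (max (v (position u)) (1 / real (Suc m))))"
  proof (rule continuous_map_coordinatewise_then_product)
    fix u assume "u \<in> I"
    have "continuous_on UNIV (\<lambda>v :: nat \<Rightarrow> real. - ln (max (v (position u)) (1 / real (Suc m))))"
    proof (intro continuous_on_minus continuous_on_ln continuous_on_max continuous_on_const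
        continuous_on_product_coordinates ballI)
      fix v :: "nat \<Rightarrow> real"
      have "0 < max (v (position u)) (1 / real (Suc m))" by (simp add: less_max_iff_disj)
      then show "max (v (position u)) (1 / real (Suc m)) \<noteq> 0" by linarith
    qed
    then show "continuous_map euclidean euclideanreal (\<lambda>v. (\<lambda>u\<in>I. - ln (max (v (position u)) (1 / real (Suc m)))) u)"
      using \<open>u \<in> I\<close> by (simp only: restrict_apply if_True continuous_map_iff_continuous2)
  qed (simp add: restrict_def)
  then have "continuous_map euclidean euclideanreal (truncated m)"
    unfolding truncated_def using continuous_map_compose[OF _ f] by (simp only: comp_def)
  then show ?thesis using continuous_on_subset[OF _ subset_UNIV] by simp
qed

lemma continuous_overflow: "continuous_on (unit_cube n) (overflow m)" for m
  unfolding overflow_def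
  by (intro continuous_intros continuous_on_subset[OF continuous_on_product_coordinates]) auto

lemma
  assumes N: "prob_space N" and m: "\<And>k. (\<lambda>\<omega>. encode (\<lambda>u. Y u \<omega>) k) \<in> borel_measurable N"
    and c: "\<And>\<omega>. \<omega> \<in> space N \<Longrightarrow> encode (\<lambda>u. Y u \<omega>) \<in> unit_cube n"
  shows integrable_encoded: "integrable N (\<lambda>\<omega>. f (\<lambda>u\<in>I. Y u \<omega>))"
    and truncation_error_expectation: "\<bar>(\<integral>\<omega>. f (\<lambda>u\<in>I. Y u \<omega>) \<partial>N) - (\<integral>\<omega>. truncated m (encode (\<lambda>u. Y u \<omega>)) \<partial>N)\<bar>
        \<le> 2 * B * (\<integral>\<omega>. overflow m (encode (\<lambda>u. Y u \<omega>)) \<partial>N)"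
proof -
  let ?E = "\<lambda>\<omega>. encode (\<lambda>u. Y u \<omega>)"
  let ?f = "\<lambda>\<omega>. f (\<lambda>u\<in>I. Y u \<omega>)"
  interpret N: prob_space N by fact
  have "?f \<in> borel_measurable N"
  proof (rule borel_measurable_LIMSEQ_real)
    show "(\<lambda>\<omega>. truncated m (?E \<omega>)) \<in> borel_measurable N" for m
      using integrable_continuous_on_unit_cube[OF N m c continuous_truncated] by auto
    fix \<omega> assume "\<omega> \<in> space N"
    obtain m0 where m0: "\<forall>u\<in>I. exp (Y u \<omega>) \<le> real m0"
    proof -
      have "finite ((\<lambda>u. exp (Y u \<omega>)) ` I)" using bij_betw_finite[OF h] by auto
      then obtain z where "\<forall>u\<in>I. exp (Y u \<omega>) \<le> z"
        using bdd_above_finite by (metis bdd_above.E imageI)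
      then show ?thesis using that real_arch_simple by (meson order_trans)
    qed
    have "truncated m (?E \<omega>) = ?f \<omega>" if "m \<ge> m0" for m
    proof -
      have "exp (- Y u \<omega>) \<ge> 1 / real (Suc m)" if "u \<in> I" for u
      proof -
        have "exp (Y u \<omega>) \<le> real (Suc m)" using m0 that \<open>m \<ge> m0\<close> by fastforce
        then have "inverse (real (Suc m)) \<le> inverse (exp (Y u \<omega>))" by (intro le_imp_inverse_le) auto
        then show ?thesis by (simp add: exp_minus inverse_eq_divide)
      qed
      then have "(\<lambda>u\<in>I. - ln (max (?E \<omega> (position u)) (1 / real (Suc m)))) = (\<lambda>u\<in>I. Y u \<omega>)"
        using position by (auto simp: restrict_def fun_eq_iff encode_def max_absorb1)
      then show ?thesis unfolding truncated_def by simp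
    qed
    then show "(\<lambda>m. truncated m (?E \<omega>)) \<longlonglongrightarrow> ?f \<omega>"
      by (intro tendsto_eventually eventually_sequentiallyI) auto
  qed
  then show i: "integrable N ?f"
    using B by (intro N.integrable_const_bound[where B=B]) auto
  have iR: "integrable N (\<lambda>\<omega>. truncated m (?E \<omega>))"
    by (rule integrable_continuous_on_unit_cube[OF N m c continuous_truncated])
  have i_overflow: "integrable N (\<lambda>\<omega>. overflow m (?E \<omega>))"
    by (rule integrable_continuous_on_unit_cube[OF N m c continuous_overflow])
  have "\<bar>(\<integral>\<omega>. ?f \<omega> \<partial>N) - (\<integral>\<omega>. truncated m (?E \<omega>) \<partial>N)\<bar>
      \<le> (\<integral>\<omega>. \<bar>?f \<omega> - truncated m (?E \<omega>)\<bar> \<partial>N)"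
    unfolding Bochner_Integration.integral_diff[OF i iR, symmetric] by (rule integral_abs_bound)
  also have "\<dots> \<le> (\<integral>\<omega>. 2 * B * overflow m (?E \<omega>) \<partial>N)"
    using i iR i_overflow truncation_error_encode by (intro integral_mono) auto
  finally show "\<bar>(\<integral>\<omega>. ?f \<omega> \<partial>N) - (\<integral>\<omega>. truncated m (?E \<omega>) \<partial>N)\<bar>
      \<le> 2 * B * (\<integral>\<omega>. overflow m (?E \<omega>) \<partial>N)" by simp
qed

end

lemma expectation_convergence_from_laplace:
  fixes X :: "'t \<Rightarrow> 'i \<Rightarrow> 'w \<Rightarrow> real" and Z :: "'i \<Rightarrow> 'v \<Rightarrow> real"
  assumes "prob_space M" "prob_space M'" "finite I"
    and X: "\<And>t u. u \<in> I \<Longrightarrow> X t u \<in> borel_measurable M" and Z: "\<And>u. u \<in> I \<Longrightarrow> Z u \<in> borel_measurable M'"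
    and X0: "\<forall>\<^sub>F t in F. \<forall>u\<in>I. \<forall>\<omega>\<in>space M. 0 \<le> X t u \<omega>"
    and Z0: "\<And>u \<omega>. u \<in> I \<Longrightarrow> \<omega> \<in> space M' \<Longrightarrow> 0 \<le> Z u \<omega>"
    and lap: "\<And>e :: 'i \<Rightarrow> nat. ((\<lambda>t. \<integral>\<omega>. exp (- (\<Sum>u\<in>I. real (e u) * X t u \<omega>)) \<partial>M) \<longlongrightarrow>
        (\<integral>\<omega>. exp (- (\<Sum>u\<in>I. real (e u) * Z u \<omega>)) \<partial>M')) F"
    and f: "continuous_map (product_topology (\<lambda>_. euclideanreal) I) euclideanreal f"
      "bounded (f ` (I \<rightarrow>\<^sub>E UNIV))"
  shows "((\<lambda>t. \<integral>\<omega>. f (\<lambda>u\<in>I. X t u \<omega>) \<partial>M) \<longlongrightarrow> (\<integral>\<omega>. f (\<lambda>u\<in>I. Z u \<omega>) \<partial>M')) F"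
proof -
  interpret M: prob_space M by fact
  interpret M': prob_space M' by fact
  obtain n and h :: "nat \<Rightarrow> 'i" where h: "bij_betw h {..<n} I"
    using ex_bij_betw_nat_finite[OF assms(3)] by (auto simp: atLeast0LessThan)
  obtain B where B: "\<And>w. w \<in> I \<rightarrow>\<^sub>E UNIV \<Longrightarrow> \<bar>f w\<bar> \<le> B"
    using f(2) by (auto simp: bounded_real)
  interpret exponential_encoding f h n I B by unfold_locales (use h f B in auto)
  let ?EX = "\<lambda>t \<omega>. encode (\<lambda>u. X t u \<omega>)" and ?EZ = "\<lambda>\<omega>. encode (\<lambda>u. Z u \<omega>)"
  have mX: "(\<lambda>\<omega>. ?EX t \<omega> k) \<in> borel_measurable M" for t k
    using X[of "h k" t] h by (cases "k < n") (auto simp: encode_def bij_betw_apply)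
  have mZ: "(\<lambda>\<omega>. ?EZ \<omega> k) \<in> borel_measurable M'" for k
    using Z[of "h k"] h by (cases "k < n") (auto simp: encode_def bij_betw_apply)
  have eX: "\<forall>\<^sub>F t in F. \<forall>\<omega>\<in>space M. ?EX t \<omega> \<in> unit_cube n"
    using X0 by eventually_elim (auto intro!: encode_in_unit_cube)
  have eZ: "?EZ \<omega> \<in> unit_cube n" if "\<omega> \<in> space M'" for \<omega>
    using Z0 that by (auto intro!: encode_in_unit_cube)
  have mono: "(\<Prod>k<n. encode x k ^ e k) = exp (- (\<Sum>u\<in>I. real (e (position u)) * x u))" for x and e :: "nat \<Rightarrow> nat"
  proof -
    have "(\<Prod>k<n. encode x k ^ e k) = (\<Prod>k<n. exp (- (real (e k) * x (h k))))"
      by (intro prod.cong) (auto simp: encode_def exp_of_nat_mult[symmetric])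
    also have "\<dots> = exp (- (\<Sum>k<n. real (e k) * x (h k)))" by (simp add: exp_sum[symmetric] sum_negf)
    also have "(\<Sum>k<n. real (e k) * x (h k)) = (\<Sum>k<n. real (e (position (h k))) * x (h k))"
      using h by (intro sum.cong) (auto simp: position_def bij_betw_def)
    also have "\<dots> = (\<Sum>u\<in>I. real (e (position u)) * x u)"
      by (rule sum.reindex_bij_betw[OF h])
    finally show ?thesis .
  qed
  have lim: "((\<lambda>t. \<integral>\<omega>. G (?EX t \<omega>) \<partial>M) \<longlongrightarrow> (\<integral>\<omega>. G (?EZ \<omega>) \<partial>M')) F"
    if "continuous_on (unit_cube n) G" for G :: "_ \<Rightarrow> real"
    by (rule expectation_convergence_from_moments[OF assms(1,2) mX mZ eX eZ _ that])
       (simp_all only: mono lap)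
  \<comment> \<open>tightness: the limit variables are finite, so that their encodings have positive coordinates\<close>
  have small: "(\<lambda>m. \<integral>\<omega>. overflow m (?EZ \<omega>) \<partial>M') \<longlonglongrightarrow> (\<integral>\<omega>. 0 \<partial>M')"
  proof (rule integral_dominated_convergence[where w="\<lambda>_. real n"])
    show "(\<lambda>\<omega>. overflow m (?EZ \<omega>)) \<in> borel_measurable M'" for m
      using integrable_continuous_on_unit_cube[OF assms(2) mZ eZ continuous_overflow] by auto
    show "AE \<omega> in M'. norm (overflow m (?EZ \<omega>)) \<le> real n" for m
    proof (rule AE_I2)
      fix \<omega>
      have "overflow m (?EZ \<omega>) \<le> (\<Sum>k<n. 1)" unfolding overflow_def by (intro sum_mono) auto
      moreover have "0 \<le> overflow m (?EZ \<omega>)" unfolding overflow_def by (intro sum_nonneg) auto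
      ultimately show "norm (overflow m (?EZ \<omega>)) \<le> real n" by simp
    qed
    show "AE \<omega> in M'. (\<lambda>m. overflow m (?EZ \<omega>)) \<longlonglongrightarrow> 0"
    proof (rule AE_I2)
      fix \<omega>
      have "(\<lambda>m. overflow m (?EZ \<omega>)) \<longlonglongrightarrow> (\<Sum>k<n. 0)"
        unfolding overflow_def
      proof (rule tendsto_sum)
        fix k assume "k \<in> {..<n}"
        then have p: "0 < ?EZ \<omega> k" by (simp add: encode_def)
        have "\<forall>\<^sub>F m in sequentially. 2 / ?EZ \<omega> k \<le> real (Suc m)"
          by (meson eventually_sequentiallyI le_SucI nat_ceiling_le_eq of_nat_le_iff order_trans real_nat_ceiling_ge)
        then have "\<forall>\<^sub>F m in sequentially. min 1 (max 0 (2 - real (Suc m) * ?EZ \<omega> k)) = 0"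
          by eventually_elim (use p in \<open>simp add: field_simps max_def\<close>)
        then show "(\<lambda>m. min 1 (max 0 (2 - real (Suc m) * ?EZ \<omega> k))) \<longlonglongrightarrow> 0"
          by (rule tendsto_eventually)
      qed
      then show "(\<lambda>m. overflow m (?EZ \<omega>)) \<longlonglongrightarrow> 0" by simp
    qed
  qed auto
  show ?thesis
  proof (rule tendsto_by_approximation)
    fix e :: real assume "e > 0"
    have "(\<lambda>m. 2 * B * (\<integral>\<omega>. overflow m (?EZ \<omega>) \<partial>M')) \<longlonglongrightarrow> 0"
      using tendsto_mult_right_zero[OF small[simplified], of "2 * B"] by simp
    then have "\<forall>\<^sub>F m in sequentially. 2 * B * (\<integral>\<omega>. overflow m (?EZ \<omega>) \<partial>M') < e"
      using order_tendstoD(2) \<open>e > 0\<close> by blast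
    then obtain m where m: "2 * B * (\<integral>\<omega>. overflow m (?EZ \<omega>) \<partial>M') < e"
      by (meson eventually_happens sequentially_bot)
    have "\<forall>\<^sub>F t in F. 2 * B * (\<integral>\<omega>. overflow m (?EX t \<omega>) \<partial>M) < e"
      using order_tendstoD(2)[OF tendsto_mult_left[OF lim[OF continuous_overflow[of m]], of "2 * B"] m] .
    with eX have "\<forall>\<^sub>F t in F. \<bar>(\<integral>\<omega>. f (\<lambda>u\<in>I. X t u \<omega>) \<partial>M) - (\<integral>\<omega>. truncated m (?EX t \<omega>) \<partial>M)\<bar> \<le> e"
    proof eventually_elim
      case (elim t)
      then show ?case using truncation_error_expectation[OF assms(1) mX, of t m] by fastforce
    qed
    moreover have "\<bar>(\<integral>\<omega>. f (\<lambda>u\<in>I. Z u \<omega>) \<partial>M') - (\<integral>\<omega>. truncated m (?EZ \<omega>) \<partial>M')\<bar> \<le> e"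
      using truncation_error_expectation[OF assms(2) mZ eZ, of m] m by linarith
    ultimately show "\<exists>A l. (A \<longlongrightarrow> l) F \<and> (\<forall>\<^sub>F t in F. \<bar>(\<integral>\<omega>. f (\<lambda>u\<in>I. X t u \<omega>) \<partial>M) - A t\<bar> \<le> e)
        \<and> \<bar>(\<integral>\<omega>. f (\<lambda>u\<in>I. Z u \<omega>) \<partial>M') - l\<bar> \<le> e"
      using lim[OF continuous_truncated[of m]] by blast
  qed
qed

text \<open>
  Positive integer weights suffice, because indices of weight 0 can be removed from \<open>I\<close>.
\<close>

lemma fdd_convergence_from_laplace:
  fixes X :: "'t \<Rightarrow> 'i \<Rightarrow> 'w \<Rightarrow> real" and Z :: "'i \<Rightarrow> 'v \<Rightarrow> real"
  assumes "prob_space M" "prob_space M'"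
    and X: "\<And>t u. u \<in> T \<Longrightarrow> X t u \<in> borel_measurable M" and Z: "\<And>u. u \<in> T \<Longrightarrow> Z u \<in> borel_measurable M'"
    and X0: "\<forall>\<^sub>F t in F. \<forall>u\<in>T. \<forall>\<omega>\<in>space M. 0 \<le> X t u \<omega>"
    and Z0: "\<And>u \<omega>. u \<in> T \<Longrightarrow> \<omega> \<in> space M' \<Longrightarrow> 0 \<le> Z u \<omega>"
    and lap: "\<And>I (e :: 'i \<Rightarrow> nat). finite I \<Longrightarrow> I \<subseteq> T \<Longrightarrow> (\<And>u. u \<in> I \<Longrightarrow> e u > 0) \<Longrightarrow>
        ((\<lambda>t. \<integral>\<omega>. exp (- (\<Sum>u\<in>I. real (e u) * X t u \<omega>)) \<partial>M) \<longlongrightarrow>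
        (\<integral>\<omega>. exp (- (\<Sum>u\<in>I. real (e u) * Z u \<omega>)) \<partial>M')) F"
  shows "fdd_converges T M X M' Z F"
  unfolding fdd_converges_def
proof (intro conjI allI ballI impI X Z; (elim conjE)?)
  fix I f assume I: "finite I" "I \<subseteq> T"
    and f: "continuous_map (product_topology (\<lambda>_. euclideanreal) I) euclideanreal f"
      "bounded (f ` (I \<rightarrow>\<^sub>E UNIV))"
  show "((\<lambda>t. \<integral>\<omega>. f (\<lambda>u\<in>I. X t u \<omega>) \<partial>M) \<longlongrightarrow> (\<integral>\<omega>. f (\<lambda>u\<in>I. Z u \<omega>) \<partial>M')) F"
  proof (rule expectation_convergence_from_laplace[OF assms(1,2) I(1) _ _ _ _ _ f])
    show "\<forall>\<^sub>F t in F. \<forall>u\<in>I. \<forall>\<omega>\<in>space M. 0 \<le> X t u \<omega>"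
      using X0 by eventually_elim (use I in auto)
    fix e :: "'i \<Rightarrow> nat"
    define J where "J = {u\<in>I. e u > 0}"
    have eq: "(\<Sum>u\<in>I. real (e u) * x u) = (\<Sum>u\<in>J. real (e u) * x u)" for x :: "'i \<Rightarrow> real"
      by (rule sum.mono_neutral_right) (use I in \<open>auto simp: J_def\<close>)
    show "((\<lambda>t. \<integral>\<omega>. exp (- (\<Sum>u\<in>I. real (e u) * X t u \<omega>)) \<partial>M) \<longlongrightarrow>
        (\<integral>\<omega>. exp (- (\<Sum>u\<in>I. real (e u) * Z u \<omega>)) \<partial>M')) F"
      unfolding eq by (rule lap) (use I in \<open>auto simp: J_def\<close>)
  qed (use X Z Z0 I in auto)
qed

lemma exp_minus_lipschitz:
  fixes x y :: real
  assumes "0 \<le> y" "y \<le> x"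
  shows "\<bar>exp (- x) - exp (- y)\<bar> \<le> x - y"
proof -
  have "exp (- y) - exp (- x) = exp (- y) * (1 - exp (- (x - y)))"
    by (simp add: algebra_simps flip: exp_add)
  also have "\<dots> \<le> 1 * (x - y)"
  proof (rule mult_mono)
    show "1 - exp (- (x - y)) \<le> x - y" using exp_ge_add_one_self[of "- (x - y)"] by linarith
  qed (use assms in auto)
  finally show ?thesis using assms by simp
qed

lemma laplace_perturbation:
  fixes X X' :: "'t \<Rightarrow> 'i \<Rightarrow> 'w \<Rightarrow> real" and e :: "'i \<Rightarrow> nat"
  assumes "prob_space M" "finite I"
    and X: "\<And>t u. u \<in> I \<Longrightarrow> X t u \<in> borel_measurable M" and X': "\<And>t u. u \<in> I \<Longrightarrow> X' t u \<in> borel_measurable M"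
    and le: "\<forall>\<^sub>F t in F. \<forall>u\<in>I. \<forall>\<omega>\<in>space M. 0 \<le> X' t u \<omega> \<and> X' t u \<omega> \<le> X t u \<omega>"
    and int: "\<forall>\<^sub>F t in F. \<forall>u\<in>I. integrable M (\<lambda>\<omega>. X t u \<omega> - X' t u \<omega>)"
    and lim: "\<And>u. u \<in> I \<Longrightarrow> ((\<lambda>t. \<integral>\<omega>. X t u \<omega> - X' t u \<omega> \<partial>M) \<longlongrightarrow> 0) F"
    and L: "((\<lambda>t. \<integral>\<omega>. exp (- (\<Sum>u\<in>I. real (e u) * X' t u \<omega>)) \<partial>M) \<longlongrightarrow> l) F"
  shows "((\<lambda>t. \<integral>\<omega>. exp (- (\<Sum>u\<in>I. real (e u) * X t u \<omega>)) \<partial>M) \<longlongrightarrow> l) F"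
proof -
  interpret prob_space M by fact
  let ?s = "\<lambda>X t \<omega>. \<Sum>u\<in>I. real (e u) * X t u \<omega>"
  let ?E = "\<lambda>X t. \<integral>\<omega>. exp (- ?s X t \<omega>) \<partial>M"
  have "((\<lambda>t. \<Sum>u\<in>I. real (e u) * (\<integral>\<omega>. X t u \<omega> - X' t u \<omega> \<partial>M)) \<longlongrightarrow> (\<Sum>u\<in>I. real (e u) * 0)) F"
    by (intro tendsto_sum tendsto_mult tendsto_const lim)
  then have bound: "((\<lambda>t. \<Sum>u\<in>I. real (e u) * (\<integral>\<omega>. X t u \<omega> - X' t u \<omega> \<partial>M)) \<longlongrightarrow> 0) F" by simp
  have "((\<lambda>t. ?E X t - ?E X' t) \<longlongrightarrow> 0) F"
  proof (rule Lim_null_comparison[OF _ bound])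
    show "\<forall>\<^sub>F t in F. norm (?E X t - ?E X' t) \<le> (\<Sum>u\<in>I. real (e u) * (\<integral>\<omega>. X t u \<omega> - X' t u \<omega> \<partial>M))"
      using le int
    proof eventually_elim
      case (elim t)
      have ie: "integrable M (\<lambda>\<omega>. exp (- (\<Sum>u\<in>I. real (e u) * Z u \<omega>)))"
        if "\<And>u. u \<in> I \<Longrightarrow> Z u \<in> borel_measurable M" "\<And>u \<omega>. u \<in> I \<Longrightarrow> \<omega> \<in> space M \<Longrightarrow> 0 \<le> Z u \<omega>" for Z
      proof (rule integrable_const_bound[where B=1])
        show "(\<lambda>\<omega>. exp (- (\<Sum>u\<in>I. real (e u) * Z u \<omega>))) \<in> borel_measurable M"
          using that(1) by (intro measurable_compose[OF _ borel_measurable_exp] borel_measurable_uminus borel_measurable_sum borel_measurable_times borel_measurable_const)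
      qed (use that(2) in \<open>auto intro!: AE_I2 sum_nonneg\<close>)
      have i: "integrable M (\<lambda>\<omega>. exp (- ?s X t \<omega>))"
        by (rule ie) (use X elim(1) in \<open>blast intro: order_trans\<close>)+
      have i': "integrable M (\<lambda>\<omega>. exp (- ?s X' t \<omega>))"
        by (rule ie) (use X' elim(1) in auto)
      have "\<bar>?E X t - ?E X' t\<bar> \<le> (\<integral>\<omega>. \<bar>exp (- ?s X t \<omega>) - exp (- ?s X' t \<omega>)\<bar> \<partial>M)"
        unfolding Bochner_Integration.integral_diff[OF i i', symmetric] by (rule integral_abs_bound)
      also have "\<dots> \<le> (\<integral>\<omega>. (\<Sum>u\<in>I. real (e u) * (X t u \<omega> - X' t u \<omega>)) \<partial>M)"
      proof (rule integral_mono)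
        show "integrable M (\<lambda>\<omega>. \<Sum>u\<in>I. real (e u) * (X t u \<omega> - X' t u \<omega>))"
          using elim(2) by (intro Bochner_Integration.integrable_sum integrable_mult_right) auto
        fix \<omega> assume \<omega>: "\<omega> \<in> space M"
        have "\<bar>exp (- ?s X t \<omega>) - exp (- ?s X' t \<omega>)\<bar>
          \<le> ?s X t \<omega> - ?s X' t \<omega>"
          using elim(1) \<omega> by (intro exp_minus_lipschitz sum_nonneg sum_mono mult_left_mono mult_nonneg_nonneg) auto
        then show "\<bar>exp (- ?s X t \<omega>) - exp (- ?s X' t \<omega>)\<bar>
          \<le> (\<Sum>u\<in>I. real (e u) * (X t u \<omega> - X' t u \<omega>))"
          by (simp add: right_diff_distrib sum_subtractf)
      qed (use i i' in auto)
      also have "\<dots> = (\<Sum>u\<in>I. real (e u) * (\<integral>\<omega>. X t u \<omega> - X' t u \<omega> \<partial>M))"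
        using elim(2) by (subst Bochner_Integration.integral_sum) auto
      finally show ?case by simp
    qed
  qed
  from tendsto_add[OF this L] show ?thesis by simp
qed

section \<open>Vague convergence on the punctured orthant and tail probabilities\<close>

text \<open>
  The points that are not below \<open>z\<close> coordinatewise. For positive \<open>z\<close> this set is bounded away from
  the origin, hence of finite mass under a locally finite measure, and the maximum of several vectors is at most \<open>z\<close> exactly
  if none of them lies in it.
\<close>

definition exceed :: "('d \<Rightarrow> real) \<Rightarrow> ('d \<Rightarrow> ennreal) set" where
  "exceed z = {y. \<exists>i. ennreal (z i) < y i}"

lemma continuous_coordinate: "continuous_on UNIV (\<lambda>y :: 'd \<Rightarrow> ennreal. y i)"
  by simp

lemma open_exceed: "open (exceed z)"
proof -
  have "exceed z = (\<Union>i. {y. ennreal (z i) < y i})" by (auto simp: exceed_def)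
  also have "open \<dots>"
    by (intro open_UN ballI open_Collect_less continuous_on_const continuous_coordinate)
  finally show ?thesis .
qed

lemma punctured_orthant_eq: "punctured_orthant = exceed (\<lambda>_. 0)"
  by (auto simp: punctured_orthant_def exceed_def fun_eq_iff zero_less_iff_neq_zero)

lemma exceed_subset_punctured: "exceed z \<subseteq> punctured_orthant"
  by (auto simp: punctured_orthant_def exceed_def)

lemma compact_orthant: "compact (UNIV :: ('d \<Rightarrow> ennreal) set)"
proof -
  have "compactin (product_topology (\<lambda>_. euclidean) UNIV) (Pi\<^sub>E UNIV (\<lambda>_ :: 'd. UNIV :: ennreal set))"
    unfolding compactin_PiE by (simp add: compactin_euclidean_iff compact_UNIV)
  then show ?thesis by (simp add: euclidean_product_topology compactin_euclidean_iff)
qed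

lemma compact_weak_exceed: "compact {y :: 'd::finite \<Rightarrow> ennreal. \<exists>i. ennreal (z i) \<le> y i}"
proof -
  have "{y. \<exists>i. ennreal (z i) \<le> y i} = (\<Union>i. {y. ennreal (z i) \<le> y i})" by auto
  also have "closed \<dots>"
    by (intro closed_UN ballI closed_Collect_le continuous_on_const continuous_coordinate) auto
  finally show ?thesis using compact_Int_closed[OF compact_orthant] by simp
qed

text \<open>
  A continuous substitute for the indicator of \<open>v \<le> r\<close>, decreasing linearly from 1 at \<open>r\<close> to
  0 at \<open>r'\<close>. The inner minimum makes it continuous at infinity as well.
\<close>

definition soft_below :: "real \<Rightarrow> real \<Rightarrow> ennreal \<Rightarrow> real" where
  "soft_below r r' v = min 1 ((r' - enn2real (min v (ennreal r'))) / (r' - r))"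

lemma continuous_soft_below: "continuous_on UNIV (soft_below r r')"
proof -
  have "continuous_on UNIV (\<lambda>v. enn2real (min v (ennreal r')))"
  proof -
    have "continuous_on UNIV (\<lambda>v. min v (ennreal r'))"
      by (intro continuous_on_min continuous_on_id continuous_on_const)
    then show ?thesis
      unfolding continuous_on_def by (intro ballI tendsto_enn2real) (auto simp: min_less_iff_disj)
  qed
  then show ?thesis unfolding soft_below_def divide_inverse by (intro continuous_intros)
qed

lemma soft_below_range:
  assumes "0 \<le> r" "r < r'"
  shows "0 \<le> soft_below r r' v" "soft_below r r' v \<le> 1"
proof -
  have "enn2real (min v (ennreal r')) \<le> r'"
    using assms by (intro enn2real_leI) auto
  then show "0 \<le> soft_below r r' v" "soft_below r r' v \<le> 1"
    using assms by (auto simp: soft_below_def)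
qed

lemma soft_below_eq_1:
  assumes "0 \<le> r" "r < r'" "v \<le> ennreal r"
  shows "soft_below r r' v = 1"
proof -
  have "enn2real (min v (ennreal r')) \<le> r"
    using assms by (intro enn2real_leI) (auto simp: min_le_iff_disj)
  then show ?thesis using assms by (simp add: soft_below_def)
qed

lemma soft_below_eq_0:
  assumes "0 \<le> r" "r < r'" "ennreal r' \<le> v"
  shows "soft_below r r' v = 0"
  using assms by (simp add: soft_below_def min_absorb2)

definition soft_exceed :: "('d::finite \<Rightarrow> real) \<Rightarrow> ('d \<Rightarrow> real) \<Rightarrow> ('d \<Rightarrow> ennreal) \<Rightarrow> real" where
  "soft_exceed z z' y = 1 - (\<Prod>i\<in>UNIV. soft_below (z i) (z' i) (y i))"

lemma continuous_soft_exceed: "continuous_on UNIV (soft_exceed z z')"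
  unfolding soft_exceed_def
  by (intro continuous_on_diff continuous_on_const continuous_on_prod
      continuous_on_compose2[OF continuous_soft_below continuous_coordinate]) auto

lemma soft_exceed_sandwich:
  assumes "\<And>i. 0 \<le> z i" "\<And>i. z i < z' i"
  shows "indicator (exceed z') y \<le> soft_exceed z z' y" "soft_exceed z z' y \<le> indicator (exceed z) y"
    "0 \<le> soft_exceed z z' y" "soft_exceed z z' y \<le> 1"
proof -
  let ?s = "\<lambda>i. soft_below (z i) (z' i) (y i)"
  have r: "0 \<le> ?s i" "?s i \<le> 1" for i using soft_below_range assms by blast+
  show 0: "0 \<le> soft_exceed z z' y" "soft_exceed z z' y \<le> 1"
    unfolding soft_exceed_def using prod_le_1[of UNIV ?s] prod_nonneg[of UNIV ?s] r by auto
  show "indicator (exceed z') y \<le> soft_exceed z z' y"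
  proof (cases "y \<in> exceed z'")
    case True
    then obtain i where "ennreal (z' i) < y i" by (auto simp: exceed_def)
    then have "?s i = 0" using assms by (intro soft_below_eq_0) auto
    then have p0: "prod ?s UNIV = 0" by (intro prod_zero) auto
    show ?thesis unfolding soft_exceed_def p0 by (simp add: indicator_def)
  qed (use 0 in auto)
  show "soft_exceed z z' y \<le> indicator (exceed z) y"
  proof (cases "y \<in> exceed z")
    case False
    then have "?s i = 1" for i using assms by (intro soft_below_eq_1) (auto simp: exceed_def not_less)
    then have "prod ?s UNIV = 1" by (intro prod.neutral) auto
    then show ?thesis by (simp add: soft_exceed_def)
  qed (use 0 in auto)
qed

lemma integral_scale_restrict_distr:
  fixes f :: "'a::topological_space \<Rightarrow> real"
  assumes "0 < t" "X \<in> measurable M borel" "E \<in> sets borel" "f \<in> borel_measurable borel"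
    "\<And>x. 0 \<le> f x" "\<And>x. x \<notin> E \<Longrightarrow> f x = 0"
  shows "(\<integral>x. f x \<partial>scale_measure (ennreal t) (restrict_space (distr M borel X) E)) = t * (\<integral>\<omega>. f (X \<omega>) \<partial>M)"
proof -
  have m: "f \<in> borel_measurable (restrict_space (distr M borel X) E)"
    using assms by (intro measurable_restrict_space1) auto
  have "(\<integral>\<^sup>+x. ennreal (f x) \<partial>scale_measure (ennreal t) (restrict_space (distr M borel X) E))
      = ennreal t * (\<integral>\<^sup>+x. ennreal (f x) \<partial>restrict_space (distr M borel X) E)"
    using m by (intro nn_integral_scale_measure) auto
  also have "(\<integral>\<^sup>+x. ennreal (f x) \<partial>restrict_space (distr M borel X) E) = (\<integral>\<^sup>+x. ennreal (f x) * indicator E x \<partial>distr M borel X)"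
    using assms by (intro nn_integral_restrict_space) auto
  also have "\<dots> = (\<integral>\<^sup>+x. ennreal (f x) \<partial>distr M borel X)"
    using assms(6) by (intro nn_integral_cong) (auto simp: indicator_def)
  also have "\<dots> = (\<integral>\<^sup>+\<omega>. ennreal (f (X \<omega>)) \<partial>M)"
    using assms by (intro nn_integral_distr) auto
  finally have eq: "(\<integral>\<^sup>+x. ennreal (f x) \<partial>scale_measure (ennreal t) (restrict_space (distr M borel X) E))
      = ennreal t * (\<integral>\<^sup>+\<omega>. ennreal (f (X \<omega>)) \<partial>M)" .
  have "(\<integral>x. f x \<partial>scale_measure (ennreal t) (restrict_space (distr M borel X) E)) =
     enn2real (\<integral>\<^sup>+x. ennreal (f x) \<partial>scale_measure (ennreal t) (restrict_space (distr M borel X) E))"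
    by (rule integral_eq_nn_integral) (use m assms(5) in \<open>auto simp: measurable_def space_scale_measure\<close>)
  also have "\<dots> = t * enn2real (\<integral>\<^sup>+\<omega>. ennreal (f (X \<omega>)) \<partial>M)"
    unfolding eq using assms(1) by (simp add: enn2real_mult)
  also have "enn2real (\<integral>\<^sup>+\<omega>. ennreal (f (X \<omega>)) \<partial>M) = (\<integral>\<omega>. f (X \<omega>) \<partial>M)"
    by (rule integral_eq_nn_integral[symmetric]) (use assms in auto)
  finally show ?thesis .
qed

locale vague_tail = prob_space M for M :: "'w measure" +
  fixes Y :: "'w \<Rightarrow> 'd::finite \<Rightarrow> real" and a :: "real \<Rightarrow> real" and \<nu> :: "('d \<Rightarrow> ennreal) measure"
  assumes Y_meas: "\<And>i. (\<lambda>\<omega>. Y \<omega> i) \<in> borel_measurable M"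
    and a_pos: "\<And>t. t > 0 \<Longrightarrow> a t > 0"
    and sets_nu: "sets \<nu> = sets (restrict_space borel punctured_orthant)"
    and locally_finite_nu: "locally_finite_on punctured_orthant \<nu>"
    and vague: "vaguely_converges_on punctured_orthant
       (\<lambda>t. scale_measure (ennreal t) (restrict_space (distr M borel (\<lambda>\<omega> i. ennreal (Y \<omega> i / a t))) punctured_orthant))
       \<nu> at_top"
begin

declare Y_meas [measurable]

lemma punctured_borel: "punctured_orthant \<in> sets (borel :: ('d \<Rightarrow> ennreal) measure)"
  unfolding punctured_orthant_eq by (intro borel_open open_exceed)

lemma space_nu: "space \<nu> = punctured_orthant"
  using sets_eq_imp_space_eq[OF sets_nu] by (simp add: space_restrict_space)

lemma sets_nu_iff: "A \<in> sets \<nu> \<longleftrightarrow> A \<in> sets borel \<and> A \<subseteq> punctured_orthant"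
  unfolding sets_nu using punctured_borel by (subst sets_restrict_space_iff) auto

lemma borel_measurable_nu: "f \<in> borel_measurable borel \<Longrightarrow> f \<in> borel_measurable \<nu>"
  using measurable_restrict_space1 measurable_cong_sets[OF sets_nu refl] by blast

lemma exceed_sets [simp, intro]: "exceed z \<in> sets \<nu>"
  using borel_open[OF open_exceed] exceed_subset_punctured by (auto simp: sets_nu_iff)

lemma emeasure_exceed_finite:
  assumes "\<And>i. 0 < z i"
  shows "emeasure \<nu> (exceed z) < \<infinity>"
proof -
  let ?K = "{y. \<exists>i. ennreal (z i) \<le> y i}"
  have K: "?K \<subseteq> punctured_orthant"
    using assms by (auto simp: punctured_orthant_def ennreal_eq_0_iff not_le)
  have "compact ?K" by (rule compact_weak_exceed)
  then have "emeasure \<nu> ?K < \<infinity>" using K locally_finite_nu by (auto simp: locally_finite_on_def)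
  moreover have "emeasure \<nu> (exceed z) \<le> emeasure \<nu> ?K"
  proof (rule emeasure_mono)
    have "{y. \<exists>i. ennreal (z i) \<le> y i} = (\<Union>i. {y. ennreal (z i) \<le> y i})" by auto
    also have "closed \<dots>"
      by (intro closed_UN ballI closed_Collect_le continuous_on_const continuous_coordinate) auto
    finally show "?K \<in> sets \<nu>" using K by (auto simp: sets_nu_iff)
  qed (auto simp: exceed_def intro: less_imp_le)
  ultimately show ?thesis by (rule le_less_trans[rotated])
qed

lemma emeasure_exceed: "(\<And>i. 0 < z i) \<Longrightarrow> emeasure \<nu> (exceed z) = ennreal (measure \<nu> (exceed z))"
  using emeasure_exceed_finite[of z] by (intro emeasure_eq_ennreal_measure) auto

lemma sigma_finite_nu: "sigma_finite_measure \<nu>"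
proof
  let ?A = "\<lambda>n. exceed (\<lambda>_. 1 / real (Suc n))"
  have "space \<nu> \<subseteq> (\<Union>n. ?A n)"
  proof
    fix y assume "y \<in> space \<nu>"
    then obtain i where "0 < y i" by (auto simp: space_nu punctured_orthant_eq exceed_def)
    then obtain e where e: "0 < e" "ennreal e < y i"
      by (metis dense ennreal_cases ennreal_less_zero_iff not_less_iff_gr_or_eq top.not_eq_extremum order.strict_trans)
    obtain n where "inverse (real (Suc n)) < e" using reals_Archimedean e(1) by blast
    then have "ennreal (1 / real (Suc n)) < y i"
      using e(2) by (metis ennreal_leI inverse_eq_divide less_imp_le order.strict_trans1)
    then show "y \<in> (\<Union>n. ?A n)" by (auto simp: exceed_def)
  qed
  moreover have "emeasure \<nu> (?A n) < \<infinity>" for n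
    by (rule emeasure_exceed_finite) simp
  moreover have "\<Union> (range ?A) \<subseteq> space \<nu>"
    using exceed_subset_punctured unfolding space_nu by blast
  ultimately show "\<exists>A. countable A \<and> A \<subseteq> sets \<nu> \<and> \<Union> A = space \<nu> \<and> (\<forall>a\<in>A. emeasure \<nu> a \<noteq> \<infinity>)"
    by (intro exI[of _ "range ?A"]) (auto simp: less_top[symmetric])
qed

lemma inf_set: "{y. \<exists>i. y i = \<infinity>} \<in> sets \<nu>"
proof -
  have "{y :: 'd \<Rightarrow> ennreal. \<exists>i. y i = \<infinity>} = (\<Union>i. {y. y i = \<infinity>})" by auto
  also have "closed \<dots>"
    by (intro closed_UN ballI closed_Collect_eq continuous_on_const continuous_coordinate) auto
  finally show ?thesis by (auto simp: sets_nu_iff punctured_orthant_def)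
qed

text \<open>
  The levels at which vague convergence may fail to give convergence of the mass of \<open>exceed\<close>.
\<close>

definition atoms :: "'d \<Rightarrow> real set" where
  "atoms i = {r. 0 < r \<and> emeasure \<nu> {y. y i = ennreal r} \<noteq> 0}"

lemma level_sets: "0 < r \<Longrightarrow> {y. y i = ennreal r} \<in> sets \<nu>"
proof -
  assume "0 < r"
  have "closed {y :: 'd \<Rightarrow> ennreal. y i = ennreal r}"
    by (intro closed_Collect_eq continuous_on_const continuous_coordinate)
  then show ?thesis using \<open>0 < r\<close> by (auto simp: sets_nu_iff punctured_orthant_def)
qed

text \<open>
  On each set \<open>exceed (\<lambda>_. 1 / Suc n)\<close> the measure is finite, and a finite measure has only
  countably many atoms.
\<close>

lemma countable_atoms: "countable (atoms i)"
proof -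
  let ?A = "\<lambda>n. exceed (\<lambda>_. 1 / real (Suc n))"
  define N where "N n = distr (restrict_space \<nu> (?A n)) borel (\<lambda>y. y i)" for n
  have coord: "(\<lambda>y. y i) \<in> measurable (restrict_space \<nu> (?A n)) borel" for n
    by (intro measurable_restrict_space1 borel_measurable_nu borel_measurable_continuous_onI continuous_coordinate)
  have fin: "finite_measure (N n)" for n
    unfolding N_def
  proof (rule finite_measure.finite_measure_distr[OF _ coord], rule finite_measureI)
    show "emeasure (restrict_space \<nu> (?A n))
       (space (restrict_space \<nu> (?A n))) \<noteq> \<infinity>"
      using emeasure_exceed_finite[of "\<lambda>_. 1 / real (Suc n)"] sets.sets_into_space[OF exceed_sets]
      by (subst emeasure_restrict_space) (auto simp: space_restrict_space Int_absorb2)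
  qed
  have N: "countable {x. measure (N n) {x} \<noteq> 0}" for n
    by (rule finite_measure.countable_support[OF fin])
  have "atoms i \<subseteq> enn2real ` (\<Union>n. {x. measure (N n) {x} \<noteq> 0})"
  proof
    fix r assume "r \<in> atoms i"
    then have r: "0 < r" "emeasure \<nu> {y. y i = ennreal r} \<noteq> 0" by (auto simp: atoms_def)
    obtain n where "inverse (real (Suc n)) < r" using reals_Archimedean r(1) by blast
    then have sub: "{y. y i = ennreal r} \<subseteq> ?A n"
      by (auto simp: exceed_def inverse_eq_divide intro!: exI[of _ i] ennreal_lessI r(1))
    interpret finite_measure "N n" by (rule fin)
    have "emeasure (N n) {ennreal r} = emeasure (restrict_space \<nu> (?A n))
       ((\<lambda>y. y i) -` {ennreal r} \<inter> space (restrict_space \<nu> (?A n)))"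
      unfolding N_def using coord by (subst emeasure_distr) auto
    also have "(\<lambda>y. y i) -` {ennreal r} \<inter> space (restrict_space \<nu> (?A n)) = {y. y i = ennreal r}"
      using sub exceed_subset_punctured by (auto simp: space_restrict_space space_nu)
    also have "emeasure (restrict_space \<nu> (?A n)) {y. y i = ennreal r} = emeasure \<nu> {y. y i = ennreal r}"
      using sub sets.sets_into_space[OF exceed_sets] by (subst emeasure_restrict_space) (auto simp: Int_absorb2)
    finally have "measure (N n) {ennreal r} \<noteq> 0" using r(2) by (auto simp: emeasure_eq_measure)
    then show "r \<in> enn2real ` (\<Union>n. {x. measure (N n) {x} \<noteq> 0})"
      using r(1) by (intro image_eqI[of _ _ "ennreal r"]) auto
  qed
  then show ?thesis using N by (meson countable_UN countable_image countable_subset uncountable_def UNIV_I countableI_type)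
qed

lemma Y_vec_meas: "(\<lambda>\<omega> i. ennreal (Y \<omega> i / a t)) \<in> measurable M borel"
  by (intro measurable_coordinatewise_then_product) measurable

definition tail :: "real \<Rightarrow> ('d \<Rightarrow> real) \<Rightarrow> real" where
  "tail s z = prob {\<omega>\<in>space M. \<exists>i. Y \<omega> i > s * z i}"

lemma soft_tail_convergence:
  assumes "\<And>i. 0 < z i" "\<And>i. z i < z' i"
  shows "((\<lambda>t. t * (\<integral>\<omega>. soft_exceed z z' (\<lambda>i. ennreal (Y \<omega> i / a t)) \<partial>M)) \<longlongrightarrow> (\<integral>y. soft_exceed z z' y \<partial>\<nu>)) at_top"
proof -
  let ?\<mu> = "\<lambda>t. scale_measure (ennreal t) (restrict_space (distr M borel (\<lambda>\<omega> i. ennreal (Y \<omega> i / a t))) punctured_orthant)"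
  have z0: "0 \<le> z i" for i using assms(1) less_imp_le by blast
  have *: "(\<exists>K. compact K \<and> K \<subseteq> punctured_orthant \<and> (\<forall>x\<in>punctured_orthant - K. soft_exceed z z' x = 0))"
  proof (intro exI[of _ "{y. \<exists>i. ennreal (z i) \<le> y i}"] conjI ballI compact_weak_exceed)
    show "{y. \<exists>i. ennreal (z i) \<le> y i} \<subseteq> punctured_orthant"
      using assms by (auto simp: punctured_orthant_def ennreal_eq_0_iff not_le)
    fix x assume "x \<in> punctured_orthant - {y. \<exists>i. ennreal (z i) \<le> y i}"
    then have "x \<notin> exceed z" by (auto simp: exceed_def not_le dest: less_asym)
    then show "soft_exceed z z' x = 0" using soft_exceed_sandwich[where z=z and z'=z' and y=x, OF z0 assms(2)] by simp
  qed
  then have "((\<lambda>t. \<integral>y. soft_exceed z z' y \<partial>?\<mu> t)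
     \<longlongrightarrow> (\<integral>y. soft_exceed z z' y \<partial>\<nu>)) at_top"
    using vague continuous_on_subset[OF continuous_soft_exceed subset_UNIV]
    unfolding vaguely_converges_on_def by blast
  moreover have "\<forall>\<^sub>F t in at_top. (\<integral>y. soft_exceed z z' y \<partial>?\<mu> t) = t * (\<integral>\<omega>. soft_exceed z z' (\<lambda>i. ennreal (Y \<omega> i / a t)) \<partial>M)"
    using eventually_gt_at_top[of 0]
  proof eventually_elim
    case (elim t)
    show ?case
    proof (rule integral_scale_restrict_distr[OF elim Y_vec_meas punctured_borel])
      show "soft_exceed z z' \<in> borel_measurable borel"
        by (rule borel_measurable_continuous_onI[OF continuous_soft_exceed])
      fix x :: "'d \<Rightarrow> ennreal" assume "x \<notin> punctured_orthant"
      then have "x \<notin> exceed z" using exceed_subset_punctured by blast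
      then show "soft_exceed z z' x = 0" using soft_exceed_sandwich[where z=z and z'=z' and y=x, OF z0 assms(2)] by simp
    qed (rule soft_exceed_sandwich[where z=z and z'=z', OF z0 assms(2)])
  qed
  ultimately show ?thesis by (rule Lim_transform_eventually)
qed

lemma soft_integral_limit:
  assumes z: "\<And>i. 0 < z i" and b: "\<And>i n. z i / 2 \<le> r n i" "\<And>i n. r n i < r' n i"
    and lim: "\<And>i v. v \<noteq> ennreal (z i) \<Longrightarrow> (\<lambda>n. soft_below (r n i) (r' n i) v) \<longlonglongrightarrow> (if v < ennreal (z i) then 1 else 0)"
    and null: "\<And>i. z i \<notin> atoms i"
  shows "(\<lambda>n. \<integral>y. soft_exceed (r n) (r' n) y \<partial>\<nu>) \<longlonglongrightarrow> measure \<nu> (exceed z)"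
proof -
  have r0: "0 \<le> r n i" for n i using z[of i] b(1)[of i n] by linarith
  have "(\<lambda>n. \<integral>y. soft_exceed (r n) (r' n) y \<partial>\<nu>) \<longlonglongrightarrow> (\<integral>y. indicator (exceed z) y \<partial>\<nu>)"
  proof (rule integral_dominated_convergence[where w = "indicator (exceed (\<lambda>i. z i / 2))"])
    show "integrable \<nu> (indicator (exceed (\<lambda>i. z i / 2)) :: _ \<Rightarrow> real)"
      using emeasure_exceed_finite[of "\<lambda>i. z i / 2"] z by (intro integrable_real_indicator) auto
    show "soft_exceed (r n) (r' n) \<in> borel_measurable \<nu>" for n
      by (intro borel_measurable_nu borel_measurable_continuous_onI continuous_soft_exceed)
    show "AE y in \<nu>. norm (soft_exceed (r n) (r' n) y) \<le> indicator (exceed (\<lambda>i. z i / 2)) y" for n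
    proof (rule AE_I2)
      fix y
      have "exceed (r n) \<subseteq> exceed (\<lambda>i. z i / 2)"
        using b(1)[of _ n] unfolding exceed_def by (blast intro: order.strict_trans1[OF ennreal_leI])
      then have "indicator (exceed (r n)) y \<le> (indicator (exceed (\<lambda>i. z i / 2)) y :: real)"
        by (auto simp: indicator_def)
      with soft_exceed_sandwich[OF r0 b(2), where y=y]
      show "norm (soft_exceed (r n) (r' n) y) \<le> indicator (exceed (\<lambda>i. z i / 2)) y"
        using order_trans by fastforce
    qed
    have "AE y in \<nu>. y i \<noteq> ennreal (z i)" for i
      using null[of i] z[of i] level_sets[OF z[of i], of i] sets.sets_into_space[OF level_sets[OF z[of i], of i]]
      by (intro AE_I[of _ _ "{y. y i = ennreal (z i)}"]) (auto simp: atoms_def)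
    then have "AE y in \<nu>. \<forall>i. y i \<noteq> ennreal (z i)" by (simp add: AE_finite_all[OF finite_class.finite_UNIV, simplified])
    then show "AE y in \<nu>. (\<lambda>n. soft_exceed (r n) (r' n) y) \<longlonglongrightarrow> indicator (exceed z) y"
    proof eventually_elim
      case (elim y)
      have "(\<lambda>n. soft_exceed (r n) (r' n) y) \<longlonglongrightarrow> 1 - (\<Prod>i\<in>UNIV. if y i < ennreal (z i) then 1 else 0)"
        unfolding soft_exceed_def using elim by (intro tendsto_diff tendsto_const tendsto_prod lim) auto
      also have "1 - (\<Prod>i\<in>UNIV. if y i < ennreal (z i) then 1 else 0) = (indicator (exceed z) y :: real)"
      proof (cases "y \<in> exceed z")
        case True
        then obtain i where "\<not> y i < ennreal (z i)" unfolding exceed_def by (blast dest: less_asym)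
        then have "(\<Prod>i\<in>UNIV. if y i < ennreal (z i) then 1 else 0 :: real) = 0" by (intro prod_zero) auto
        then show ?thesis using True by simp
      next
        case False
        then have "y i < ennreal (z i)" for i using elim unfolding exceed_def by (metis (mono_tags, lifting) mem_Collect_eq linorder_neqE)
        then show ?thesis using False by simp
      qed
      finally show ?case .
    qed
  qed (rule borel_measurable_indicator[OF exceed_sets])
  also have "(\<integral>y. indicator (exceed z) y \<partial>\<nu>) = measure \<nu> (exceed z)"
    by (simp add: space_nu Int_absorb2[OF exceed_subset_punctured])
  finally show ?thesis .
qed

text \<open>
  The indicator of \<open>exceed z\<close> lies between two continuous functions with compact support, whose
  levels approach \<open>z\<close> from above and from below; as no coordinate of \<open>z\<close> is an atom,
  both integrals converge to the mass of \<open>exceed z\<close>.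
\<close>

lemma tail_convergence:
  assumes z: "\<And>i. 0 < z i" and null: "\<And>i. z i \<notin> atoms i"
  shows "((\<lambda>t. t * tail (a t) z) \<longlongrightarrow> measure \<nu> (exceed z)) at_top"
proof -
  let ?p = "\<lambda>n i. (1 + 1 / real (Suc n)) * z i" and ?q = "\<lambda>n i. (1 - 1 / real (Suc (Suc n))) * z i"
  have p: "z i < ?p n i" for n i using z[of i] by (simp add: field_simps)
  have q: "?q n i < z i" "z i / 2 \<le> ?q n i" for n i using z[of i] by (auto simp: field_simps)
  have q0: "0 < ?q n i" for n i using q(2)[of i n] z[of i] by linarith
  let ?X = "\<lambda>t \<omega> i. ennreal (Y \<omega> i / a t)"
  have ind: "(\<integral>\<omega>. indicator (exceed z) (?X t \<omega>) \<partial>M) = tail (a t) z" "integrable M (\<lambda>\<omega>. indicator (exceed z) (?X t \<omega>) :: real)" if "t > 0" for t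
  proof -
    let ?A = "{\<omega>\<in>space M. \<exists>i. Y \<omega> i > a t * z i}"
    have eq: "indicator (exceed z) (?X t \<omega>) = (indicator ?A \<omega> :: real)" if "\<omega> \<in> space M" for \<omega>
    proof -
      have "ennreal (z i) < ennreal (Y \<omega> i / a t) \<longleftrightarrow> a t * z i < Y \<omega> i" for i
        using z[of i] a_pos[OF \<open>t > 0\<close>] by (subst ennreal_less_iff) (auto simp: field_simps)
      then show ?thesis using that by (auto simp: indicator_def exceed_def)
    qed
    have A: "?A \<in> events" using Y_meas by measurable
    show "(\<integral>\<omega>. indicator (exceed z) (?X t \<omega>) \<partial>M) = tail (a t) z"
      unfolding tail_def using A eq by (subst Bochner_Integration.integral_cong[OF refl eq]) (auto simp: Int_absorb2)
    have "integrable M (indicator ?A :: _ \<Rightarrow> real)" using A by (intro integrable_real_indicator) (auto simp: emeasure_eq_measure)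
    then show "integrable M (\<lambda>\<omega>. indicator (exceed z) (?X t \<omega>) :: real)"
      using eq by (subst Bochner_Integration.integrable_cong[OF refl eq]) auto
  qed
  have intg: "integrable M (\<lambda>\<omega>. soft_exceed r r' (?X t \<omega>))" if "\<And>i. 0 < r i" "\<And>i. r i < r' i" for r r' t
  proof (rule integrable_const_bound[where B=1])
    show "(\<lambda>\<omega>. soft_exceed r r' (?X t \<omega>)) \<in> borel_measurable M"
      by (rule measurable_compose[OF Y_vec_meas borel_measurable_continuous_onI[OF continuous_soft_exceed]])
    show "AE \<omega> in M. norm (soft_exceed r r' (?X t \<omega>)) \<le> 1"
      using soft_exceed_sandwich(3,4)[where z=r and z'=r', OF less_imp_le[OF that(1)] that(2)] by auto
  qed
  show ?thesis
  proof (rule tendsto_between_sequences)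
    show "((\<lambda>t. t * (\<integral>\<omega>. soft_exceed z (?p n) (?X t \<omega>) \<partial>M)) \<longlongrightarrow> (\<integral>y. soft_exceed z (?p n) y \<partial>\<nu>)) at_top" for n
      by (rule soft_tail_convergence[OF z p])
    show "((\<lambda>t. t * (\<integral>\<omega>. soft_exceed (?q n) z (?X t \<omega>) \<partial>M)) \<longlongrightarrow> (\<integral>y. soft_exceed (?q n) z y \<partial>\<nu>)) at_top" for n
      by (rule soft_tail_convergence[OF q0 q(1)])
    show "\<forall>\<^sub>F t in at_top. t * (\<integral>\<omega>. soft_exceed z (?p n) (?X t \<omega>) \<partial>M) \<le> t * tail (a t) z" for n
      using eventually_gt_at_top[of 0]
    proof eventually_elim
      case (elim t)
      have "(\<integral>\<omega>. soft_exceed z (?p n) (?X t \<omega>) \<partial>M) \<le> (\<integral>\<omega>. indicator (exceed z) (?X t \<omega>) \<partial>M)"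
        by (rule integral_mono[OF intg[OF z p] ind(2)[OF elim]])
           (rule soft_exceed_sandwich[OF less_imp_le[OF z] p])
      then show ?case using elim ind(1)[OF elim] by simp
    qed
    show "\<forall>\<^sub>F t in at_top. t * tail (a t) z \<le> t * (\<integral>\<omega>. soft_exceed (?q n) z (?X t \<omega>) \<partial>M)" for n
      using eventually_gt_at_top[of 0]
    proof eventually_elim
      case (elim t)
      have "(\<integral>\<omega>. indicator (exceed z) (?X t \<omega>) \<partial>M) \<le> (\<integral>\<omega>. soft_exceed (?q n) z (?X t \<omega>) \<partial>M)"
        by (rule integral_mono[OF ind(2)[OF elim] intg[OF q0 q(1)]])
           (rule soft_exceed_sandwich[OF less_imp_le[OF q0] q(1)])
      then show ?case using elim ind(1)[OF elim] by simp
    qed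
    have limp: "(\<lambda>n. ennreal (?p n i)) \<longlonglongrightarrow> ennreal (z i)" for i
    proof (rule tendsto_ennrealI)
      have "(\<lambda>n. (1 + inverse (real (Suc n))) * z i) \<longlonglongrightarrow> (1 + 0) * z i"
        by (intro tendsto_intros LIMSEQ_inverse_real_of_nat)
      then show "(\<lambda>n. ?p n i) \<longlonglongrightarrow> z i" by (simp add: inverse_eq_divide)
    qed
    have limq: "(\<lambda>n. ennreal (?q n i)) \<longlonglongrightarrow> ennreal (z i)" for i
    proof (rule tendsto_ennrealI)
      have "(\<lambda>n. (1 - inverse (real (Suc (Suc n)))) * z i) \<longlonglongrightarrow> (1 - 0) * z i"
        by (intro tendsto_intros LIMSEQ_Suc[OF LIMSEQ_inverse_real_of_nat])
      then show "(\<lambda>n. ?q n i) \<longlonglongrightarrow> z i" by (simp add: inverse_eq_divide)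
    qed
    show "(\<lambda>n. \<integral>y. soft_exceed z (?p n) y \<partial>\<nu>) \<longlonglongrightarrow> measure \<nu> (exceed z)"
    proof (rule soft_integral_limit[OF z _ p _ null])
      fix i n show "z i / 2 \<le> z i" using z[of i] by simp
    next
      fix i v assume v: "v \<noteq> ennreal (z i)"
      show "(\<lambda>n. soft_below (z i) (?p n i) v) \<longlonglongrightarrow> (if v < ennreal (z i) then 1 else 0)"
      proof (cases "v < ennreal (z i)")
        case True
        then show ?thesis using z p
          by (intro tendsto_eventually always_eventually allI) (auto intro!: soft_below_eq_1 less_imp_le)
      next
        case False
        with v have "ennreal (z i) < v" by auto
        then have "\<forall>\<^sub>F n in sequentially. ennreal (?p n i) < v" using limp order_tendstoD(2) by blast
        then have "\<forall>\<^sub>F n in sequentially. soft_below (z i) (?p n i) v = 0"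
          by eventually_elim (intro soft_below_eq_0 less_imp_le z p, assumption)
        then show ?thesis using False by (simp add: tendsto_eventually)
      qed
    qed
    show "(\<lambda>n. \<integral>y. soft_exceed (?q n) z y \<partial>\<nu>) \<longlonglongrightarrow> measure \<nu> (exceed z)"
    proof (rule soft_integral_limit[OF z q(2,1) _ null])
      fix i v assume v: "v \<noteq> ennreal (z i)"
      show "(\<lambda>n. soft_below (?q n i) (z i) v) \<longlonglongrightarrow> (if v < ennreal (z i) then 1 else 0)"
      proof (cases "v < ennreal (z i)")
        case True
        then have "\<forall>\<^sub>F n in sequentially. v < ennreal (?q n i)" using limq order_tendstoD(1) by blast
        then have "\<forall>\<^sub>F n in sequentially. soft_below (?q n i) (z i) v = 1"
          by eventually_elim (intro soft_below_eq_1 less_imp_le q0 q(1), assumption)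
        then show ?thesis using True by (simp add: tendsto_eventually)
      next
        case False
        then show ?thesis using q0 q(1)
          by (intro tendsto_eventually always_eventually allI) (auto intro!: soft_below_eq_0 less_imp_le simp: not_less)
      qed
    qed
  qed
qed

end

section \<open>Growth of the normalization and mass at infinity\<close>

text \<open>
  The usual compactness argument on the Euclidean unit sphere.
\<close>

lemma is_norm_equivalence:
  fixes N :: "real ^ 'd::finite \<Rightarrow> real"
  assumes "is_norm N"
  obtains m K where "0 < m" "0 < K" "\<And>x. m * norm x \<le> N x" "\<And>x. N x \<le> K * norm x"
proof -
  have N: "N x = 0 \<longleftrightarrow> x = 0" "N (r *\<^sub>R x) = \<bar>r\<bar> * N x" "N (x + y) \<le> N x + N y" for x y r
    using assms by (auto simp: is_norm_def)
  have sum: "N (\<Sum>i\<in>A. f i) \<le> (\<Sum>i\<in>A. N (f i))" if "finite A" for A :: "'d set" and f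
    using that
  proof (induction A rule: finite_induct)
    case empty
    then show ?case using N(1)[of 0] by simp
  next
    case (insert i A)
    then show ?case using N(3)[of "f i" "sum f A"] by simp
  qed
  have nonneg: "0 \<le> N x" for x
    using N(3)[of x "- x"] N(2)[of "- 1" x] N(1)[of 0] by auto
  define K where "K = (\<Sum>i\<in>UNIV. N (axis i 1)) + 1"
  have K: "0 < K" unfolding K_def using sum_nonneg[of UNIV "\<lambda>i. N (axis i 1)"] nonneg by (simp add: add_nonneg_pos)
  have up: "N x \<le> K * norm x" for x
  proof -
    have "N x = N (\<Sum>i\<in>UNIV. x $ i *\<^sub>R axis i 1)" using basis_expansion[of x] by (simp add: scalar_mult_eq_scaleR)
    also have "\<dots> \<le> (\<Sum>i\<in>UNIV. N (x $ i *\<^sub>R axis i 1))" by (rule sum) simp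
    also have "\<dots> \<le> (\<Sum>i\<in>UNIV. norm x * N (axis i 1))"
      unfolding N(2) using nonneg component_le_norm_cart by (intro sum_mono mult_right_mono) auto
    also have "\<dots> \<le> K * norm x" by (simp add: K_def sum_distrib_left[symmetric] algebra_simps)
    finally show ?thesis .
  qed
  have lip: "\<bar>N x - N y\<bar> \<le> K * norm (x - y)" for x y
    using N(3)[of y "x - y"] N(3)[of x "y - x"] up[of "x - y"] up[of "y - x"] by (auto simp: norm_minus_commute)
  have "continuous_on (sphere 0 1) N"
    unfolding continuous_on_iff
  proof (intro ballI allI impI)
    fix x :: "real ^ 'd" and e :: real assume "0 < e"
    then show "\<exists>d>0. \<forall>x'\<in>sphere 0 1. dist x' x < d \<longrightarrow> dist (N x') (N x) < e"
      using lip K by (intro exI[of _ "e / K"]) (auto simp: dist_norm field_simps intro: le_less_trans)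
  qed
  then obtain z where z: "z \<in> sphere 0 1" "\<And>x. x \<in> sphere 0 1 \<Longrightarrow> N z \<le> N x"
    using continuous_attains_inf[of "sphere 0 1" N] by auto
  have m: "0 < N z" using z(1) nonneg[of z] N(1)[of z] by (cases "N z = 0") auto
  have low: "N z * norm x \<le> N x" for x
  proof (cases "x = 0")
    case False
    have "N z \<le> N (inverse (norm x) *\<^sub>R x)" using False by (intro z(2)) simp
    then show ?thesis using False by (simp add: N(2) field_simps)
  qed (use nonneg in simp)
  show thesis by (rule that[OF m K low up])
qed

text \<open>
  Exceedance of a common level by some coordinate is comparable with exceedance by the norm, up to
  constant factors. In the comparison of scales below these power bounds take the place of
  homogeneity of \<open>\<nu>\<close>.
\<close>

lemma (in vague_tail) radial_bounds:
  fixes N :: "real ^ 'd \<Rightarrow> real"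
  assumes "is_norm N" "c > 0" "\<alpha> > 0"
    and radial: "\<And>r. r > 0 \<Longrightarrow>
           emeasure \<nu> {x \<in> space \<nu>. (\<forall>i. x i < \<infinity>) \<and> N (\<chi> i. enn2real (x i)) \<ge> r} =
           ennreal (c * r powr (- \<alpha>))"
  obtains C1 C2 where "0 < C1" "0 < C2"
    "\<And>r. 0 < r \<Longrightarrow> C1 * r powr - \<alpha> \<le> measure \<nu> {y \<in> exceed (\<lambda>_. r). \<forall>i. y i < \<infinity>}"
    "\<And>r. 0 < r \<Longrightarrow> measure \<nu> {y \<in> exceed (\<lambda>_. r). \<forall>i. y i < \<infinity>} \<le> C2 * r powr - \<alpha>"
proof -
  obtain m K where mK: "0 < m" "0 < K" "\<And>x. m * norm x \<le> N x" "\<And>x. N x \<le> K * norm x"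
    using is_norm_equivalence[OF assms(1)] by blast
  let ?A = "\<lambda>r. {x \<in> space \<nu>. (\<forall>i. x i < \<infinity>) \<and> N (\<chi> i. enn2real (x i)) \<ge> r}"
  let ?B = "\<lambda>r. {y \<in> exceed (\<lambda>_. r). \<forall>i. y i < \<infinity>}"
  let ?d = "real CARD('d)"
  have A: "?A r \<in> sets \<nu>" "measure \<nu> (?A r) = c * r powr - \<alpha>" "emeasure \<nu> (?A r) < \<infinity>" if "0 < r" for r
  proof -
    have "0 < c * r powr - \<alpha>" using assms(2) that by simp
    then show "?A r \<in> sets \<nu>" using radial[OF that] emeasure_notin_sets by force
    show "measure \<nu> (?A r) = c * r powr - \<alpha>" "emeasure \<nu> (?A r) < \<infinity>"
      using radial[OF that] \<open>0 < c * r powr - \<alpha>\<close> by (auto simp: measure_def)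
  qed
  have B: "?B r \<in> sets \<nu>" for r
  proof -
    have eq: "?B r = exceed (\<lambda>_. r) - {y. \<exists>i. y i = \<infinity>}" by (auto simp: less_top[symmetric])
    show ?thesis unfolding eq by (rule sets.Diff[OF exceed_sets inf_set])
  qed
  have Bf: "emeasure \<nu> (?B r) < \<infinity>" if "0 < r" for r
    using emeasure_mono[of "?B r" "exceed (\<lambda>_. r)" \<nu>] emeasure_exceed_finite[of "\<lambda>_. r"] that
    by (auto intro: le_less_trans)
  have upper: "measure \<nu> (?B r) \<le> (c * m powr - \<alpha>) * r powr - \<alpha>" if "0 < r" for r
  proof -
    have "?B r \<subseteq> ?A (m * r)"
    proof
      fix y :: "'d \<Rightarrow> ennreal" assume y: "y \<in> ?B r"
      then obtain i where i: "ennreal r < y i" by (auto simp: exceed_def)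
      have "y i \<noteq> \<infinity>" using y by (auto simp: less_top[symmetric])
      then have "r < enn2real (y i)" using i that by (cases "y i") (auto simp: ennreal_less_iff)
      then have "r < norm (\<chi> i. enn2real (y i))"
        using component_le_norm_cart[of "\<chi> i. enn2real (y i)" i] by simp
      then have "m * r \<le> N (\<chi> i. enn2real (y i))" using mK(3)[of "\<chi> i. enn2real (y i)"] mK(1)
        by (meson less_imp_le mult_left_mono order_trans)
      then show "y \<in> ?A (m * r)" using y exceed_subset_punctured by (auto simp: space_nu)
    qed
    then have "measure \<nu> (?B r) \<le> measure \<nu> (?A (m * r))"
      using A[of "m * r"] B mK(1) that by (intro measure_mono_fmeasurable) (auto simp: fmeasurable_def)
    also have "\<dots> = (c * m powr - \<alpha>) * r powr - \<alpha>"
      using A(2)[of "m * r"] mK(1) that by (simp add: powr_mult)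
    finally show ?thesis .
  qed
  have lower: "(c * (2 * K * ?d) powr - \<alpha>) * r powr - \<alpha> \<le> measure \<nu> (?B r)" if "0 < r" for r
  proof -
    have s: "0 < 2 * K * ?d * r" using mK(2) that by simp
    have "?A (2 * K * ?d * r) \<subseteq> ?B r"
    proof
      fix y :: "'d \<Rightarrow> ennreal" assume y: "y \<in> ?A (2 * K * ?d * r)"
      let ?v = "\<chi> i. enn2real (y i)"
      have "2 * K * ?d * r \<le> K * norm ?v" using y mK(4)[of ?v] by auto
      then have nv: "2 * ?d * r \<le> norm ?v" using mK(2) by (simp add: field_simps)
      have "\<exists>i. 2 * r \<le> enn2real (y i)"
      proof (rule ccontr)
        assume "\<not> (\<exists>i. 2 * r \<le> enn2real (y i))"
        then have lt: "\<bar>?v $ i\<bar> < 2 * r" for i by (auto simp: not_le)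
        have "norm ?v \<le> (\<Sum>i\<in>UNIV. \<bar>?v $ i\<bar>)" by (rule norm_le_l1_cart)
        also have "\<dots> < (\<Sum>i\<in>(UNIV :: 'd set). 2 * r)" by (rule sum_strict_mono) (use lt in auto)
        finally show False using nv by simp
      qed
      then obtain i where i: "2 * r \<le> enn2real (y i)" by blast
      have "y i < \<infinity>" using y by auto
      then have "ennreal r < y i" using i that by (cases "y i") (auto simp: ennreal_less_iff)
      then show "y \<in> ?B r" using y by (auto simp: exceed_def)
    qed
    then have "measure \<nu> (?A (2 * K * ?d * r)) \<le> measure \<nu> (?B r)"
      using A(1)[OF s] B Bf[OF that] by (intro measure_mono_fmeasurable) (auto simp: fmeasurable_def)
    also have "measure \<nu> (?A (2 * K * ?d * r)) = (c * (2 * K * ?d) powr - \<alpha>) * r powr - \<alpha>"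
      using A(2)[OF s] mK(2) that by (simp add: powr_mult)
    finally show ?thesis .
  qed
  show thesis
    by (rule that[OF _ _ lower upper]) (use assms(2) mK in auto)
qed

lemma powr_level:
  fixes \<alpha> C K :: real
  assumes "0 < \<alpha>" "0 < C" "0 < K"
  shows "\<exists>r0>0. (\<forall>r>r0. C * r powr - \<alpha> < K) \<and> (\<forall>r. 0 < r \<longrightarrow> r < r0 \<longrightarrow> K < C * r powr - \<alpha>)"
proof -
  obtain r0 where r0: "0 < r0" "C * r0 powr - \<alpha> = K"
  proof
    show "0 < (K / C) powr (- 1 / \<alpha>)" using assms by simp
    show "C * ((K / C) powr (- 1 / \<alpha>)) powr - \<alpha> = K" using assms by (simp add: powr_powr)
  qed
  have "C * r powr - \<alpha> < K" if "r0 < r" for r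
    using mult_strict_left_mono[OF powr_less_mono2_neg[OF _ r0(1) that, of "- \<alpha>"] assms(2)] assms(1) r0(2) by linarith
  moreover have "K < C * r powr - \<alpha>" if "0 < r" "r < r0" for r
    using mult_strict_left_mono[OF powr_less_mono2_neg[OF _ that, of "- \<alpha>"] assms(2)] assms(1) r0(2) by linarith
  ultimately show ?thesis using r0(1) by blast
qed

locale regular_tail = vague_tail +
  fixes \<alpha> C1 C2 :: real
  assumes alpha: "0 < \<alpha>" "\<alpha> < 1" and C1: "0 < C1" and C2: "0 < C2"
    and radial: "\<And>r. 0 < r \<Longrightarrow> C1 * r powr - \<alpha> \<le> measure \<nu> {y \<in> exceed (\<lambda>_. r). \<forall>i. y i < \<infinity>}"
      "\<And>r. 0 < r \<Longrightarrow> measure \<nu> {y \<in> exceed (\<lambda>_. r). \<forall>i. y i < \<infinity>} \<le> C2 * r powr - \<alpha>"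
begin

definition sup_tail :: "real \<Rightarrow> real" where "sup_tail r = measure \<nu> (exceed (\<lambda>_. r))"

definition atom_levels :: "real set" where "atom_levels = (\<Union>i. atoms i)"

definition inf_mass :: real where "inf_mass = measure \<nu> {y. \<exists>i. y i = \<infinity>}"

lemma countable_atom_levels: "countable atom_levels"
  unfolding atom_levels_def by (intro countable_UN countable_atoms) auto

lemma inf_subset_exceed: "{y. \<exists>i. y i = \<infinity>} \<subseteq> exceed z"
  by (auto simp: exceed_def) (metis ennreal_less_top)

lemma sup_tail_eq: "0 < r \<Longrightarrow> sup_tail r = measure \<nu> {y \<in> exceed (\<lambda>_. r). \<forall>i. y i < \<infinity>} + inf_mass"
proof -
  assume "0 < r"
  let ?A = "exceed (\<lambda>_. r) :: ('b \<Rightarrow> ennreal) set" and ?B = "{y :: 'b \<Rightarrow> ennreal. \<exists>i. y i = \<infinity>}"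
  have eq: "{y \<in> ?A. \<forall>i. y i < \<infinity>} = ?A - ?B"
    by (auto simp: less_top[symmetric])
  have "measure \<nu> (?A - ?B) = measure \<nu> ?A - measure \<nu> ?B"
    using emeasure_exceed_finite[of "\<lambda>_. r"] \<open>0 < r\<close>
    by (intro measure_Diff exceed_sets inf_set inf_subset_exceed) auto
  then show ?thesis unfolding eq sup_tail_def inf_mass_def by simp
qed

lemma inf_mass_nonneg: "0 \<le> inf_mass"
  by (simp add: inf_mass_def)

lemma sup_tail_bounds: "0 < r \<Longrightarrow> C1 * r powr - \<alpha> + inf_mass \<le> sup_tail r" "0 < r \<Longrightarrow> sup_tail r \<le> C2 * r powr - \<alpha> + inf_mass"
  using sup_tail_eq radial by fastforce+

lemma sup_tail_pos: "0 < r \<Longrightarrow> 0 < sup_tail r"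
  using sup_tail_bounds(1)[of r] inf_mass_nonneg C1 by (smt (verit) mult_pos_pos powr_gt_zero)

lemma tail_anti: "s \<le> s' \<Longrightarrow> tail s' (\<lambda>_. 1) \<le> tail s (\<lambda>_. 1)"
  unfolding tail_def by (intro finite_measure_mono) (auto intro: order.strict_trans1)

lemma tail_scale: "tail s (\<lambda>_. r) = tail (s * r) (\<lambda>_. 1)"
  by (simp add: tail_def)

lemma tail_tendsto_sup_tail:
  assumes "0 < r" "r \<notin> atom_levels" "0 < \<tau>"
  shows "((\<lambda>t. t * tail (a (\<tau> * t) * r) (\<lambda>_. 1)) \<longlongrightarrow> sup_tail r / \<tau>) at_top"
proof -
  have "((\<lambda>t. t * tail (a t) (\<lambda>_. r)) \<longlongrightarrow> sup_tail r) at_top"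
    unfolding sup_tail_def by (rule tail_convergence) (use assms in \<open>auto simp: atom_levels_def\<close>)
  moreover have "filterlim (\<lambda>t. \<tau> * t) at_top at_top"
    by (rule filterlim_tendsto_pos_mult_at_top[OF tendsto_const assms(3) filterlim_ident])
  ultimately have "((\<lambda>t. (\<tau> * t) * tail (a (\<tau> * t)) (\<lambda>_. r)) \<longlongrightarrow> sup_tail r) at_top"
    by (rule filterlim_compose)
  from tendsto_divide[OF this tendsto_const[of \<tau>]] show ?thesis
    using assms(3) by (simp add: tail_scale[symmetric])
qed

text \<open>
  The tail probability is antitone in the level. If its limits along two sequences of levels are
  strictly ordered, then so are eventually the levels, in the opposite direction.
\<close>

lemma scale_comparison:
  assumes "0 < r" "r \<notin> atom_levels" "0 < \<tau>" "0 < r'" "r' \<notin> atom_levels" "0 < \<tau>'" and less: "sup_tail r / \<tau> < sup_tail r' / \<tau>'"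
  shows "\<forall>\<^sub>F t in at_top. a (\<tau>' * t) * r' < a (\<tau> * t) * r"
proof -
  obtain c where c: "sup_tail r / \<tau> < c" "c < sup_tail r' / \<tau>'" using less dense by blast
  from order_tendstoD(2)[OF tail_tendsto_sup_tail[OF assms(1-3)] c(1)] order_tendstoD(1)[OF tail_tendsto_sup_tail[OF assms(4-6)] c(2)]
    eventually_gt_at_top[of 0]
  show ?thesis
  proof eventually_elim
    case (elim t)
    then have "t * tail (a (\<tau> * t) * r) (\<lambda>_. 1) < t * tail (a (\<tau>' * t) * r') (\<lambda>_. 1)" by linarith
    then have "tail (a (\<tau> * t) * r) (\<lambda>_. 1) < tail (a (\<tau>' * t) * r') (\<lambda>_. 1)" using elim(3) by simp
    then show ?case using tail_anti by (meson linorder_not_less)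
  qed
qed

text \<open>
  Suppose that there is mass \<open>m > 0\<close> at infinity. Then \<open>sup_tail\<close> tends to \<open>m\<close>, so that in units of
  \<open>1/t\<close> the tail probability stays near \<open>m\<close> over an arbitrarily long range of levels of order \<open>a t\<close>.
  In units of \<open>1/(2 * t)\<close> the same probabilities are near \<open>2 * m\<close>, away from \<open>m\<close>, so that the same
  levels lie between \<open>q1 * a (2 * t)\<close> and \<open>q2 * a (2 * t)\<close> with \<open>q1\<close>, \<open>q2\<close> fixed by the power bounds.
\<close>

lemma inf_mass_zero: "inf_mass = 0"
proof (rule ccontr)
  assume "inf_mass \<noteq> 0"
  then have m: "0 < inf_mass" using inf_mass_nonneg by simp
  obtain x1 where x1: "0 < x1" "\<And>r. 0 < r \<Longrightarrow> r < x1 \<Longrightarrow> 2 * inf_mass < C1 * r powr - \<alpha>"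
    using powr_level[OF alpha(1) C1 mult_pos_pos[OF zero_less_numeral m]] by blast
  obtain q1 where q1: "0 < q1" "q1 < x1" "q1 \<notin> atom_levels" using countable_avoid[OF countable_atom_levels x1(1)] by blast
  obtain x2 where x2: "0 < x2" "\<And>r. x2 < r \<Longrightarrow> C2 * r powr - \<alpha> < inf_mass / 2"
    using powr_level[OF alpha(1) C2 half_gt_zero[OF m]] by blast
  obtain r1 where r1: "x2 < r1" "r1 \<notin> atom_levels" using countable_avoid[OF countable_atom_levels, of x2 "x2 + 1"] by auto
  have r1p: "0 < r1" using r1 x2 by simp
  have "sup_tail r1 / 1 < sup_tail q1 / 2"
    using sup_tail_bounds(2)[OF r1p] sup_tail_bounds(1)[OF q1(1)] x2(2)[OF r1(1)] x1(2)[OF q1(1,2)] by argo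
  from scale_comparison[OF r1p r1(2) _ q1(1,3) _ this]
  have A: "\<forall>\<^sub>F t in at_top. a (2 * t) * q1 < a t * r1" by simp
  \<comment> \<open>\<open>sup_tail\<close> never falls below \<open>inf_mass\<close>, so that \<open>r2\<close> can be arbitrarily large\<close>
  obtain x3 where x3: "0 < x3" "\<And>r. x3 < r \<Longrightarrow> C2 * r powr - \<alpha> < inf_mass"
    using powr_level[OF alpha(1) C2 m] by blast
  obtain q2 where q2: "x3 < q2" "q2 \<notin> atom_levels" using countable_avoid[OF countable_atom_levels, of x3 "x3 + 1"] by auto
  have q2p: "0 < q2" using q2 x3 by simp
  obtain r2 where r2: "r1 * q2 / q1 < r2" "r2 \<notin> atom_levels"
    using countable_avoid[OF countable_atom_levels, of "r1 * q2 / q1" "r1 * q2 / q1 + 1"] by auto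
  have r2p: "0 < r2" using r2(1) r1p q2p q1(1) by (smt (verit) divide_pos_pos mult_pos_pos)
  have "0 < C1 * r2 powr - \<alpha>" using C1 r2p by simp
  then have "sup_tail q2 / 2 < sup_tail r2 / 1"
    using sup_tail_bounds(2)[OF q2p] sup_tail_bounds(1)[OF r2p] x3(2)[OF q2(1)] by argo
  from scale_comparison[OF q2p q2(2) _ r2p r2(2) _ this]
  have B: "\<forall>\<^sub>F t in at_top. a t * r2 < a (2 * t) * q2" by simp
  have "\<forall>\<^sub>F t in at_top. a (2 * t) * q1 < a t * r1 \<and> a t * r2 < a (2 * t) * q2 \<and> 0 < t"
    by (intro eventually_conj A B eventually_gt_at_top)
  then obtain t where t: "a (2 * t) * q1 < a t * r1" "a t * r2 < a (2 * t) * q2" "0 < t"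
    using eventually_happens'[OF trivial_limit_at_top_linorder] by blast
  have "(a t * r2) * q1 < (a (2 * t) * q2) * q1" using t(2) q1(1) by simp
  also have "\<dots> = (a (2 * t) * q1) * q2" by simp
  also have "\<dots> < (a t * r1) * q2" using t(1) q2p by simp
  finally have "a t * (r2 * q1) < a t * (r1 * q2)" by (simp add: ac_simps)
  then have "r2 * q1 < r1 * q2" using a_pos[OF t(3)] by simp
  then show False using r2(1) q1(1) by (simp add: field_simps)
qed

lemma sup_tail_tendsto_0: "(sup_tail \<longlongrightarrow> 0) at_top"
proof -
  have "((\<lambda>r. C2 * r powr - \<alpha>) \<longlongrightarrow> C2 * 0) at_top"
    by (intro tendsto_mult tendsto_const tendsto_neg_powr filterlim_ident) (use alpha in auto)
  then show ?thesis
    using sup_tail_bounds(2) inf_mass_zero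
    by (intro real_tendsto_sandwich[of "\<lambda>_. 0" sup_tail at_top "\<lambda>r. C2 * r powr - \<alpha>" 0])
       (auto intro!: always_eventually eventually_mono[OF eventually_gt_at_top[of 0]] simp: sup_tail_def)
qed

text \<open>
  Since \<open>sup_tail\<close> is of the order of \<open>r powr - \<alpha>\<close>, multiplying time by \<open>s\<close> multiplies \<open>a\<close> by roughly
  \<open>s powr (1 / \<alpha>)\<close>. Because \<open>\<alpha> < 1\<close> this is more than \<open>2 * s\<close> for large \<open>s\<close>, and iterating the
  factor gives superlinear growth.
\<close>

lemma normalization_superlinear: "filterlim (\<lambda>t. a t / t) at_top at_top"
proof -
  \<comment> \<open>stretching time by \<open>s\<close> stretches the normalization by more than \<open>2 * s\<close>\<close>
  define s where "s = (2 powr \<alpha> * C2 / C1 + 2) powr (1 / (1 - \<alpha>))"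
  have b: "2 powr \<alpha> * C2 / C1 + 2 > 1" using C1 C2 by (smt (verit) divide_pos_pos mult_pos_pos powr_gt_zero)
  have s1: "1 < s" unfolding s_def using b alpha by (intro gr_one_powr) auto
  have "s powr (1 - \<alpha>) = 2 powr \<alpha> * C2 / C1 + 2"
    unfolding s_def powr_powr using alpha b by simp
  then have "2 powr \<alpha> * C2 / C1 < s powr (1 - \<alpha>)" by simp
  then have "C2 * 2 powr \<alpha> < C1 * s powr (1 - \<alpha>)" using C1 by (simp add: field_simps)
  then have s2: "C2 / s < C1 * (2 * s) powr - \<alpha>"
    using s1 by (simp add: powr_mult powr_minus powr_diff field_simps)
  have "countable (atom_levels \<union> (\<lambda>x. x / (2 * s)) ` atom_levels)" using countable_atom_levels by auto
  from countable_avoid[OF this, of 1 2] obtain r where r: "1 < r" "r \<notin> atom_levels" "r \<notin> (\<lambda>x. x / (2 * s)) ` atom_levels" by auto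
  define r' where "r' = 2 * s * r"
  have r'D: "r' \<notin> atom_levels"
  proof
    assume "r' \<in> atom_levels"
    then have "r' / (2 * s) \<in> (\<lambda>x. x / (2 * s)) ` atom_levels" by blast
    then show False using r(3) s1 by (simp add: r'_def)
  qed
  have p: "0 < r" "0 < r'" "0 < s" using r s1 by (auto simp: r'_def)
  have "sup_tail r / s \<le> C2 * r powr - \<alpha> / s"
    using sup_tail_bounds(2)[OF p(1)] inf_mass_zero p by (simp add: divide_right_mono)
  also have "\<dots> = (C2 / s) * r powr - \<alpha>" by simp
  also have "\<dots> < (C1 * (2 * s) powr - \<alpha>) * r powr - \<alpha>" using s2 p by (intro mult_strict_right_mono) auto
  also have "\<dots> = C1 * r' powr - \<alpha>" using p by (simp add: r'_def powr_mult)
  also have "\<dots> \<le> sup_tail r' / 1" using sup_tail_bounds(1)[OF p(2)] inf_mass_zero by simp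
  finally have "\<forall>\<^sub>F t in at_top. a (1 * t) * r' < a (s * t) * r"
    by (intro scale_comparison r'D r(2) p) auto
  then have step: "\<forall>\<^sub>F t in at_top. 2 * s * a t < a (s * t)"
  proof eventually_elim
    case (elim t)
    then have "(2 * s * a t) * r < a (s * t) * r" by (simp only: r'_def mult_1 ac_simps)
    then show ?case using p(1) by simp
  qed
  \<comment> \<open>the iteration needs a start bounded away from 0, uniformly over one period \<open>[T, s * T]\<close>\<close>
  have lower: "\<exists>a0>0. \<forall>\<^sub>F t in at_top. a0 \<le> a t"
  proof -
    let ?T = "\<lambda>t. tail (a t * r) (\<lambda>_. 1)"
    have tG: "((\<lambda>t. t * ?T t) \<longlongrightarrow> sup_tail r) at_top"
      using tail_tendsto_sup_tail[OF p(1) r(2), of 1] by simp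
    have "\<forall>\<^sub>F t in at_top. 0 < t * ?T t"
      by (rule order_tendstoD(1)[OF tG sup_tail_pos[OF p(1)]])
    then have "\<forall>\<^sub>F t in at_top. 0 < t \<and> 0 < ?T t"
      using eventually_gt_at_top[of 0] by eventually_elim (simp add: zero_less_mult_iff)
    from eventually_happens'[OF trivial_limit_at_top_linorder this]
    obtain t0 where t0: "0 < t0" "0 < ?T t0" by blast
    let ?v = "?T t0"
    have "\<forall>\<^sub>F t in at_top. t * ?T t < sup_tail r + 1"
      by (rule order_tendstoD(2)[OF tG]) simp
    then have "\<forall>\<^sub>F t in at_top. a t0 \<le> a t"
      using eventually_gt_at_top[of "(sup_tail r + 1) / ?v"] eventually_gt_at_top[of 0]
    proof eventually_elim
      case (elim t)
      have "sup_tail r + 1 < t * ?v" using elim(2) t0(2) by (simp add: field_simps)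
      then have "t * ?T t < t * ?v" using elim(1) by simp
      then have "?T t < ?v" using elim(3) by simp
      then have "\<not> a t * r \<le> a t0 * r" using tail_anti by (meson linorder_not_less)
      then show ?case using p(1) by simp
    qed
    then show ?thesis using a_pos[OF t0(1)] by blast
  qed
  then obtain a0 where a0: "0 < a0" "\<forall>\<^sub>F t in at_top. a0 \<le> a t" by blast
  have "\<forall>\<^sub>F t in at_top. a0 \<le> a t \<and> 2 * s * a t < a (s * t)" using a0(2) step by eventually_elim simp
  then obtain T0 where T0: "\<And>t. T0 \<le> t \<Longrightarrow> a0 \<le> a t \<and> 2 * s * a t < a (s * t)"
    unfolding eventually_at_top_linorder by blast
  define T where "T = max T0 1"
  have T: "0 < T" "\<And>t. T \<le> t \<Longrightarrow> a0 \<le> a t" "\<And>t. T \<le> t \<Longrightarrow> 2 * s * a t \<le> a (s * t)"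
    using T0 by (auto simp: T_def intro: less_imp_le)
  have iter: "T \<le> t \<Longrightarrow> (2 * s) ^ k * a t \<le> a (s ^ k * t)" for k t
  proof (induction k)
    case (Suc k)
    have "T \<le> s ^ k * t" using Suc.prems T(1) s1 one_le_power[of s k] mult_mono[of 1 "s ^ k" T t] by auto
    then have "2 * s * a (s ^ k * t) \<le> a (s * (s ^ k * t))" by (rule T(3))
    moreover have "2 * s * ((2 * s) ^ k * a t) \<le> 2 * s * a (s ^ k * t)"
      using Suc p by (intro mult_left_mono) auto
    ultimately show ?case by (simp add: ac_simps)
  qed simp
  have key: "2 ^ K * (a0 / (s * T)) \<le> a t / t" if t: "s ^ K * T \<le> t" for K t
  proof -
    let ?x = "t / T"
    have x: "s ^ K \<le> ?x" using t T(1) by (simp add: field_simps)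
    obtain j where "?x < s ^ j" using real_arch_pow[OF s1] by blast
    moreover have "\<not> ?x < s ^ 0" using x one_le_power[OF less_imp_le[OF s1], of K] by (simp only: power_0)
    ultimately obtain k where k: "\<forall>i\<le>k. \<not> ?x < s ^ i" "?x < s ^ Suc k"
      using ex_least_nat_less[of "\<lambda>i. ?x < s ^ i" j] by blast
    have "s ^ K < s ^ Suc k" using x k(2) by linarith
    then have "K \<le> k" using power_less_imp_less_exp[OF s1] by fastforce
    have sk: "0 < s ^ k" using p by simp
    have "T \<le> t / s ^ k" using k(1)[rule_format, of k] T(1) sk by (simp add: field_simps)
    from iter[OF this, of k] T(2)[OF this] have "(2 * s) ^ k * a0 \<le> a t"
      using sk p by (smt (verit, best) mult_left_mono nonzero_mult_div_cancel_left times_divide_eq_right zero_less_power)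
    have tp: "0 < t" using x T(1) s1 by (smt (verit) mult_pos_pos t zero_less_power)
    have tb: "t \<le> s ^ Suc k * T" using k(2) T(1) by (simp add: field_simps)
    have "2 ^ K * (a0 / (s * T)) \<le> 2 ^ k * (a0 / (s * T))"
      using \<open>K \<le> k\<close> a0 p T(1) by (intro mult_right_mono power_increasing) auto
    also have "\<dots> = (2 * s) ^ k * a0 / (s ^ Suc k * T)"
      using p by (simp add: power_mult_distrib field_simps)
    also have "\<dots> \<le> (2 * s) ^ k * a0 / t"
      using tb tp a0 p by (intro divide_left_mono) auto
    also have "\<dots> \<le> a t / t" using \<open>(2 * s) ^ k * a0 \<le> a t\<close> tp by (intro divide_right_mono) auto
    finally show ?thesis .
  qed
  show ?thesis
    unfolding filterlim_at_top
  proof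
    fix Z :: real
    obtain K where "Z / (a0 / (s * T)) < 2 ^ K" using real_arch_pow[of 2] by auto
    then have "Z \<le> 2 ^ K * (a0 / (s * T))" using a0 p T(1) by (simp add: field_simps)
    then show "\<forall>\<^sub>F t in at_top. Z \<le> a t / t"
      using key by (intro eventually_mono[OF eventually_ge_at_top[of "s ^ K * T"]]) (meson order_trans)
  qed
qed

end

section \<open>Joint distribution functions of partial maxima\<close>

text \<open>
  The Poisson approximation: \<open>n \<approx> l t\<close> independent trials with success probability \<open>q \<approx> c / t\<close>
  fail simultaneously with probability close to \<open>exp (- l c)\<close>.
\<close>

lemma power_tendsto_exp:
  fixes q n :: "real \<Rightarrow> _"
  assumes q: "\<And>t. 0 \<le> q t" "((\<lambda>t. t * q t) \<longlongrightarrow> c) at_top"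
    and n: "((\<lambda>t. real (n t) / t) \<longlongrightarrow> l) at_top"
  shows "((\<lambda>t. (1 - q t) ^ n t) \<longlongrightarrow> exp (- (l * c))) at_top"
proof -
  let ?e = "\<lambda>t. exp ((real (n t) / t) * (t * ln (1 - q t)))"
  have "((\<lambda>t. (t * q t) * inverse t) \<longlongrightarrow> c * 0) at_top"
    by (intro tendsto_mult q tendsto_inverse_0_at_top filterlim_ident)
  moreover have "\<forall>\<^sub>F t in at_top. (t * q t) * inverse t = q t"
    using eventually_gt_at_top[of 0] by eventually_elim simp
  ultimately have q0: "(q \<longlongrightarrow> 0) at_top" using Lim_transform_eventually by fastforce
  then have small: "\<forall>\<^sub>F t in at_top. q t < 1 / 2" by (rule order_tendstoD) simp
  have "((\<lambda>t. - (t * q t) - 2 * ((t * q t) * q t)) \<longlongrightarrow> - c - 2 * (c * 0)) at_top"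
    by (intro tendsto_intros q q0)
  then have lo: "((\<lambda>t. - (t * q t) - 2 * ((t * q t) * q t)) \<longlongrightarrow> - c) at_top" by simp
  have lim: "((\<lambda>t. t * ln (1 - q t)) \<longlongrightarrow> - c) at_top"
  proof (rule real_tendsto_sandwich[OF _ _ lo tendsto_minus[OF q(2)]])
    show "\<forall>\<^sub>F t in at_top. - (t * q t) - 2 * ((t * q t) * q t) \<le> t * ln (1 - q t)"
      using small eventually_gt_at_top[of 0]
    proof eventually_elim
      case (elim t)
      then have "t * (- q t - 2 * (q t)\<^sup>2) \<le> t * ln (1 - q t)"
        using ln_one_minus_pos_lower_bound[of "q t"] q(1)[of t] by (intro mult_left_mono) auto
      then show ?case by (simp add: algebra_simps power2_eq_square)
    qed
    show "\<forall>\<^sub>F t in at_top. t * ln (1 - q t) \<le> - (t * q t)"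
      using small eventually_gt_at_top[of 0]
    proof eventually_elim
      case (elim t)
      then have "t * ln (1 - q t) \<le> t * (- q t)"
        using ln_one_minus_pos_upper_bound[of "q t"] q(1)[of t] by (intro mult_left_mono) auto
      then show ?case by simp
    qed
  qed
  have "(?e \<longlongrightarrow> exp (l * - c)) at_top"
    by (intro tendsto_exp tendsto_mult n lim)
  moreover have "\<forall>\<^sub>F t in at_top. ?e t = (1 - q t) ^ n t"
    using small eventually_gt_at_top[of 0]
  proof eventually_elim
    case (elim t)
    then have "?e t = exp (real (n t) * ln (1 - q t))" by simp
    also have "\<dots> = (1 - q t) ^ n t" using elim by (simp add: exp_of_nat_mult)
    finally show ?case .
  qed
  ultimately have "((\<lambda>t. (1 - q t) ^ n t) \<longlongrightarrow> exp (l * - c)) at_top"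
    by (rule Lim_transform_eventually)
  then show ?thesis by simp
qed

text \<open>
  The times \<open>j\<close> in \<open>J\<close> whose maximum takes an observation at time \<open>s\<close> into account. As a function
  of \<open>s > 0\<close> this set is piecewise constant, and for nonempty \<open>S\<close> the number \<open>active_length J S\<close> is
  the length of the interval on which it equals \<open>S\<close> (0 if there is none). Grouping the observations by their active
  set avoids having to sort \<open>J\<close>.
\<close>

definition active :: "real set \<Rightarrow> real \<Rightarrow> real set" where "active J s = {j\<in>J. s \<le> j}"

definition active_length :: "real set \<Rightarrow> real set \<Rightarrow> real" where
  "active_length J S = max 0 (Min S - Max (insert 0 (J - S)))"

lemma active_eq_iff:
  assumes "finite J" "S \<subseteq> J" "S \<noteq> {}" "0 < s"
  shows "active J s = S \<longleftrightarrow> Max (insert 0 (J - S)) < s \<and> s \<le> Min S"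
proof -
  have f: "finite S" using assms finite_subset by blast
  have "active J s = S \<longleftrightarrow> (\<forall>j\<in>J - S. j < s) \<and> (\<forall>j\<in>S. s \<le> j)"
    using assms(2) unfolding active_def set_eq_iff mem_Collect_eq Diff_iff Ball_def subset_iff
    by (metis not_le)
  then show ?thesis using assms f by (auto simp: Max_less_iff)
qed

lemma card_active:
  assumes "finite J" "S \<subseteq> J" "S \<noteq> {}" "J \<subseteq> {0..}" "0 < t"
  shows "card {k\<in>{1..nat \<lfloor>t * Max J\<rfloor>}. active J (real k / t) = S} = nat \<lfloor>t * Min S\<rfloor> - nat \<lfloor>t * Max (insert 0 (J - S))\<rfloor>"
proof -
  let ?N = "{k\<in>{1..nat \<lfloor>t * Max J\<rfloor>}. active J (real k / t) = S}"
  let ?A = "Max (insert 0 (J - S))" and ?B = "Min S"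
  have f: "finite S" using assms finite_subset by blast
  have A: "0 \<le> ?A" using assms(1) by (intro Max_ge) auto
  have "?B \<in> J" using Min_in[OF f assms(3)] assms(2) by blast
  then have B: "0 \<le> ?B" "?B \<le> Max J" using assms by auto
  have "?N = {nat \<lfloor>t * ?A\<rfloor><..nat \<lfloor>t * ?B\<rfloor>}"
  proof (intro set_eqI iffI)
    fix k assume "k \<in> ?N"
    then have k: "1 \<le> k" "active J (real k / t) = S" by auto
    then have "?A < real k / t" "real k / t \<le> ?B"
      using active_eq_iff[OF assms(1-3), of "real k / t"] assms(5) by auto
    then have "t * ?A < real k" "real k \<le> t * ?B" using assms(5) by (auto simp: field_simps)
    then show "k \<in> {nat \<lfloor>t * ?A\<rfloor><..nat \<lfloor>t * ?B\<rfloor>}"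
      using A assms(5) by (auto simp: le_nat_floor nat_less_iff floor_less_iff)
  next
    fix k assume k: "k \<in> {nat \<lfloor>t * ?A\<rfloor><..nat \<lfloor>t * ?B\<rfloor>}"
    then have k1: "1 \<le> k" by auto
    have "\<lfloor>t * ?A\<rfloor> < int k" using k by (auto simp: nat_less_iff)
    then have 1: "t * ?A < real k" by (simp add: floor_less_iff)
    have "int k \<le> \<lfloor>t * ?B\<rfloor>" using k k1 by (auto simp: le_nat_iff)
    then have 2: "real k \<le> t * ?B" by (simp add: le_floor_iff)
    have "real k \<le> t * Max J" using 2 mult_left_mono[OF B(2), of t] assms(5) by linarith
    then have "k \<le> nat \<lfloor>t * Max J\<rfloor>" by (simp add: le_nat_floor)
    moreover have "active J (real k / t) = S"
      using active_eq_iff[OF assms(1-3), of "real k / t"] assms(5) k1 1 2 by (auto simp: field_simps)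
    ultimately show "k \<in> ?N" using k1 by auto
  qed
  then show ?thesis by simp
qed

lemma le_nat_floor_iff: "1 \<le> k \<Longrightarrow> k \<le> nat \<lfloor>y\<rfloor> \<longleftrightarrow> real k \<le> y"
  using le_floor_iff[of "int k" y] by auto

lemma floor_ratio_limit:
  assumes "0 \<le> A"
  shows "((\<lambda>t. real (nat \<lfloor>t * A\<rfloor>) / t) \<longlongrightarrow> A) at_top"
proof (rule real_tendsto_sandwich)
  have "((\<lambda>t. A - inverse t) \<longlongrightarrow> A - 0) at_top"
    by (intro tendsto_diff tendsto_const tendsto_inverse_0_at_top filterlim_ident)
  then show "((\<lambda>t. A - inverse t) \<longlongrightarrow> A) at_top" by simp
  show "\<forall>\<^sub>F t in at_top. A - inverse t \<le> real (nat \<lfloor>t * A\<rfloor>) / t"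
    using eventually_gt_at_top[of 0]
  proof eventually_elim
    case (elim t)
    have "t * A - 1 \<le> real (nat \<lfloor>t * A\<rfloor>)" by linarith
    then have "(t * A - 1) / t \<le> real (nat \<lfloor>t * A\<rfloor>) / t" using elim by (intro divide_right_mono) auto
    then show ?case using elim by (simp add: diff_divide_distrib inverse_eq_divide)
  qed
  show "\<forall>\<^sub>F t in at_top. real (nat \<lfloor>t * A\<rfloor>) / t \<le> A"
    using eventually_gt_at_top[of 0]
  proof eventually_elim
    case (elim t)
    have "0 \<le> t * A" using elim assms by simp
    then have "real (nat \<lfloor>t * A\<rfloor>) \<le> t * A" by linarith
    then show ?case using elim by (simp add: field_simps)
  qed
qed (rule tendsto_const)

lemma card_active_ratio:
  assumes "finite J" "S \<subseteq> J" "S \<noteq> {}" "J \<subseteq> {0..}"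
  shows "((\<lambda>t. real (card {k\<in>{1..nat \<lfloor>t * Max J\<rfloor>}. active J (real k / t) = S}) / t) \<longlongrightarrow> active_length J S) at_top"
proof -
  let ?A = "Max (insert 0 (J - S))" and ?B = "Min S"
  have f: "finite S" using assms finite_subset by blast
  have A: "0 \<le> ?A" using assms(1) by (intro Max_ge) auto
  have B: "0 \<le> ?B" using Min_in[OF f assms(3)] assms by auto
  have "((\<lambda>t. max 0 (real (nat \<lfloor>t * ?B\<rfloor>) / t - real (nat \<lfloor>t * ?A\<rfloor>) / t)) \<longlongrightarrow> max 0 (?B - ?A)) at_top"
    by (intro tendsto_max tendsto_const tendsto_diff floor_ratio_limit A B)
  moreover have "\<forall>\<^sub>F t in at_top. max 0 (real (nat \<lfloor>t * ?B\<rfloor>) / t - real (nat \<lfloor>t * ?A\<rfloor>) / t) =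
     real (card {k\<in>{1..nat \<lfloor>t * Max J\<rfloor>}. active J (real k / t) = S}) / t"
    using eventually_gt_at_top[of 0]
  proof eventually_elim
    case (elim t)
    have "real (m - n) / t = max 0 (real m / t - real n / t)" for m n :: nat
      using elim by (cases "n \<le> m") (auto simp: of_nat_diff diff_divide_distrib max_def divide_right_mono not_le divide_strict_right_mono intro: antisym)
    then show ?case using card_active[OF assms elim] by simp
  qed
  ultimately show ?thesis unfolding active_length_def by (rule Lim_transform_eventually)
qed

lemma emeasure_active:
  assumes "finite J" "S \<subseteq> J" "S \<noteq> {}" "J \<subseteq> {0..}"
  shows "{s\<in>{0..}. active J s = S} \<in> sets lborel" "emeasure lborel {s\<in>{0..}. active J s = S} = ennreal (active_length J S)"
proof -
  let ?A = "Max (insert 0 (J - S))" and ?B = "Min S" and ?T = "{s\<in>{0..}. active J s = S}"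
  have f: "finite S" using assms finite_subset by blast
  have A: "0 \<le> ?A" using assms(1) by (intro Max_ge) auto
  have low: "{?A<..?B} \<subseteq> ?T"
  proof
    fix s assume "s \<in> {?A<..?B}"
    then show "s \<in> ?T" using active_eq_iff[OF assms(1-3), of s] A by simp
  qed
  have up: "?T \<subseteq> insert 0 {?A<..?B}"
  proof
    fix s assume s: "s \<in> ?T"
    show "s \<in> insert 0 {?A<..?B}"
    proof (cases "s = 0")
      case False
      then show ?thesis using s active_eq_iff[OF assms(1-3), of s] by simp
    qed simp
  qed
  have "?T = {?A<..?B} \<or> ?T = insert 0 {?A<..?B}" using low up by blast
  then show m: "?T \<in> sets lborel" by auto
  have "emeasure lborel {?A<..?B} \<le> emeasure lborel ?T" using low m by (intro emeasure_mono) auto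
  moreover have "emeasure lborel ?T \<le> emeasure lborel ({?A<..?B} \<union> {0})" using up m by (intro emeasure_mono) auto
  moreover have "emeasure lborel ({?A<..?B} \<union> {0}) = emeasure lborel {?A<..?B}"
    by (rule emeasure_Un_null_set) auto
  moreover have "emeasure lborel {?A<..?B} = ennreal (active_length J S)"
    by (cases "?A \<le> ?B") (auto simp: active_length_def max_def)
  ultimately show "emeasure lborel ?T = ennreal (active_length J S)" by (metis antisym)
qed

text \<open>
  An observation with active set \<open>S\<close> has to respect the smallest of the levels \<open>x j\<close>, \<open>j \<in> S\<close>.
\<close>

definition level_min :: "(real \<Rightarrow> 'd \<Rightarrow> real) \<Rightarrow> real set \<Rightarrow> 'd \<Rightarrow> real" where
  "level_min x S i = Min ((\<lambda>j. x j i) ` S)"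

lemma level_min_in: "finite S \<Longrightarrow> S \<noteq> {} \<Longrightarrow> \<exists>j\<in>S. level_min x S i = x j i"
  unfolding level_min_def using Min_in[of "(\<lambda>j. x j i) ` S"] by blast

lemma exceed_level_min:
  assumes "finite S" "S \<noteq> {}"
  shows "y \<in> exceed (level_min x S) \<longleftrightarrow> (\<exists>j\<in>S. y \<in> exceed (x j))"
proof
  assume "y \<in> exceed (level_min x S)"
  then obtain i where "ennreal (level_min x S i) < y i" by (auto simp: exceed_def)
  then show "\<exists>j\<in>S. y \<in> exceed (x j)" using level_min_in[OF assms, of x i] unfolding exceed_def by fastforce
next
  assume "\<exists>j\<in>S. y \<in> exceed (x j)"
  then obtain j i where ji: "j \<in> S" "ennreal (x j i) < y i" by (auto simp: exceed_def)
  have "level_min x S i \<le> x j i" using ji(1) assms by (auto simp: level_min_def)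
  then show "y \<in> exceed (level_min x S)" using ji(2) unfolding exceed_def
    by (auto intro: order.strict_trans1[OF ennreal_leI])
qed

context vague_tail
begin

definition rate :: "real set \<Rightarrow> (real \<Rightarrow> 'd \<Rightarrow> real) \<Rightarrow> real" where
  "rate J x = (\<Sum>S\<in>Pow J - {{}}. active_length J S * measure \<nu> (exceed (level_min x S)))"

lemma tail_complement: "prob {\<omega>\<in>space M. \<forall>i. Y \<omega> i \<le> s * z i} = 1 - tail s z"
proof -
  have "{\<omega>\<in>space M. \<forall>i. Y \<omega> i \<le> s * z i} = space M - {\<omega>\<in>space M. \<exists>i. Y \<omega> i > s * z i}"
    by (auto simp: not_less) (meson not_le)
  then show ?thesis unfolding tail_def by (simp add: prob_compl)
qed

text \<open>
  Independence and equality of distributions enter through the product formula \<open>iid\<close>. By \<open>tail_convergence\<close> and \<open>card_active_ratio\<close> each active set \<open>S\<close> contributes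
  a factor to which \<open>power_tendsto_exp\<close> applies.
\<close>

lemma block_maxima_distribution:
  fixes Ys :: "nat \<Rightarrow> 'w \<Rightarrow> 'd \<Rightarrow> real"
  assumes iid: "\<And>n b. prob {\<omega>\<in>space M. \<forall>k\<in>{1..n}. \<forall>i. Ys k \<omega> i \<le> b k i} = (\<Prod>k\<in>{1..n}. prob {\<omega>\<in>space M. \<forall>i. Y \<omega> i \<le> b k i})"
    and J: "finite J" "J \<subseteq> {0..}" and x: "\<And>j i. j \<in> J \<Longrightarrow> 0 < x j i" "\<And>j i. j \<in> J \<Longrightarrow> x j i \<notin> atoms i"
  shows "((\<lambda>t. prob {\<omega>\<in>space M. \<forall>j\<in>J. \<forall>k\<in>{1..nat \<lfloor>t * j\<rfloor>}. \<forall>i. Ys k \<omega> i \<le> a t * x j i})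
    \<longlongrightarrow> exp (- rate J x)) at_top"
proof (cases "J = {}")
  case True
  then show ?thesis by (simp add: rate_def prob_space)
next
  case False
  let ?\<nu> = "\<lambda>S. measure \<nu> (exceed (level_min x S))"
  let ?N = "\<lambda>t S. card {k\<in>{1..nat \<lfloor>t * Max J\<rfloor>}. active J (real k / t) = S}"
  let ?P = "Pow J - {{}}"
  have fP: "finite ?P" using J by auto
  have SJ: "finite S" "S \<noteq> {}" "S \<subseteq> J" if "S \<in> ?P" for S using that J finite_subset by auto
  have "((\<lambda>t. \<Prod>S\<in>?P. (1 - tail (a t) (level_min x S)) ^ ?N t S) \<longlongrightarrow>
      (\<Prod>S\<in>?P. exp (- (active_length J S * ?\<nu> S)))) at_top"
  proof (intro tendsto_prod power_tendsto_exp)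
    fix S assume S: "S \<in> ?P"
    note S' = SJ[OF S]
    show "0 \<le> tail (a t) (level_min x S)" for t by (simp add: tail_def)
    show "((\<lambda>t. t * tail (a t) (level_min x S)) \<longlongrightarrow> ?\<nu> S) at_top"
    proof (rule tail_convergence)
      fix i
      obtain j where "j \<in> S" "level_min x S i = x j i" using level_min_in[OF S'(1,2)] by metis
      then show "0 < level_min x S i" "level_min x S i \<notin> atoms i" using x S'(3) by auto
    qed
    show "((\<lambda>t. real (?N t S) / t) \<longlongrightarrow> active_length J S) at_top"
      by (rule card_active_ratio[OF J(1) S'(3,2) J(2)])
  qed
  also have "(\<Prod>S\<in>?P. exp (- (active_length J S * ?\<nu> S))) = exp (- rate J x)"
    unfolding rate_def by (simp add: exp_sum[OF fP] sum_negf[symmetric] del: sum_negf)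
  finally show ?thesis
  proof (rule Lim_transform_eventually)
    show "\<forall>\<^sub>F t in at_top. (\<Prod>S\<in>?P. (1 - tail (a t) (level_min x S)) ^ ?N t S) =
      prob {\<omega>\<in>space M. \<forall>j\<in>J. \<forall>k\<in>{1..nat \<lfloor>t * j\<rfloor>}. \<forall>i. Ys k \<omega> i \<le> a t * x j i}"
      using eventually_gt_at_top[of 0]
    proof eventually_elim
      case (elim t)
      let ?n = "nat \<lfloor>t * Max J\<rfloor>"
      let ?S = "\<lambda>k :: nat. active J (real k / t)"
      have mem: "?S k \<in> ?P" if "k \<in> {1..?n}" for k
      proof -
        have "real k \<le> t * Max J" using that by (auto simp: le_nat_floor_iff)
        then have "Max J \<in> ?S k" using Max_in[OF J(1) False] elim by (auto simp: active_def field_simps)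
        then show ?thesis by (auto simp: active_def)
      qed
      have ev: "(\<forall>j\<in>J. \<forall>k\<in>{1..nat \<lfloor>t * j\<rfloor>}. \<forall>i. Ys k \<omega> i \<le> a t * x j i) \<longleftrightarrow>
          (\<forall>k\<in>{1..?n}. \<forall>i. Ys k \<omega> i \<le> a t * level_min x (?S k) i)" (is "?L \<longleftrightarrow> ?R") for \<omega>
      proof (intro iffI ballI allI)
        fix k i assume L: ?L and k: "k \<in> {1..?n}"
        note S = SJ[OF mem[OF k]]
        obtain j where j: "j \<in> ?S k" "level_min x (?S k) i = x j i" using level_min_in[OF S(1,2)] by metis
        then have "j \<in> J" "real k \<le> t * j" using elim by (auto simp: active_def field_simps)
        then show "Ys k \<omega> i \<le> a t * level_min x (?S k) i" using L k j(2) by (auto simp: le_nat_floor_iff)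
      next
        fix j k i assume R: ?R and jk: "j \<in> J" "k \<in> {1..nat \<lfloor>t * j\<rfloor>}"
        have kj: "real k \<le> t * j" using jk(2) by (auto simp: le_nat_floor_iff)
        also have "\<dots> \<le> t * Max J" using jk(1) J(1) elim by simp
        finally have k: "k \<in> {1..?n}" using jk(2) by (auto simp: le_nat_floor_iff)
        have "j \<in> ?S k" using jk(1) kj elim by (simp add: active_def field_simps)
        then have "level_min x (?S k) i \<le> x j i" using SJ[OF mem[OF k]] by (auto simp: level_min_def)
        then have "a t * level_min x (?S k) i \<le> a t * x j i" using a_pos[OF elim] by simp
        then show "Ys k \<omega> i \<le> a t * x j i" using R k by (meson order_trans)
      qed
      have "prob {\<omega>\<in>space M. \<forall>j\<in>J. \<forall>k\<in>{1..nat \<lfloor>t * j\<rfloor>}. \<forall>i. Ys k \<omega> i \<le> a t * x j i}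
        = (\<Prod>k\<in>{1..?n}. 1 - tail (a t) (level_min x (?S k)))"
        unfolding ev iid tail_complement ..
      also have "\<dots> = (\<Prod>S\<in>?P. \<Prod>k\<in>{k\<in>{1..?n}. ?S k = S}. 1 - tail (a t) (level_min x (?S k)))"
        by (rule prod.group[symmetric]) (use mem fP in \<open>simp_all add: image_subset_iff\<close>)
      also have "\<dots> = (\<Prod>S\<in>?P. (1 - tail (a t) (level_min x S)) ^ ?N t S)"
      proof (rule prod.cong[OF refl])
        fix S
        have "(\<Prod>k\<in>{k\<in>{1..?n}. ?S k = S}. 1 - tail (a t) (level_min x (?S k))) = (\<Prod>k\<in>{k\<in>{1..?n}. ?S k = S}. 1 - tail (a t) (level_min x S))"
          by (rule prod.cong) auto
        then show "(\<Prod>k\<in>{k\<in>{1..?n}. ?S k = S}. 1 - tail (a t) (level_min x (?S k))) = (1 - tail (a t) (level_min x S)) ^ ?N t S"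
          by simp
      qed
      finally show ?case by simp
    qed
  qed
qed

end

section \<open>Distribution functions of the extreme process\<close>

locale poisson_extremes = regular_tail M Y a \<nu> \<alpha> C1 C2
  for M :: "'w measure" and Y :: "'w \<Rightarrow> 'd::finite \<Rightarrow> real" and a \<nu> \<alpha> C1 C2 +
  fixes M' :: "'v measure" and \<Phi> :: "'v \<Rightarrow> (real \<times> ('d \<Rightarrow> ennreal)) set"
  assumes ppp: "poisson_point_process M' (restrict_space lborel {0..} \<Otimes>\<^sub>M \<nu>) \<Phi>"
begin

abbreviation \<mu> :: "(real \<times> ('d \<Rightarrow> ennreal)) measure" where
  "\<mu> \<equiv> restrict_space lborel {0..} \<Otimes>\<^sub>M \<nu>"

lemma prob_space_M': "prob_space M'"
  using ppp by (simp add: poisson_point_process_def)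

sublocale M': prob_space M'
  by (rule prob_space_M')

lemma rect_sets: "T \<in> sets lborel \<Longrightarrow> T \<subseteq> {0..} \<Longrightarrow> A \<in> sets \<nu> \<Longrightarrow> T \<times> A \<in> sets \<mu>"
  by (intro pair_measureI) (auto simp: sets_restrict_space_iff)

lemma emeasure_rect:
  assumes "T \<in> sets lborel" "T \<subseteq> {0..}" "A \<in> sets \<nu>"
  shows "emeasure \<mu> (T \<times> A) = emeasure lborel T * emeasure \<nu> A"
proof -
  interpret N: sigma_finite_measure \<nu> by (rule sigma_finite_nu)
  have "T \<in> sets (restrict_space lborel {0..})" using assms by (auto simp: sets_restrict_space_iff)
  then have "emeasure \<mu> (T \<times> A) = emeasure (restrict_space lborel {0..}) T * emeasure \<nu> A"
    using assms(3) by (rule N.emeasure_pair_measure_Times)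
  also have "emeasure (restrict_space lborel {0..}) T = emeasure lborel T"
    using assms by (intro emeasure_restrict_space) auto
  finally show ?thesis .
qed

lemma points_nonneg:
  assumes "\<omega> \<in> space M'" "(s, y) \<in> \<Phi> \<omega>"
  shows "0 \<le> s \<and> y \<in> space \<nu>"
proof -
  have "\<Phi> \<omega> \<subseteq> space \<mu>"
    using ppp[unfolded poisson_point_process_def, THEN conjunct2, THEN conjunct1] assms(1) by blast
  then have "(s, y) \<in> space \<mu>" using assms(2) by blast
  then show ?thesis by (simp add: space_pair_measure space_restrict_space)
qed

lemma num_points_0_iff: "num_points S B = 0 \<longleftrightarrow> S \<inter> B = {}"
  unfolding num_points_def by (subst emeasure_count_space_eq_0) auto

lemma void_sets: "B \<in> sets \<mu> \<Longrightarrow> {\<omega>\<in>space M'. \<Phi> \<omega> \<inter> B = {}} \<in> sets M'"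
proof -
  assume "B \<in> sets \<mu>"
  then have [measurable]: "(\<lambda>\<omega>. num_points (\<Phi> \<omega>) B) \<in> borel_measurable M'"
    using ppp by (auto simp: poisson_point_process_def)
  have "{\<omega>\<in>space M'. num_points (\<Phi> \<omega>) B = 0} \<in> sets M'" by measurable
  then show ?thesis by (simp add: num_points_0_iff)
qed

lemma void_probability:
  assumes "B \<in> sets \<mu>" "emeasure \<mu> B < \<infinity>"
  shows "M'.prob {\<omega>\<in>space M'. \<Phi> \<omega> \<inter> B = {}} = exp (- measure \<mu> B)"
proof -
  have "\<forall>k::nat. M'.prob {\<omega>\<in>space M'. num_points (\<Phi> \<omega>) B = of_nat k} =
      exp (- measure \<mu> B) * measure \<mu> B ^ k / fact k"
    using ppp assms by (auto simp: poisson_point_process_def)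
  from this[rule_format, of 0] show ?thesis by (simp add: num_points_0_iff)
qed

lemma extreme_le_iff:
  "extreme_process \<Phi> u \<omega> i \<le> c \<longleftrightarrow> (\<forall>(s, y)\<in>\<Phi> \<omega>. s \<le> u \<longrightarrow> y i \<le> c)"
  unfolding extreme_process_def by (auto simp: Sup_apply SUP_le_iff)

lemma extreme_measurable: "(\<lambda>\<omega>. extreme_process \<Phi> u \<omega> i) \<in> borel_measurable M'"
proof (rule borel_measurableI_le)
  fix c :: ennreal
  let ?B = "{s\<in>{0..}. s \<le> u} \<times> {y. c < y i}"
  have "open {y :: 'd \<Rightarrow> ennreal. c < y i}"
    by (intro open_Collect_less continuous_on_const continuous_coordinate)
  then have "{y. c < y i} \<in> sets \<nu>" by (auto simp: sets_nu_iff punctured_orthant_def)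
  then have B: "?B \<in> sets \<mu>" by (intro rect_sets) auto
  have "{\<omega>\<in>space M'. extreme_process \<Phi> u \<omega> i \<le> c} = {\<omega>\<in>space M'. \<Phi> \<omega> \<inter> ?B = {}}"
  proof (intro Collect_cong conj_cong refl)
    fix \<omega> assume \<omega>: "\<omega> \<in> space M'"
    show "extreme_process \<Phi> u \<omega> i \<le> c \<longleftrightarrow> \<Phi> \<omega> \<inter> ?B = {}"
      unfolding extreme_le_iff disjoint_iff Ball_def
    proof (intro iff_allI imp_cong refl)
      fix p assume "p \<in> \<Phi> \<omega>"
      then show "(case p of (s, y) \<Rightarrow> s \<le> u \<longrightarrow> y i \<le> c) \<longleftrightarrow> p \<notin> ?B"
        using points_nonneg[OF \<omega>, of "fst p" "snd p"] by (cases p) (simp add: not_less)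
    qed
  qed
  with void_sets[OF B] show "{\<omega>\<in>space M'. extreme_process \<Phi> u \<omega> i \<le> c} \<in> sets M'" by (simp only:)
qed

text \<open>
  The part of space-time that has to be free of points if the extreme process is to stay below the
  level \<open>x j\<close> at every time \<open>j \<in> J\<close>; written as a disjoint union of rectangles, from which its
  intensity \<open>rate J x\<close> can be read off.
\<close>

definition region :: "real set \<Rightarrow> (real \<Rightarrow> 'd \<Rightarrow> real) \<Rightarrow> (real \<times> ('d \<Rightarrow> ennreal)) set" where
  "region J x = (\<Union>S\<in>Pow J - {{}}. {s\<in>{0..}. active J s = S} \<times> exceed (level_min x S))"

lemma region_iff:
  assumes "finite J"
  shows "(s, y) \<in> region J x \<longleftrightarrow> 0 \<le> s \<and> (\<exists>j\<in>J. s \<le> j \<and> y \<in> exceed (x j))"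
proof -
  have "(s, y) \<in> region J x \<longleftrightarrow> 0 \<le> s \<and> active J s \<noteq> {} \<and> y \<in> exceed (level_min x (active J s))"
    by (auto simp: region_def active_def)
  also have "\<dots> \<longleftrightarrow> 0 \<le> s \<and> (\<exists>j\<in>active J s. y \<in> exceed (x j))"
    using exceed_level_min[of "active J s" y x] assms by (cases "active J s = {}") (auto simp: active_def)
  finally show ?thesis by (auto simp: active_def)
qed

lemma region_measure:
  assumes J: "finite J" "J \<subseteq> {0..}" and x: "\<And>j i. j \<in> J \<Longrightarrow> 0 < x j i"
  shows "region J x \<in> sets \<mu>" "emeasure \<mu> (region J x) = ennreal (rate J x)"
proof -
  let ?P = "Pow J - {{}}" and ?R = "\<lambda>S. {s\<in>{0..}. active J s = S} \<times> exceed (level_min x S)"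
  have SJ: "finite S" "S \<subseteq> J" "S \<noteq> {}" if "S \<in> ?P" for S using that J finite_subset by auto
  have R: "?R S \<in> sets \<mu>" if "S \<in> ?P" for S
    by (intro rect_sets emeasure_active(1) J SJ that) auto
  then show "region J x \<in> sets \<mu>" unfolding region_def using J by auto
  have "emeasure \<mu> (region J x) = (\<Sum>S\<in>?P. emeasure \<mu> (?R S))"
    unfolding region_def
    by (rule sum_emeasure[symmetric]) (use R J in \<open>auto simp: disjoint_family_on_def\<close>)
  also have "\<dots> = (\<Sum>S\<in>?P. ennreal (active_length J S * measure \<nu> (exceed (level_min x S))))"
  proof (rule sum.cong[OF refl])
    fix S assume S: "S \<in> ?P"
    have "0 < level_min x S i" for i
      using level_min_in[OF SJ(1,3)[OF S], of x i] x SJ(2)[OF S] by fastforce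
    then show "emeasure \<mu> (?R S) = ennreal (active_length J S * measure \<nu> (exceed (level_min x S)))"
      using emeasure_active[OF J(1) SJ(2,3)[OF S] J(2)]
      by (subst emeasure_rect) (auto simp: emeasure_exceed ennreal_mult active_length_def)
  qed
  also have "\<dots> = ennreal (rate J x)"
    unfolding rate_def by (rule sum_ennreal) (auto simp: active_length_def)
  finally show "emeasure \<mu> (region J x) = ennreal (rate J x)" .
qed

lemma extreme_distribution:
  assumes J: "finite J" "J \<subseteq> {0..}" and x: "\<And>j i. j \<in> J \<Longrightarrow> 0 < x j i"
  shows "M'.prob {\<omega>\<in>space M'. \<forall>j\<in>J. \<forall>i. extreme_process \<Phi> j \<omega> i \<le> ennreal (x j i)} = exp (- rate J x)"
proof -
  have "{\<omega>\<in>space M'. \<forall>j\<in>J. \<forall>i. extreme_process \<Phi> j \<omega> i \<le> ennreal (x j i)} = {\<omega>\<in>space M'. \<Phi> \<omega> \<inter> region J x = {}}"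
  proof (intro Collect_cong conj_cong refl)
    fix \<omega> assume \<omega>: "\<omega> \<in> space M'"
    have "(\<Phi> \<omega> \<inter> region J x = {}) \<longleftrightarrow> (\<forall>(s, y)\<in>\<Phi> \<omega>. (s, y) \<notin> region J x)" by auto
    also have "\<dots> \<longleftrightarrow> (\<forall>(s, y)\<in>\<Phi> \<omega>. \<forall>j\<in>J. s \<le> j \<longrightarrow> (\<forall>i. y i \<le> ennreal (x j i)))"
    proof (intro ball_cong refl)
      fix p assume "p \<in> \<Phi> \<omega>"
      then show "(case p of (s, y) \<Rightarrow> (s, y) \<notin> region J x) \<longleftrightarrow>
          (case p of (s, y) \<Rightarrow> \<forall>j\<in>J. s \<le> j \<longrightarrow> (\<forall>i. y i \<le> ennreal (x j i)))"
        using points_nonneg[OF \<omega>, of "fst p" "snd p"] region_iff[OF J(1), of "fst p" "snd p" x]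
        by (cases p) (simp add: exceed_def not_less)
    qed
    also have "\<dots> \<longleftrightarrow> (\<forall>j\<in>J. \<forall>i. extreme_process \<Phi> j \<omega> i \<le> ennreal (x j i))"
      unfolding extreme_le_iff by blast
    finally show "(\<forall>j\<in>J. \<forall>i. extreme_process \<Phi> j \<omega> i \<le> ennreal (x j i)) \<longleftrightarrow> \<Phi> \<omega> \<inter> region J x = {}" by simp
  qed
  moreover have "0 \<le> rate J x"
    unfolding rate_def by (intro sum_nonneg) (auto simp: active_length_def)
  ultimately show ?thesis
    using void_probability[of "region J x"] region_measure[OF J x] by (simp add: measure_def)
qed

text \<open>
  The process is below the level \<open>r\<close> at time \<open>u\<close> with probability \<open>exp (- u * sup_tail r)\<close>, which
  tends to 1 as there is no mass at infinity.
\<close>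

lemma extreme_finite:
  assumes "0 \<le> u"
  shows "AE \<omega> in M'. \<forall>i. extreme_process \<Phi> u \<omega> i < \<infinity>"
proof -
  let ?A = "{\<omega>\<in>space M'. \<forall>i. extreme_process \<Phi> u \<omega> i < \<infinity>}"
  have A: "?A \<in> M'.events" using extreme_measurable by measurable
  have lower: "exp (- (u * sup_tail r)) \<le> M'.prob ?A" if "0 < r" for r
  proof -
    have "rate {u} (\<lambda>_ _. r) = u * sup_tail r"
    proof -
      have "Pow {u} - {{}} = {{u}}" by auto
      moreover have "level_min (\<lambda>_ _. r) {u} = (\<lambda>_ :: 'd. r)" by (simp add: level_min_def fun_eq_iff)
      ultimately show ?thesis using assms by (simp add: rate_def active_length_def sup_tail_def)
    qed
    then have "exp (- (u * sup_tail r)) = M'.prob {\<omega>\<in>space M'. \<forall>j\<in>{u}. \<forall>i. extreme_process \<Phi> j \<omega> i \<le> ennreal r}"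
      using extreme_distribution[of "{u}" "\<lambda>_ _. r"] assms that by simp
    also have "\<dots> \<le> M'.prob ?A"
      by (intro M'.finite_measure_mono A) (auto intro: le_less_trans)
    finally show ?thesis .
  qed
  have lim: "((\<lambda>r. exp (- (u * sup_tail r))) \<longlongrightarrow> exp (- (u * 0))) at_top"
    by (intro tendsto_intros sup_tail_tendsto_0)
  have "\<forall>\<^sub>F r in at_top. exp (- (u * sup_tail r)) \<le> M'.prob ?A"
    using eventually_gt_at_top[of 0] by eventually_elim (rule lower)
  from tendsto_upperbound[OF lim this trivial_limit_at_top_linorder] have "1 \<le> M'.prob ?A" by simp
  then have "M'.prob ?A = 1" using M'.prob_le_1 antisym by blast
  then show ?thesis using M'.prob_Collect_eq_1[OF A] by simp
qed

lemma real_extreme_distribution: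
  assumes J: "finite J" "J \<subseteq> {0..}" and x: "\<And>j i. j \<in> J \<Longrightarrow> 0 < x j i"
  shows "M'.prob {\<omega>\<in>space M'. \<forall>j\<in>J. \<forall>i. enn2real (extreme_process \<Phi> j \<omega> i) \<le> x j i} = exp (- rate J x)"
proof -
  let ?R = "{\<omega>\<in>space M'. \<forall>j\<in>J. \<forall>i. enn2real (extreme_process \<Phi> j \<omega> i) \<le> x j i}"
  let ?E = "{\<omega>\<in>space M'. \<forall>j\<in>J. \<forall>i. extreme_process \<Phi> j \<omega> i \<le> ennreal (x j i)}"
  have "M'.prob ?R =
      M'.prob ?E"
  proof (rule M'.finite_measure_eq_AE)
    have "AE \<omega> in M'. \<forall>j\<in>J. \<forall>i. extreme_process \<Phi> j \<omega> i < \<infinity>"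
      using J extreme_finite by (intro AE_finite_allI) auto
    then show "AE \<omega> in M'. \<omega> \<in> ?R \<longleftrightarrow>
       \<omega> \<in> ?E"
    proof eventually_elim
      case (elim \<omega>)
      have "enn2real (extreme_process \<Phi> j \<omega> i) \<le> x j i \<longleftrightarrow> extreme_process \<Phi> j \<omega> i \<le> ennreal (x j i)" if "j \<in> J" for j i
      proof -
        have "extreme_process \<Phi> j \<omega> i \<noteq> \<infinity>" using elim that by (metis less_irrefl)
        then show ?thesis using x[OF that, of i] by (cases "extreme_process \<Phi> j \<omega> i") auto
      qed
      then show ?case by auto
    qed
  qed (use J extreme_measurable in measurable)
  then show ?thesis using extreme_distribution[OF J x] by simp
qed

end

section \<open>Laplace transforms of partial maxima\<close>

text \<open>
  Including 0 gives the value 0 to the maximum over the empty set, in accordance with the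
  convention for the extreme process, and changes nothing for nonnegative \<open>h\<close>.
\<close>

definition partial_max :: "(nat \<Rightarrow> 'a::{linorder,zero}) \<Rightarrow> nat \<Rightarrow> 'a" where
  "partial_max h n = Max (insert 0 (h ` {1..n}))"

lemma partial_max_le_iff: "partial_max h n \<le> c \<longleftrightarrow> 0 \<le> c \<and> (\<forall>k\<in>{1..n}. h k \<le> c)"
  by (simp add: partial_max_def)

lemma partial_max_nonneg: "0 \<le> partial_max h n"
  by (simp add: partial_max_def)

lemma partial_max_ge: "k \<in> {1..n} \<Longrightarrow> h k \<le> partial_max h n"
  unfolding partial_max_def by (intro Max_ge) auto

lemma partial_max_attained: "partial_max h n = 0 \<or> (\<exists>k\<in>{1..n}. partial_max h n = h k)"
  using Max_in[of "insert 0 (h ` {1..n})"] unfolding partial_max_def by blast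

lemma real_partial_max: "real (partial_max h n) = partial_max (\<lambda>k. real (h k)) n"
proof (rule antisym)
  show "partial_max (\<lambda>k. real (h k)) n \<le> real (partial_max h n)"
    by (simp add: partial_max_le_iff partial_max_ge)
  show "real (partial_max h n) \<le> partial_max (\<lambda>k. real (h k)) n"
    using partial_max_attained[of h n] partial_max_nonneg[of "\<lambda>k. real (h k)" n] partial_max_ge[of _ n "\<lambda>k. real (h k)"]
    by auto
qed

lemma partial_max_Suc: "partial_max h (Suc n) = max (h (Suc n)) (partial_max h n)"
proof -
  have "insert 0 (h ` {1..Suc n}) = insert (h (Suc n)) (insert 0 (h ` {1..n}))"
    by (auto simp: atLeastAtMostSuc_conv)
  then show ?thesis by (simp add: partial_max_def)
qed

context poisson_extremes
begin

text \<open>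
  The events \<open>b \<kappa> \<le> exp (- \<theta> w)\<close> are the events \<open>w \<le> - ln (b \<kappa>) / \<theta>\<close>, so that convergence
  of the joint distribution functions is needed at all levels that are not atoms; the images of the
  atoms are the countable sets that the nodes \<open>b\<close> avoid.
\<close>

lemma laplace_of_maxima:
  fixes Ys :: "nat \<Rightarrow> 'w \<Rightarrow> 'd \<Rightarrow> real" and \<theta> :: "real \<Rightarrow> 'd \<Rightarrow> real"
  assumes iid: "\<And>n b. prob {\<omega>\<in>space M. \<forall>k\<in>{1..n}. \<forall>i. Ys k \<omega> i \<le> b k i} = (\<Prod>k\<in>{1..n}. prob {\<omega>\<in>space M. \<forall>i. Y \<omega> i \<le> b k i})"
    and Ys_meas: "\<And>n i. (\<lambda>\<omega>. partial_max (\<lambda>k. Ys k \<omega> i) n) \<in> borel_measurable M"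
    and J: "finite J" "J \<subseteq> {0..}" and \<theta>: "\<And>j i. j \<in> J \<Longrightarrow> 0 < \<theta> j i"
  shows "((\<lambda>t. \<integral>\<omega>. (\<Prod>\<kappa>\<in>J \<times> UNIV. exp (- (\<theta> (fst \<kappa>) (snd \<kappa>) * (partial_max (\<lambda>k. Ys k \<omega> (snd \<kappa>)) (nat \<lfloor>t * fst \<kappa>\<rfloor>) / a t)))) \<partial>M)
    \<longlongrightarrow> (\<integral>\<omega>. (\<Prod>\<kappa>\<in>J \<times> UNIV. exp (- (\<theta> (fst \<kappa>) (snd \<kappa>) * enn2real (extreme_process \<Phi> (fst \<kappa>) \<omega> (snd \<kappa>))))) \<partial>M')) at_top"
proof (rule moment_convergence_from_distribution_functions[where D = "\<lambda>\<kappa>. (\<lambda>r. exp (- (\<theta> (fst \<kappa>) (snd \<kappa>) * r))) ` atoms (snd \<kappa>)"])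
  let ?v = "\<lambda>t \<kappa> \<omega>. exp (- (\<theta> (fst \<kappa>) (snd \<kappa>) * (partial_max (\<lambda>k. Ys k \<omega> (snd \<kappa>)) (nat \<lfloor>t * fst \<kappa>\<rfloor>) / a t)))"
  let ?w = "\<lambda>\<kappa> \<omega>. exp (- (\<theta> (fst \<kappa>) (snd \<kappa>) * enn2real (extreme_process \<Phi> (fst \<kappa>) \<omega> (snd \<kappa>))))"
  show "prob_space M" "prob_space M'" by unfold_locales
  show "finite (J \<times> (UNIV :: 'd set))" using J by simp
  show "countable ((\<lambda>r. exp (- (\<theta> (fst \<kappa>) (snd \<kappa>) * r))) ` atoms (snd \<kappa>))" for \<kappa>
    by (intro countable_image countable_atoms)
  show "(\<lambda>\<omega>. ?v t \<kappa> \<omega>) \<in> borel_measurable M" for t \<kappa>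
    using Ys_meas by measurable
  show "(\<lambda>\<omega>. ?w \<kappa> \<omega>) \<in> borel_measurable M'" for \<kappa>
    using extreme_measurable by measurable
  show "\<forall>\<^sub>F t in at_top. \<forall>\<kappa>\<in>J \<times> UNIV. \<forall>\<omega>\<in>space M.
     0 \<le> ?v t \<kappa> \<omega>
     \<and> ?v t \<kappa> \<omega> \<le> 1"
    using eventually_gt_at_top[of 0]
  proof eventually_elim
    case (elim t)
    then show ?case using \<theta> a_pos[OF elim] partial_max_nonneg
      by (auto intro!: mult_nonneg_nonneg divide_nonneg_nonneg intro: less_imp_le)
  qed
  show "0 \<le> ?w \<kappa> \<omega> \<and>
      ?w \<kappa> \<omega> \<le> 1"
    if "\<kappa> \<in> J \<times> UNIV" for \<kappa> \<omega>
    using \<theta> that by (auto intro!: mult_nonneg_nonneg intro: less_imp_le)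
next
  let ?v = "\<lambda>t \<kappa> \<omega>. exp (- (\<theta> (fst \<kappa>) (snd \<kappa>) * (partial_max (\<lambda>k. Ys k \<omega> (snd \<kappa>)) (nat \<lfloor>t * fst \<kappa>\<rfloor>) / a t)))"
  let ?w = "\<lambda>\<kappa> \<omega>. exp (- (\<theta> (fst \<kappa>) (snd \<kappa>) * enn2real (extreme_process \<Phi> (fst \<kappa>) \<omega> (snd \<kappa>))))"
  fix b :: "real \<times> 'd \<Rightarrow> real"
  assume b: "\<And>\<kappa>. \<kappa> \<in> J \<times> UNIV \<Longrightarrow> 0 < b \<kappa> \<and> b \<kappa> < 1 \<and> b \<kappa> \<notin> (\<lambda>r. exp (- (\<theta> (fst \<kappa>) (snd \<kappa>) * r))) ` atoms (snd \<kappa>)"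
  define x where "x j i = - ln (b (j, i)) / \<theta> j i" for j i
  have bj: "0 < b (j, i)" "b (j, i) < 1" if "j \<in> J" for j i using b[of "(j, i)"] that by auto
  have x0: "0 < x j i" if "j \<in> J" for j i
    unfolding x_def using bj[OF that, of i] \<theta>[OF that, of i] by (intro divide_pos_pos) auto
  have level: "b (j, i) \<le> exp (- (\<theta> j i * w)) \<longleftrightarrow> w \<le> x j i" if "j \<in> J" for j i w
  proof -
    have "b (j, i) \<le> exp (- (\<theta> j i * w)) \<longleftrightarrow> ln (b (j, i)) \<le> - (\<theta> j i * w)"
      using bj[OF that, of i] by (metis exp_gt_zero ln_exp ln_le_cancel_iff)
    also have "\<dots> \<longleftrightarrow> w \<le> x j i" using \<theta>[OF that, of i] by (simp add: x_def field_simps) linarith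
    finally show ?thesis .
  qed
  have xa: "x j i \<notin> atoms i" if "j \<in> J" for j i
  proof
    assume "x j i \<in> atoms i"
    then have "exp (- (\<theta> j i * x j i)) \<in> (\<lambda>r. exp (- (\<theta> j i * r))) ` atoms i" by (rule imageI)
    moreover have "exp (- (\<theta> j i * x j i)) = b (j, i)"
      using bj[OF that, of i] \<theta>[OF that, of i] by (simp add: x_def)
    ultimately show False using b[of "(j, i)"] that by auto
  qed
  have "((\<lambda>t. prob {\<omega>\<in>space M. \<forall>j\<in>J. \<forall>k\<in>{1..nat \<lfloor>t * j\<rfloor>}. \<forall>i. Ys k \<omega> i \<le> a t * x j i})
    \<longlongrightarrow> exp (- rate J x)) at_top"
    by (rule block_maxima_distribution[OF iid J x0 xa])
  also have "exp (- rate J x) = M'.prob {\<omega>\<in>space M'. \<forall>j\<in>J. \<forall>i. enn2real (extreme_process \<Phi> j \<omega> i) \<le> x j i}"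
    by (rule real_extreme_distribution[OF J x0, symmetric])
  also have "{\<omega>\<in>space M'. \<forall>j\<in>J. \<forall>i. enn2real (extreme_process \<Phi> j \<omega> i) \<le> x j i} =
     {\<omega>\<in>space M'. \<forall>\<kappa>\<in>J \<times> UNIV. b \<kappa> \<le> ?w \<kappa> \<omega>}"
    by (auto simp: level)
  finally show "((\<lambda>t. prob {\<omega>\<in>space M. \<forall>\<kappa>\<in>J \<times> UNIV. b \<kappa> \<le> ?v t \<kappa> \<omega>})
     \<longlongrightarrow> M'.prob {\<omega>\<in>space M'. \<forall>\<kappa>\<in>J \<times> UNIV. b \<kappa> \<le> ?w \<kappa> \<omega>}) at_top"
  proof (rule Lim_transform_eventually)
    show "\<forall>\<^sub>F t in at_top. prob {\<omega>\<in>space M. \<forall>j\<in>J. \<forall>k\<in>{1..nat \<lfloor>t * j\<rfloor>}. \<forall>i. Ys k \<omega> i \<le> a t * x j i} =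
      prob {\<omega>\<in>space M. \<forall>\<kappa>\<in>J \<times> UNIV. b \<kappa> \<le> ?v t \<kappa> \<omega>}"
      using eventually_gt_at_top[of 0]
    proof eventually_elim
      case (elim t)
      note at = a_pos[OF elim]
      have lv: "b (j, i) \<le> exp (- (\<theta> j i * (partial_max (\<lambda>k. Ys k \<omega> i) (nat \<lfloor>t * j\<rfloor>) / a t))) \<longleftrightarrow>
          (\<forall>k\<in>{1..nat \<lfloor>t * j\<rfloor>}. Ys k \<omega> i \<le> a t * x j i)" if "j \<in> J" for j i \<omega>
      proof -
        have "partial_max (\<lambda>k. Ys k \<omega> i) (nat \<lfloor>t * j\<rfloor>) / a t \<le> x j i \<longleftrightarrow> partial_max (\<lambda>k. Ys k \<omega> i) (nat \<lfloor>t * j\<rfloor>) \<le> a t * x j i"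
          using at by (simp add: field_simps)
        then show ?thesis
          unfolding level[OF that] using at x0[OF that, of i] by (simp add: partial_max_le_iff)
      qed
      have "{\<omega>\<in>space M. \<forall>j\<in>J. \<forall>k\<in>{1..nat \<lfloor>t * j\<rfloor>}. \<forall>i. Ys k \<omega> i \<le> a t * x j i} =
        {\<omega>\<in>space M. \<forall>\<kappa>\<in>J \<times> UNIV. b \<kappa> \<le> ?v t \<kappa> \<omega>}"
      proof (intro Collect_cong conj_cong refl)
        fix \<omega>
        have "(\<forall>j\<in>J. \<forall>k\<in>{1..nat \<lfloor>t * j\<rfloor>}. \<forall>i. Ys k \<omega> i \<le> a t * x j i) \<longleftrightarrow>
            (\<forall>j\<in>J. \<forall>i. \<forall>k\<in>{1..nat \<lfloor>t * j\<rfloor>}. Ys k \<omega> i \<le> a t * x j i)" by blast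
        also have "\<dots> \<longleftrightarrow> (\<forall>j\<in>J. \<forall>i. b (j, i) \<le> exp (- (\<theta> j i * (partial_max (\<lambda>k. Ys k \<omega> i) (nat \<lfloor>t * j\<rfloor>) / a t))))"
          by (intro ball_cong refl iff_allI lv[symmetric])
        also have "\<dots> \<longleftrightarrow> (\<forall>\<kappa>\<in>J \<times> UNIV. b \<kappa> \<le> ?v t \<kappa> \<omega>)"
          by auto
        finally show "(\<forall>j\<in>J. \<forall>k\<in>{1..nat \<lfloor>t * j\<rfloor>}. \<forall>i. Ys k \<omega> i \<le> a t * x j i) \<longleftrightarrow>
          (\<forall>\<kappa>\<in>J \<times> UNIV. b \<kappa> \<le> ?v t \<kappa> \<omega>)" .
      qed
      then show ?case by simp
    qed
  qed
qed

end

section \<open>The least common multiple of a perturbed multiplicative walk\<close>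

definition coprime_part :: "nat set \<Rightarrow> nat \<Rightarrow> nat" where
  "coprime_part P m = (\<Prod>p\<in>prime_factors m - P. p ^ multiplicity p m)"

lemma split_off_primes:
  assumes "m > 0" "finite P" "P \<subseteq> {p. prime p}"
  shows "m = (\<Prod>p\<in>P. p ^ multiplicity p m) * coprime_part P m"
proof -
  have "m = (\<Prod>p\<in>prime_factors m. p ^ multiplicity p m)"
    using assms(1) by (rule prime_factorization_nat)
  also have "\<dots> = (\<Prod>p\<in>prime_factors m \<inter> P. p ^ multiplicity p m) * coprime_part P m"
    unfolding coprime_part_def by (rule prod.Int_Diff) simp
  also have "(\<Prod>p\<in>prime_factors m \<inter> P. p ^ multiplicity p m) = (\<Prod>p\<in>P. p ^ multiplicity p m)"
  proof (rule prod.mono_neutral_left)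
    show "\<forall>p\<in>P - prime_factors m \<inter> P. p ^ multiplicity p m = 1"
      using assms by (auto simp: prime_factors_multiplicity)
  qed (use assms in auto)
  finally show ?thesis .
qed

lemma coprime_part_pos: "0 < coprime_part P m"
  unfolding coprime_part_def by (intro prod_pos) (auto intro: prime_gt_0_nat dest: in_prime_factors_imp_prime)

lemma ln_coprime_part:
  "ln (real (coprime_part P m)) = (\<Sum>p\<in>prime_factors m - P. real (multiplicity p m) * ln (real p))"
proof -
  have "p > 0" if "p \<in> prime_factors m" for p using that by (auto intro: prime_gt_0_nat)
  then show ?thesis
    unfolding coprime_part_def of_nat_prod of_nat_power by (subst ln_prod) (auto simp: ln_realpow)
qed

lemma prod_dvd_of_coprime:
  fixes f :: "'a \<Rightarrow> nat"
  assumes "finite A" "\<And>a. a \<in> A \<Longrightarrow> f a dvd c" "\<And>a b. a \<in> A \<Longrightarrow> b \<in> A \<Longrightarrow> a \<noteq> b \<Longrightarrow> coprime (f a) (f b)"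
  shows "prod f A dvd c"
  using assms
proof (induction A rule: finite_induct)
  case (insert a A)
  have "coprime (f a) (prod f A)"
    using insert.hyps insert.prems by (intro prod_coprime_right) auto
  then show ?case using insert by (simp add: divides_mult)
qed simp

text \<open>
  Every prime power occurring in some \<open>h k\<close> survives in the least common multiple, which gives the
  lower bound. For the upper bound the product of all \<open>x k\<close> is a crude multiple of every partial
  product; it is good enough because the mean of its logarithm grows only linearly.
\<close>

lemma lcm_of_perturbed_products:
  fixes x h :: "nat \<Rightarrow> nat"
  assumes pos: "\<And>k. k \<in> {1..n} \<Longrightarrow> 0 < x k \<and> 0 < h k" and P: "finite P" "P \<subseteq> {p. prime p}"
  defines "L \<equiv> Lcm ((\<lambda>k. (\<Prod>i=1..k-1. x i) * h k) ` {1..n})"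
    and "m \<equiv> \<lambda>p. partial_max (\<lambda>k. multiplicity p (h k)) n"
  shows "0 < L" "(\<Prod>p\<in>P. p ^ m p) dvd L"
    "L dvd (\<Prod>p\<in>P. p ^ m p) * (\<Prod>k=1..n. x k * coprime_part P (h k))"
proof -
  let ?\<Theta> = "\<lambda>k. (\<Prod>i=1..k-1. x i) * h k"
  have th: "?\<Theta> k \<noteq> 0" if "k \<in> {1..n}" for k using pos that by fastforce
  have "0 \<notin> ?\<Theta> ` {1..n}"
  proof
    assume "0 \<in> ?\<Theta> ` {1..n}"
    then obtain k where "k \<in> {1..n}" "0 = ?\<Theta> k" by (rule imageE)
    then show False using th[of k] by simp
  qed
  then have "L \<noteq> 0" unfolding L_def by (subst Lcm_0_iff) auto
  then show L: "0 < L" by simp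
  have dL: "h k dvd L" if "k \<in> {1..n}" for k
    using dvd_trans[OF dvd_triv_right dvd_Lcm[OF imageI[OF that, of ?\<Theta>]]] unfolding L_def by simp
  show "(\<Prod>p\<in>P. p ^ m p) dvd L"
  proof (rule prod_dvd_of_coprime[OF P(1)])
    fix p assume "p \<in> P"
    show "p ^ m p dvd L"
    proof (cases "m p = 0")
      case False
      then obtain k where k: "k \<in> {1..n}" "m p = multiplicity p (h k)"
        using partial_max_attained[of "\<lambda>k. multiplicity p (h k)" n] by (auto simp: m_def)
      then show ?thesis using dvd_trans[OF multiplicity_dvd dL[OF k(1)]] by simp
    qed simp
  next
    fix p q assume "p \<in> P" "q \<in> P" "p \<noteq> q"
    then have "coprime p q" using P primes_coprime by blast
    then show "coprime (p ^ m p) (q ^ m q)" by simp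
  qed
  show "L dvd (\<Prod>p\<in>P. p ^ m p) * (\<Prod>k=1..n. x k * coprime_part P (h k))"
    unfolding L_def
  proof (rule Lcm_least)
    fix y assume "y \<in> ?\<Theta> ` {1..n}"
    then obtain k where k: "k \<in> {1..n}" "y = ?\<Theta> k" by blast
    have 1: "(\<Prod>i=1..k-1. x i) dvd (\<Prod>i=1..n. x i)" using k by (intro prod_dvd_prod_subset) auto
    have 2: "coprime_part P (h k) dvd (\<Prod>k=1..n. coprime_part P (h k))" using k by (intro dvd_prodI) auto
    have 3: "(\<Prod>p\<in>P. p ^ multiplicity p (h k)) dvd (\<Prod>p\<in>P. p ^ m p)"
      using partial_max_ge[OF k(1)] by (intro prod_dvd_prod le_imp_power_dvd) (simp add: m_def)
    have d: "(\<Prod>i=1..k-1. x i) * ((\<Prod>p\<in>P. p ^ multiplicity p (h k)) * coprime_part P (h k)) dvd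
      (\<Prod>i=1..n. x i) * ((\<Prod>p\<in>P. p ^ m p) * (\<Prod>k=1..n. coprime_part P (h k)))"
      by (rule mult_dvd_mono[OF 1 mult_dvd_mono[OF 3 2]])
    have "h k = (\<Prod>p\<in>P. p ^ multiplicity p (h k)) * coprime_part P (h k)"
      by (rule split_off_primes[OF _ P]) (use pos[OF k(1)] in simp)
    from arg_cong[OF this, of "\<lambda>z. (\<Prod>i=1..k-1. x i) * z"] d k(2)
    have "y dvd (\<Prod>i=1..n. x i) * ((\<Prod>p\<in>P. p ^ m p) * (\<Prod>k=1..n. coprime_part P (h k)))"
      by (simp only:)
    then show "y dvd (\<Prod>p\<in>P. p ^ m p) * (\<Prod>k=1..n. x k * coprime_part P (h k))"
      by (simp add: prod.distrib ac_simps)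
  qed
qed

lemma ln_lcm_of_perturbed_products:
  fixes x h :: "nat \<Rightarrow> nat"
  assumes pos: "\<And>k. k \<in> {1..n} \<Longrightarrow> 0 < x k \<and> 0 < h k" and P: "finite P" "P \<subseteq> {p. prime p}"
  defines "L \<equiv> Lcm ((\<lambda>k. (\<Prod>i=1..k-1. x i) * h k) ` {1..n})"
    and "s \<equiv> \<Sum>p\<in>P. partial_max (\<lambda>k. real (multiplicity p (h k))) n * ln (real p)"
  shows "s \<le> ln (real L)" "ln (real L) \<le> s + (\<Sum>k=1..n. ln (real (x k)) + ln (real (coprime_part P (h k))))"
proof -
  let ?m = "\<lambda>p. partial_max (\<lambda>k. multiplicity p (h k)) n"
  let ?D = "\<Prod>p\<in>P. p ^ ?m p" and ?R = "\<Prod>k=1..n. x k * coprime_part P (h k)"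
  note * = lcm_of_perturbed_products[where n=n and x=x and h=h and P=P, OF pos P, folded L_def]
  have p0: "0 < p" if "p \<in> P" for p using that P by (auto intro: prime_gt_0_nat)
  have D0: "0 < ?D" using p0 by (intro prod_pos) auto
  have R0: "0 < ?R" using pos coprime_part_pos by (intro prod_pos) auto
  have s: "ln (real ?D) = s"
    using p0 P unfolding s_def of_nat_prod of_nat_power real_partial_max[symmetric]
    by (subst ln_prod) (auto simp: ln_realpow)
  have "real ?D \<le> real L" using dvd_imp_le[OF *(2,1)] by (simp only: of_nat_le_iff)
  then show "s \<le> ln (real L)" using D0 unfolding s[symmetric] by (intro ln_mono) (simp_all only: of_nat_0_less_iff)
  have "real L \<le> real (?D * ?R)"
    using dvd_imp_le[OF *(3)] D0 R0 by (simp only: of_nat_le_iff mult_pos_pos)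
  then have "ln (real L) \<le> ln (real (?D * ?R))"
    using *(1) by (intro ln_mono) (simp_all only: of_nat_0_less_iff)
  also have "\<dots> = s + ln (real ?R)"
    using D0 R0 unfolding of_nat_mult s[symmetric] by (intro ln_mult_pos) (simp_all only: of_nat_0_less_iff)
  also have "ln (real ?R) = (\<Sum>k=1..n. ln (real (x k)) + ln (real (coprime_part P (h k))))"
    unfolding of_nat_prod using pos coprime_part_pos
    by (subst ln_prod) (auto intro!: sum.cong simp: ln_mult_pos)
  finally show "ln (real L) \<le> s + (\<Sum>k=1..n. ln (real (x k)) + ln (real (coprime_part P (h k))))" .
qed

text \<open>
  The logarithm of the part of \<open>\<eta>\<close> coprime to \<open>P\<close> is the sum of \<open>\<lambda>\<^sub>p(\<eta>) ln p\<close> over the primes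
  outside \<open>P\<close>; monotone convergence exchanges sum and expectation.
\<close>

lemma integrable_ln_coprime_part:
  assumes "prob_space M" "\<eta> \<in> measurable M (count_space UNIV)" "\<And>\<omega>. \<omega> \<in> space M \<Longrightarrow> 0 < \<eta> \<omega>"
    and int: "\<And>p. prime p \<Longrightarrow> p \<notin> P \<Longrightarrow> integrable M (\<lambda>\<omega>. real (multiplicity p (\<eta> \<omega>)))"
    and sum: "(\<lambda>p. (\<integral>\<omega>. real (multiplicity p (\<eta> \<omega>)) \<partial>M) * ln (real p)) summable_on ({p. prime p} - P)"
  shows "integrable M (\<lambda>\<omega>. ln (real (coprime_part P (\<eta> \<omega>))))"
proof -
  define g where "g p m = (if prime p \<and> p \<notin> P then real (multiplicity p m) * ln (real p) else 0)" for p m :: nat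
  define f where "f p = (if prime p \<and> p \<notin> P then (\<integral>\<omega>. real (multiplicity p (\<eta> \<omega>)) \<partial>M) * ln (real p) else 0)" for p
  have lnp: "0 \<le> ln (real p)" if "prime p" for p :: nat using prime_ge_1_nat[OF that] by simp
  have g0: "0 \<le> g p m" for p m using lnp by (auto simp: g_def)
  have f0: "0 \<le> f p" for p using lnp by (auto simp: f_def intro!: mult_nonneg_nonneg)
  have gm: "(\<lambda>\<omega>. g p (\<eta> \<omega>)) \<in> borel_measurable M" for p
    by (rule measurable_compose[OF assms(2)]) simp
  have gf: "(\<integral>\<^sup>+\<omega>. ennreal (g p (\<eta> \<omega>)) \<partial>M) = ennreal (f p)" for p
  proof (cases "prime p \<and> p \<notin> P")
    case True
    then have "integrable M (\<lambda>\<omega>. g p (\<eta> \<omega>))" using int by (simp add: g_def)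
    then have "(\<integral>\<^sup>+\<omega>. ennreal (g p (\<eta> \<omega>)) \<partial>M) = ennreal (\<integral>\<omega>. g p (\<eta> \<omega>) \<partial>M)"
      using g0 by (intro nn_integral_eq_integral) auto
    then show ?thesis using True by (simp add: g_def f_def)
  qed (auto simp: g_def f_def)
  have "f summable_on UNIV"
    using sum by (rule summable_on_cong_neutral[THEN iffD1, rotated -1]) (auto simp: f_def)
  then have sf: "summable f" using f0 by (simp add: summable_on_UNIV_nonneg_real_iff)
  have pt: "ennreal (ln (real (coprime_part P m))) = (\<Sum>p. ennreal (g p m))" for m
  proof -
    have "(\<Sum>p. ennreal (g p m)) = (\<Sum>p\<in>prime_factors m - P. ennreal (g p m))"
      by (rule suminf_finite[OF finite_Diff[OF finite_set_mset]]) (auto simp: g_def prime_factors_multiplicity)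
    also have "\<dots> = ennreal (\<Sum>p\<in>prime_factors m - P. g p m)" using g0 by simp
    also have "(\<Sum>p\<in>prime_factors m - P. g p m) = ln (real (coprime_part P m))"
      unfolding ln_coprime_part by (rule sum.cong) (auto simp: g_def)
    finally show ?thesis by simp
  qed
  show ?thesis
  proof (rule integrableI_nonneg)
    show "(\<lambda>\<omega>. ln (real (coprime_part P (\<eta> \<omega>)))) \<in> borel_measurable M"
      by (rule measurable_compose[OF assms(2)]) simp
    show "AE \<omega> in M. 0 \<le> ln (real (coprime_part P (\<eta> \<omega>)))"
      using coprime_part_pos[of P] by (intro AE_I2) (simp add: Suc_leI)
    have "(\<integral>\<^sup>+\<omega>. ennreal (ln (real (coprime_part P (\<eta> \<omega>)))) \<partial>M) = (\<Sum>p. \<integral>\<^sup>+\<omega>. ennreal (g p (\<eta> \<omega>)) \<partial>M)"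
      unfolding pt using gm by (intro nn_integral_suminf) auto
    also have "\<dots> = (\<Sum>p. ennreal (f p))" unfolding gf ..
    also have "\<dots> < \<infinity>" using ennreal_suminf_neq_top[OF sf f0] by (simp add: less_top)
    finally show "(\<integral>\<^sup>+\<omega>. ennreal (ln (real (coprime_part P (\<eta> \<omega>)))) \<partial>M) < \<infinity>" .
  qed
qed

lemma measurable_count_space_binop:
  fixes A B :: "'w \<Rightarrow> nat"
  assumes "A \<in> measurable M (count_space UNIV)" "B \<in> measurable M (count_space UNIV)"
  shows "(\<lambda>\<omega>. f (A \<omega>) (B \<omega>)) \<in> measurable M (count_space UNIV)"
proof -
  have "(\<lambda>\<omega>. f i (B \<omega>)) \<in> measurable M (count_space UNIV)" for i
    by (rule measurable_compose[OF assms(2)]) simp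
  then show ?thesis by (rule measurable_compose_countable[OF _ assms(1)])
qed

lemma measurable_walk_lcm:
  assumes "\<And>k. k \<ge> 1 \<Longrightarrow> \<xi>s k \<in> measurable M (count_space UNIV)" "\<And>k. k \<ge> 1 \<Longrightarrow> \<eta>s k \<in> measurable M (count_space UNIV)"
  shows "(\<lambda>\<omega>. walk_lcm \<xi>s \<eta>s n \<omega>) \<in> measurable M (count_space UNIV)"
proof -
  have prod: "(\<lambda>\<omega>. \<Prod>i=1..k. \<xi>s i \<omega>) \<in> measurable M (count_space UNIV)" for k
    by (induction k) (use assms(1) in \<open>auto intro!: measurable_count_space_binop\<close>)
  have walk: "(\<lambda>\<omega>. perturbed_walk \<xi>s \<eta>s k \<omega>) \<in> measurable M (count_space UNIV)" if "k \<ge> 1" for k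
    unfolding perturbed_walk_def walk_prod_def by (rule measurable_count_space_binop[OF prod assms(2)[OF that]])
  show ?thesis
  proof (induction n)
    case 0
    then show ?case by (simp add: walk_lcm_def)
  next
    case (Suc n)
    have "walk_lcm \<xi>s \<eta>s (Suc n) \<omega> = lcm (perturbed_walk \<xi>s \<eta>s (Suc n) \<omega>) (walk_lcm \<xi>s \<eta>s n \<omega>)" for \<omega>
      by (simp add: walk_lcm_def atLeastAtMostSuc_conv)
    then show ?case using measurable_count_space_binop[OF walk[of "Suc n"] Suc, of lcm] by simp
  qed
qed

section \<open>Convergence of the logarithm of the least common multiple\<close>

text \<open>
  Up to an error that is small in mean, \<open>ln L / a\<close> is the linear combination \<open>?X'\<close> of normalized
  maxima. The Laplace transform of \<open>?X'\<close> at finitely many times \<open>u\<close> with weights \<open>e u\<close> is the one in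
  \<open>laplace_of_maxima\<close>, with the weight \<open>e u * ln p\<close> for the maximum belonging to \<open>u\<close> and \<open>p\<close>.
\<close>

theorem theorem9:
  fixes M :: "'w measure"
    and \<xi> \<eta> :: "'w \<Rightarrow> nat"
    and \<xi>s \<eta>s :: "nat \<Rightarrow> 'w \<Rightarrow> nat"
    and P0 :: "nat set"
    and pr :: "'d::finite \<Rightarrow> nat"
    and N :: "real ^ 'd \<Rightarrow> real"
    and a :: "real \<Rightarrow> real"
    and \<nu> :: "('d \<Rightarrow> ennreal) measure"
    and c \<alpha> :: real
    and M' :: "'v measure"
    and \<Phi> :: "'v \<Rightarrow> (real \<times> ('d \<Rightarrow> ennreal)) set"
  assumes "prob_space M"
    and "(\<lambda>\<omega>. (\<xi> \<omega>, \<eta> \<omega>)) \<in> measurable M (count_space UNIV)"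
    and "\<And>\<omega>. \<omega> \<in> space M \<Longrightarrow> \<xi> \<omega> \<ge> 1 \<and> \<eta> \<omega> \<ge> 1"
    and "\<And>k \<omega>. k \<ge> 1 \<Longrightarrow> \<omega> \<in> space M \<Longrightarrow> \<xi>s k \<omega> \<ge> 1 \<and> \<eta>s k \<omega> \<ge> 1"
    and "prob_space.indep_vars M (\<lambda>_. count_space UNIV) (\<lambda>k \<omega>. (\<xi>s k \<omega>, \<eta>s k \<omega>)) {1..}"
    and "\<And>k. k \<ge> 1 \<Longrightarrow>
           distr M (count_space UNIV) (\<lambda>\<omega>. (\<xi>s k \<omega>, \<eta>s k \<omega>)) =
           distr M (count_space UNIV) (\<lambda>\<omega>. (\<xi> \<omega>, \<eta> \<omega>))"
    and "integrable M (\<lambda>\<omega>. ln (real (\<xi> \<omega>)))"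
    and "finite P0" and "P0 \<subseteq> {p. prime p}" and "bij_betw pr UNIV P0"
    and "is_norm N"
    and "\<And>t. t > 0 \<Longrightarrow> a t > 0"
    and "c > 0" and "0 < \<alpha>" and "\<alpha> < 1"
    and "sets \<nu> = sets (restrict_space borel punctured_orthant)"
    and "locally_finite_on punctured_orthant \<nu>"
    and "\<And>r. r > 0 \<Longrightarrow>
           emeasure \<nu> {x \<in> space \<nu>. (\<forall>i. x i < \<infinity>) \<and> N (\<chi> i. enn2real (x i)) \<ge> r} =
           ennreal (c * r powr (- \<alpha>))"
    and "vaguely_converges_on punctured_orthant
           (\<lambda>t. scale_measure (ennreal t)
              (restrict_space
                (distr M borel (\<lambda>\<omega> i. ennreal (real (multiplicity (pr i) (\<eta> \<omega>)) / a t)))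
                punctured_orthant))
           \<nu> at_top"
    and "\<And>p. prime p \<Longrightarrow> p \<notin> P0 \<Longrightarrow> integrable M (\<lambda>\<omega>. real (multiplicity p (\<eta> \<omega>)))"
    and "(\<lambda>p. (\<integral>\<omega>. real (multiplicity p (\<eta> \<omega>)) \<partial>M) * ln (real p))
           summable_on ({p. prime p} - P0)"
    and "poisson_point_process M' (restrict_space lborel {0..} \<Otimes>\<^sub>M \<nu>) \<Phi>"
  shows "fdd_converges {0..}
           M (\<lambda>t u \<omega>. ln (real (walk_lcm \<xi>s \<eta>s (nat \<lfloor>t * u\<rfloor>) \<omega>)) / a t)
           M' (\<lambda>u \<omega>. \<Sum>i\<in>UNIV. enn2real (extreme_process \<Phi> u \<omega> i) * ln (real (pr i)))
           at_top"
proof -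
  let ?p = "\<lambda>k \<omega>. (\<xi>s k \<omega>, \<eta>s k \<omega>)"
  interpret prob_space M by fact
  let ?cp = "coprime_part P0"
  let ?Y = "\<lambda>\<omega> i. real (multiplicity (pr i) (\<eta> \<omega>))"
  let ?Ys = "\<lambda>k \<omega> i. real (multiplicity (pr i) (\<eta>s k \<omega>))"
  have pair_meas: "?p k \<in> measurable M (count_space UNIV)" if "k \<ge> 1" for k
    using assms(5) that by (auto simp: indep_vars_def)
  have \<eta>_meas: "\<eta> \<in> measurable M (count_space UNIV)"
    using measurable_compose[OF assms(2), of snd "count_space UNIV"] by simp
  have \<xi>s_meas: "\<xi>s k \<in> measurable M (count_space UNIV)" if "k \<ge> 1" for k
    using measurable_compose[OF pair_meas[OF that], of fst "count_space UNIV"] by simp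
  have \<eta>s_meas: "\<eta>s k \<in> measurable M (count_space UNIV)" if "k \<ge> 1" for k
    using measurable_compose[OF pair_meas[OF that], of snd "count_space UNIV"] by simp
  have prime_pr: "prime (pr i)" for i
    using assms(9,10) bij_betw_apply[OF assms(10), of i] by auto
  have ln_pr: "0 < ln (real (pr i))" for i
    using prime_gt_1_nat[OF prime_pr[of i]] by simp

  interpret T: vague_tail M ?Y a \<nu>
  proof unfold_locales
    show "(\<lambda>\<omega>. ?Y \<omega> i) \<in> borel_measurable M" for i
      by (rule measurable_compose[OF \<eta>_meas]) simp
  qed (use assms in auto)
  obtain C1 C2 where C: "0 < C1" "0 < C2"
    "\<And>r. 0 < r \<Longrightarrow> C1 * r powr - \<alpha> \<le> measure \<nu> {y \<in> exceed (\<lambda>_. r). \<forall>i. y i < \<infinity>}"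
    "\<And>r. 0 < r \<Longrightarrow> measure \<nu> {y \<in> exceed (\<lambda>_. r). \<forall>i. y i < \<infinity>} \<le> C2 * r powr - \<alpha>"
    using T.radial_bounds[OF assms(11,13,14,18)] by blast
  interpret E: poisson_extremes M ?Y a \<nu> \<alpha> C1 C2 M' \<Phi>
    by unfold_locales (use C assms(14,15,22) in auto)

  let ?X = "\<lambda>t u \<omega>. ln (real (walk_lcm \<xi>s \<eta>s (nat \<lfloor>t * u\<rfloor>) \<omega>)) / a t"
  let ?pm = "\<lambda>n \<omega> i. partial_max (\<lambda>k. ?Ys k \<omega> i) n"
  let ?S = "\<lambda>n \<omega>. \<Sum>i\<in>UNIV. ?pm n \<omega> i * ln (real (pr i))"
  let ?X' = "\<lambda>t u \<omega>. ?S (nat \<lfloor>t * u\<rfloor>) \<omega> / a t"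
  let ?Z = "\<lambda>u \<omega>. \<Sum>i\<in>UNIV. enn2real (extreme_process \<Phi> u \<omega> i) * ln (real (pr i))"
  have X_meas: "?X t u \<in> borel_measurable M" for t u
    by (intro borel_measurable_divide borel_measurable_const measurable_compose[OF measurable_walk_lcm[OF \<xi>s_meas \<eta>s_meas]]) auto
  have pm_meas: "(\<lambda>\<omega>. ?pm n \<omega> i) \<in> borel_measurable M" for n i
  proof (induction n)
    case (Suc n)
    have "?pm (Suc n) \<omega> i = max (?Ys (Suc n) \<omega> i) (?pm n \<omega> i)" for \<omega>
      by (rule partial_max_Suc)
    moreover have "(\<lambda>\<omega>. ?Ys (Suc n) \<omega> i) \<in> borel_measurable M"
      by (rule measurable_compose[OF \<eta>s_meas]) auto
    ultimately show ?case using Suc by simp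
  qed (simp add: partial_max_def)
  have X'_meas: "?X' t u \<in> borel_measurable M" for t u
    using pm_meas by measurable

  \<comment> \<open>a bound for the contribution of the primes outside \<open>P0\<close> and of the walk\<close>
  define R where "R n \<omega> = (\<Sum>k=1..n. ln (real (\<xi>s k \<omega>)) + ln (real (?cp (\<eta>s k \<omega>))))" for n \<omega>
  have sandwich: "?S n \<omega> \<le> ln (real (walk_lcm \<xi>s \<eta>s n \<omega>))"
    "ln (real (walk_lcm \<xi>s \<eta>s n \<omega>)) \<le> ?S n \<omega> + R n \<omega>"
    if "\<omega> \<in> space M" for n \<omega>
  proof -
    have pos: "0 < \<xi>s k \<omega> \<and> 0 < \<eta>s k \<omega>" if "k \<in> {1..n}" for k
      using assms(4)[of k \<omega>] that \<open>\<omega> \<in> space M\<close> by auto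
    have eq: "?S n \<omega> =
        (\<Sum>p\<in>P0. partial_max (\<lambda>k. real (multiplicity p (\<eta>s k \<omega>))) n * ln (real p))"
      by (rule sum.reindex_bij_betw[OF assms(10), where g="\<lambda>p. partial_max (\<lambda>k. real (multiplicity p (\<eta>s k \<omega>))) n * ln (real p)"])
    note * = ln_lcm_of_perturbed_products[where n=n and x="\<lambda>k. \<xi>s k \<omega>" and h="\<lambda>k. \<eta>s k \<omega>" and P=P0, OF pos assms(8,9)]
    show "?S n \<omega> \<le> ln (real (walk_lcm \<xi>s \<eta>s n \<omega>))"
      unfolding eq walk_lcm_def perturbed_walk_def walk_prod_def by (rule *(1))
    show "ln (real (walk_lcm \<xi>s \<eta>s n \<omega>)) \<le> ?S n \<omega> + R n \<omega>"
      unfolding eq walk_lcm_def perturbed_walk_def walk_prod_def R_def by (rule *(2))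
  qed
  have X'_nonneg: "0 \<le> ?X' t u \<omega>" if "t > 0" for t u \<omega>
    using assms(12)[OF that] ln_pr by (intro divide_nonneg_pos sum_nonneg mult_nonneg_nonneg partial_max_nonneg) (auto intro: less_imp_le)
  have X'_le_X: "?X' t u \<omega> \<le> ?X t u \<omega>" and X_le: "?X t u \<omega> - ?X' t u \<omega> \<le> R (nat \<lfloor>t * u\<rfloor>) \<omega> / a t"
    if "t > 0" "\<omega> \<in> space M" for t u \<omega>
    using sandwich[OF that(2), of "nat \<lfloor>t * u\<rfloor>"] assms(12)[OF that(1)]
    by (auto simp: divide_right_mono diff_divide_distrib[symmetric])

  define f where "f = (\<lambda>(x, y). ln (real x) + ln (real (?cp y)))"
  define C where "C = (\<integral>\<omega>. f (\<xi> \<omega>, \<eta> \<omega>) \<partial>M)"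
  have "integrable M (\<lambda>\<omega>. ln (real (?cp (\<eta> \<omega>))))"
    using assms(3) by (intro integrable_ln_coprime_part[OF assms(1) \<eta>_meas _ assms(20,21)]) fastforce
  then have f_int: "integrable M (\<lambda>\<omega>. f (\<xi> \<omega>, \<eta> \<omega>))"
    unfolding f_def using assms(7) by simp
  have fs: "integrable M (\<lambda>\<omega>. f (\<xi>s k \<omega>, \<eta>s k \<omega>))" "(\<integral>\<omega>. f (\<xi>s k \<omega>, \<eta>s k \<omega>) \<partial>M) = C" if "k \<ge> 1" for k
  proof -
    have f_meas: "f \<in> borel_measurable (count_space UNIV)" by simp
    have "integrable (distr M (count_space UNIV) (\<lambda>\<omega>. (\<xi> \<omega>, \<eta> \<omega>))) f"
      using f_int by (simp add: integrable_distr_eq[OF assms(2) f_meas])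
    then show "integrable M (\<lambda>\<omega>. f (\<xi>s k \<omega>, \<eta>s k \<omega>))"
      unfolding assms(6)[OF that, symmetric] by (simp add: integrable_distr_eq[OF pair_meas[OF that] f_meas])
    show "(\<integral>\<omega>. f (\<xi>s k \<omega>, \<eta>s k \<omega>) \<partial>M) = C"
      unfolding C_def integral_distr[OF pair_meas[OF that] f_meas, symmetric] assms(6)[OF that]
      by (rule integral_distr[OF assms(2) f_meas])
  qed
  have R_eq: "R n \<omega> = (\<Sum>k=1..n. f (\<xi>s k \<omega>, \<eta>s k \<omega>))" for n \<omega>
    by (simp add: R_def f_def)
  have R_int: "integrable M (R n)" for n
    unfolding R_eq using fs(1) by (intro Bochner_Integration.integrable_sum) auto
  have R_exp: "(\<integral>\<omega>. R n \<omega> \<partial>M) = real n * C" for n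
    unfolding R_eq using fs by (subst Bochner_Integration.integral_sum) auto
  have C0: "0 \<le> C"
    unfolding C_def
  proof (rule integral_nonneg_AE, rule AE_I2)
    fix \<omega> assume "\<omega> \<in> space M"
    then show "0 \<le> f (\<xi> \<omega>, \<eta> \<omega>)"
      using assms(3)[of \<omega>] coprime_part_pos[of P0 "\<eta> \<omega>"] by (simp add: f_def Suc_leI)
  qed
  have diff_int: "integrable M (\<lambda>\<omega>. ?X t u \<omega> - ?X' t u \<omega>)" if "t > 0" for t u
  proof (rule Bochner_Integration.integrable_bound[OF integrable_divide[OF R_int]])
    show "(\<lambda>\<omega>. ?X t u \<omega> - ?X' t u \<omega>) \<in> borel_measurable M"
      by (rule borel_measurable_diff[OF X_meas X'_meas])
    show "AE \<omega> in M. norm (?X t u \<omega> - ?X' t u \<omega>) \<le> norm (R (nat \<lfloor>t * u\<rfloor>) \<omega> / a t)"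
    proof (rule AE_I2)
      fix \<omega> assume "\<omega> \<in> space M"
      from X'_le_X[OF that this, of u] X_le[OF that this, of u]
      show "norm (?X t u \<omega> - ?X' t u \<omega>) \<le> norm (R (nat \<lfloor>t * u\<rfloor>) \<omega> / a t)"
        unfolding real_norm_def by linarith
    qed
  qed
  \<comment> \<open>\<open>R n\<close> has mean \<open>n * C\<close>, and \<open>n \<le> t * u\<close> is negligible against \<open>a t\<close>\<close>
  have diff_exp: "((\<lambda>t. \<integral>\<omega>. ?X t u \<omega> - ?X' t u \<omega> \<partial>M) \<longlongrightarrow> 0) at_top" if "0 \<le> u" for u
  proof (rule real_tendsto_sandwich[where f = "\<lambda>_. 0" and h = "\<lambda>t. u * C * inverse (a t / t)"])
    have "((\<lambda>t. u * C * inverse (a t / t)) \<longlongrightarrow> u * C * 0) at_top"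
      by (intro tendsto_mult tendsto_const tendsto_inverse_0_at_top E.normalization_superlinear)
    then show "((\<lambda>t. u * C * inverse (a t / t)) \<longlongrightarrow> 0) at_top" by simp
    show "\<forall>\<^sub>F t in at_top. 0 \<le> (\<integral>\<omega>. ?X t u \<omega> - ?X' t u \<omega> \<partial>M)"
      using eventually_gt_at_top[of 0]
    proof eventually_elim
      case (elim t)
      show ?case by (rule Bochner_Integration.integral_nonneg) (use X'_le_X[OF elim] in simp)
    qed
    show "\<forall>\<^sub>F t in at_top. (\<integral>\<omega>. ?X t u \<omega> - ?X' t u \<omega> \<partial>M) \<le> u * C * inverse (a t / t)"
      using eventually_gt_at_top[of 0]
    proof eventually_elim
      case (elim t)
      have "(\<integral>\<omega>. ?X t u \<omega> - ?X' t u \<omega> \<partial>M) \<le> (\<integral>\<omega>. R (nat \<lfloor>t * u\<rfloor>) \<omega> / a t \<partial>M)"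
        by (rule integral_mono[OF diff_int[OF elim] integrable_divide[OF R_int] X_le[OF elim]])
      also have "\<dots> = real (nat \<lfloor>t * u\<rfloor>) * C / a t" by (simp add: R_exp)
      also have "\<dots> \<le> (t * u) * C / a t"
      proof (intro divide_right_mono mult_right_mono C0)
        have "0 \<le> t * u" using elim that by simp
        then show "real (nat \<lfloor>t * u\<rfloor>) \<le> t * u" by linarith
      qed (use assms(12)[OF elim] in simp)
      also have "\<dots> = u * C * inverse (a t / t)" by (simp add: field_simps)
      finally show ?case .
    qed
  qed (rule tendsto_const)

  have iid: "prob {\<omega>\<in>space M. \<forall>k\<in>{1..n}. \<forall>i. ?Ys k \<omega> i \<le> b k i} =
      (\<Prod>k\<in>{1..n}. prob {\<omega>\<in>space M. \<forall>i. ?Y \<omega> i \<le> b k i})" for n b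
  proof (cases "n = 0")
    case False
    let ?P = "\<lambda>k. prob {\<omega>\<in>space M. \<forall>i. ?Y \<omega> i \<le> b k i}"
    let ?A = "\<lambda>k. {(x :: nat, y). \<forall>i. real (multiplicity (pr i) y) \<le> b k i}"
    have "prob (\<Inter>k\<in>{1..n}. ?p k -` ?A k \<inter> space M) =
        (\<Prod>k\<in>{1..n}. prob (?p k -` ?A k \<inter> space M))"
      by (rule indep_varsD[OF assms(5)]) (use False in auto)
    also have "(\<Inter>k\<in>{1..n}. ?p k -` ?A k \<inter> space M) =
        {\<omega>\<in>space M. \<forall>k\<in>{1..n}. \<forall>i. ?Ys k \<omega> i \<le> b k i}"
      using False by auto
    also have "(\<Prod>k\<in>{1..n}. prob (?p k -` ?A k \<inter> space M)) =
        (\<Prod>k\<in>{1..n}. ?P k)"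
    proof (rule prod.cong[OF refl])
      fix k assume "k \<in> {1..n}"
      then have k: "k \<ge> 1" by simp
      have "prob (?p k -` ?A k \<inter> space M) = measure (distr M (count_space UNIV) (?p k)) (?A k)"
        by (rule measure_distr[OF pair_meas[OF k], symmetric]) simp
      also have "\<dots> = prob ((\<lambda>\<omega>. (\<xi> \<omega>, \<eta> \<omega>)) -` ?A k \<inter> space M)"
        unfolding assms(6)[OF k] by (rule measure_distr[OF assms(2)]) simp
      also have "(\<lambda>\<omega>. (\<xi> \<omega>, \<eta> \<omega>)) -` ?A k \<inter> space M = {\<omega>\<in>space M. \<forall>i. ?Y \<omega> i \<le> b k i}" by auto
      finally show "prob (?p k -` ?A k \<inter> space M) = ?P k" .
    qed
    finally show ?thesis .
  qed (simp add: prob_space)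

  show ?thesis
  proof (rule fdd_convergence_from_laplace[OF assms(1) E.prob_space_M'])
    show "?X t u \<in> borel_measurable M" for t u by (rule X_meas)
    show "?Z u \<in> borel_measurable M'" for u using E.extreme_measurable by measurable
    show "\<forall>\<^sub>F t in at_top. \<forall>u\<in>{0..}. \<forall>\<omega>\<in>space M. 0 \<le> ?X t u \<omega>"
      using eventually_gt_at_top[of 0]
      by eventually_elim (use X'_nonneg X'_le_X order_trans in blast)
    show "0 \<le> ?Z u \<omega>" for u \<omega> using ln_pr by (intro sum_nonneg mult_nonneg_nonneg) (auto intro: less_imp_le)
    fix I and e :: "real \<Rightarrow> nat"
    assume I: "finite I" "I \<subseteq> {0..}" and e: "\<And>u. u \<in> I \<Longrightarrow> 0 < e u"
    show "((\<lambda>t. \<integral>\<omega>. exp (- (\<Sum>u\<in>I. real (e u) * ?X t u \<omega>)) \<partial>M) \<longlongrightarrow> (\<integral>\<omega>. exp (- (\<Sum>u\<in>I. real (e u) * ?Z u \<omega>)) \<partial>M')) at_top"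
    proof (rule laplace_perturbation[OF assms(1) I(1), where X'="?X'"])
      show "\<forall>\<^sub>F t in at_top. \<forall>u\<in>I. \<forall>\<omega>\<in>space M. 0 \<le> ?X' t u \<omega> \<and> ?X' t u \<omega> \<le> ?X t u \<omega>"
        using eventually_gt_at_top[of 0] by eventually_elim (use X'_nonneg X'_le_X in blast)
      show "\<forall>\<^sub>F t in at_top. \<forall>u\<in>I. integrable M (\<lambda>\<omega>. ?X t u \<omega> - ?X' t u \<omega>)"
        using eventually_gt_at_top[of 0] by eventually_elim (use diff_int in blast)
      show "((\<lambda>t. \<integral>\<omega>. ?X t u \<omega> - ?X' t u \<omega> \<partial>M) \<longlongrightarrow> 0) at_top" if "u \<in> I" for u
        using that I by (intro diff_exp) auto
      let ?\<theta> = "\<lambda>j i. real (e j) * ln (real (pr i))"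
      have prod_exp: "(\<Prod>\<kappa>\<in>I \<times> UNIV. exp (- (?\<theta> (fst \<kappa>) (snd \<kappa>) * w (fst \<kappa>) (snd \<kappa>)))) =
          exp (- (\<Sum>u\<in>I. real (e u) * (\<Sum>i\<in>UNIV. w u i * ln (real (pr i)))))" for w :: "real \<Rightarrow> 'd \<Rightarrow> real"
      proof -
        have "(\<Prod>\<kappa>\<in>I \<times> UNIV. exp (- (?\<theta> (fst \<kappa>) (snd \<kappa>) * w (fst \<kappa>) (snd \<kappa>)))) =
            exp (\<Sum>\<kappa>\<in>I \<times> UNIV. - (?\<theta> (fst \<kappa>) (snd \<kappa>) * w (fst \<kappa>) (snd \<kappa>)))"
          using I(1) by (simp add: exp_sum)
        also have "(\<Sum>\<kappa>\<in>I \<times> UNIV. - (?\<theta> (fst \<kappa>) (snd \<kappa>) * w (fst \<kappa>) (snd \<kappa>))) =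
            (\<Sum>u\<in>I. \<Sum>i\<in>UNIV. - (?\<theta> u i * w u i))"
          by (simp add: sum.cartesian_product case_prod_beta)
        also have "\<dots> = - (\<Sum>u\<in>I. real (e u) * (\<Sum>i\<in>UNIV. w u i * ln (real (pr i))))"
          by (simp add: sum_negf sum_distrib_left ac_simps)
        finally show ?thesis .
      qed
      have X'_eq: "?X' t u \<omega> = (\<Sum>i\<in>UNIV. (?pm (nat \<lfloor>t * u\<rfloor>) \<omega> i / a t) * ln (real (pr i)))" for t u \<omega>
        by (simp add: sum_divide_distrib)
      have \<theta>_pos: "0 < ?\<theta> j i" if "j \<in> I" for j i using e[OF that] ln_pr[of i] by simp
      from E.laplace_of_maxima[where Ys="?Ys" and J=I and \<theta>="?\<theta>", OF iid pm_meas I \<theta>_pos]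
      show "((\<lambda>t. \<integral>\<omega>. exp (- (\<Sum>u\<in>I. real (e u) * ?X' t u \<omega>)) \<partial>M) \<longlongrightarrow> (\<integral>\<omega>. exp (- (\<Sum>u\<in>I. real (e u) * ?Z u \<omega>)) \<partial>M')) at_top"
        unfolding prod_exp[of "\<lambda>j i. ?pm (nat \<lfloor>t * j\<rfloor>) \<omega> i / a t" for t \<omega>]
          prod_exp[of "\<lambda>j i. enn2real (extreme_process \<Phi> j \<omega> i)" for \<omega>] X'_eq .
    qed (rule X_meas X'_meas)+
  qed
qed

end
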